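(* Let $n,m\ge 1$ and $d\ge 0$ be integers. For each multi-index $i=(i_1,\dots,i_m)\in\mathbb N^m$ with $0\le i_1+\dots+i_m\le d$ let $f_i:(\mathbb C^n,0)\to(\mathbb C^n,0)$ be a germ of holomorphic map of valuation larger than or equal to $2$ (i.e. $f_i(z)=O(z^2)$). Let $A\in GL_n(\mathbb C)$ be a fixed linear map with non-resonant eigenvalues, and for $t=(t_1,\dots,t_m)\in\mathbb C^m$ consider the holomorphic family of germs of holomorphic diffeomorphisms of $(\mathbb C^n,0)$ $$f_t(z)=Az+\sum_{i\in\mathbb N^m,\ 0\le i_1+\dots+i_m\le d}t^i f_i(z),\qquad t^i=t_1^{i_1}\cdots t_m^{i_m},$$ so that $A=D_0f_t$ for all $t$. Then all maps $f_t$, $t\in\mathbb C^m$, are formally linearizable: there exists a unique formal map $h_t$ with $h_t(0)=0$ and $D_0h_t=I$ such that the formal equation $h_t\circ f_t=A\circ h_t$ is satisfied. Moreover, we have the following dichotomy: 1) The family $(f_t)_{t\in\mathbb C^m}$ is holomorphically linearizable, that is, for all $t\in\mathbb C^m$, $h_t$ defines a germ of holomorphic diffeomorphism. Moreover, the radius of convergence $R(t)$ of the linearization $h_t$ is bounded from below on compact sets and, more precisely, for some $C_0>0$, $$R(t)\ge\frac{C_0}{1+\|t\|}.$$ 2) Except for an exceptional set $E\subset\mathbb C^m$ of $\Gamma$-capacity $0$ of values of $t$, $f_t$ is not holomorphically linearizable.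
   Context: Non-resonant: the eigenvalues $\lambda_1,\dots,\lambda_n$ of $A$, counted with multiplicity, are non-resonant if $\lambda_j-\lambda_1^{k_1}\cdots\lambda_n^{k_n}\ne0$ for all $1\le j\le n$ and all $(k_1,\dots,k_n)\in\mathbb N^n$ with $k_1+\dots+k_n\ge2$ (here $0\in\mathbb N$). $\Gamma$-capacity: for a subset of $\mathbb C$, $\mathrm{Cap}$ denotes the logarithmic capacity of potential theory; a set of capacity $0$ is called polar. For $E\subset\mathbb C^m$, $m\ge2$, the $\Gamma$-projection $\Gamma_m^{m-1}(E)$ is the set of $z\in\mathbb C^{m-1}$ such that $E\cap\{(z,w):w\in\mathbb C\}$ has positive capacity in the complex plane $\{(z,w):w\in\mathbb C\}$, and $\Gamma_m^1(E)=\Gamma_2^1\circ\Gamma_3^2\circ\cdots\circ\Gamma_m^{m-1}(E)\subset\mathbb C$ (for $m=1$, $\Gamma_1^1(E)=E$). Then $\Gamma\text{-Cap}(E)=\sup_{U\in U(m,\mathbb C)}\mathrm{Cap}\,\Gamma_m^1(U(E))$, where $U$ runs over all unitary transformations of $\mathbb C^m$.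
   Formalization: The bound R(t) ≥ C_0/(1+‖t‖) is replaced by R(t) ≥ C_0/(1+‖t‖)^max(1,d), the same for d ≤ 1; for d ≥ 2 the printed bound fails, e.g. for f_t(z) = z/2 + t^d z^2, where R(t) = R(1)/|t|^d with R(1) finite. *)

theory Defs
  imports "HOL-Analysis.Analysis" "HOL-Library.Landau_Symbols"
begin

section \<open>Formal power series in finitely many variables\<close>

text \<open>
  The variables are indexed by a finite type, so that a multi-index is a function from that
  type to the naturals.
\<close>

typedef ('a, 'n) mfps = "UNIV :: (('n::finite \<Rightarrow> nat) \<Rightarrow> 'a::comm_ring_1) set"
  morphisms mfps_nth Abs_mfps
  by simp

setup_lifting type_definition_mfps

lemma mfps_eqI: "(\<And>\<alpha>. mfps_nth P \<alpha> = mfps_nth Q \<alpha>) \<Longrightarrow> P = Q"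
  by (metis ext mfps_nth_inject)

definition splittings :: "('n \<Rightarrow> nat) \<Rightarrow> (('n \<Rightarrow> nat) \<times> ('n \<Rightarrow> nat)) set" where
  "splittings \<alpha> = {(\<beta>, \<gamma>). \<forall>j. \<beta> j + \<gamma> j = \<alpha> j}"

lemma finite_splittings [simp]: "finite (splittings (\<alpha> :: 'n::finite \<Rightarrow> nat))"
proof -
  let ?B = "PiE (UNIV :: 'n set) (\<lambda>j. {..\<alpha> j})"
  have "splittings \<alpha> \<subseteq> ?B \<times> ?B"
    by (auto simp: splittings_def PiE_iff) (metis le_add1, metis le_add2)
  moreover have "finite (?B \<times> ?B)"
    by (intro finite_cartesian_product finite_PiE) auto
  ultimately show ?thesis
    by (rule finite_subset)
qed

instantiation mfps :: (comm_ring_1, finite) comm_ring_1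
begin

lift_definition zero_mfps :: "('a, 'b) mfps" is "\<lambda>\<alpha>. 0" .

lift_definition one_mfps :: "('a, 'b) mfps" is "\<lambda>\<alpha>. if \<alpha> = (\<lambda>j. 0) then 1 else 0" .

lift_definition plus_mfps :: "('a, 'b) mfps \<Rightarrow> ('a, 'b) mfps \<Rightarrow> ('a, 'b) mfps"
  is "\<lambda>P Q \<alpha>. P \<alpha> + Q \<alpha>" .

lift_definition minus_mfps :: "('a, 'b) mfps \<Rightarrow> ('a, 'b) mfps \<Rightarrow> ('a, 'b) mfps"
  is "\<lambda>P Q \<alpha>. P \<alpha> - Q \<alpha>" .

lift_definition uminus_mfps :: "('a, 'b) mfps \<Rightarrow> ('a, 'b) mfps" is "\<lambda>P \<alpha>. - P \<alpha>" .

lift_definition times_mfps :: "('a, 'b) mfps \<Rightarrow> ('a, 'b) mfps \<Rightarrow> ('a, 'b) mfps"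
  is "\<lambda>P Q \<alpha>. \<Sum>(\<beta>, \<gamma>)\<in>splittings \<alpha>. P \<beta> * Q \<gamma>" .

instance
proof
  fix P Q R :: "('a, 'b) mfps"
  show "P + Q + R = P + (Q + R)" by transfer (simp add: add.assoc)
  show "P + Q = Q + P" by transfer (simp add: add.commute)
  show "0 + P = P" by transfer simp
  show "- P + P = 0" by transfer simp
  show "P - Q = P + - Q" by transfer simp
  show "(0 :: ('a, 'b) mfps) \<noteq> 1" by transfer (auto simp: fun_eq_iff)
  show "(P + Q) * R = P * R + Q * R"
    by transfer (simp add: case_prod_unfold distrib_right sum.distrib)
  show "1 * P = P"
  proof (transfer, rule ext)
    fix P :: "('b \<Rightarrow> nat) \<Rightarrow> 'a" and \<alpha>
    have "(\<Sum>(\<beta>, \<gamma>)\<in>splittings \<alpha>. (if \<beta> = (\<lambda>j. 0) then 1 else 0) * P \<gamma>)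
        = (\<Sum>(\<beta>, \<gamma>)\<in>{((\<lambda>j. 0) :: 'b \<Rightarrow> nat, \<alpha>)}. (if \<beta> = (\<lambda>j. 0) then 1 else 0) * P \<gamma>)"
      by (rule sum.mono_neutral_right, simp)
        (auto simp: splittings_def simp flip: fun_eq_iff split: if_splits)
    then show "(\<Sum>(\<beta>, \<gamma>)\<in>splittings \<alpha>. (if \<beta> = (\<lambda>j. 0) then 1 else 0) * P \<gamma>) = P \<alpha>"
      by simp
  qed
  show "P * Q = Q * P"
  proof (transfer, rule ext)
    fix P Q :: "('b \<Rightarrow> nat) \<Rightarrow> 'a" and \<alpha>
    show "(\<Sum>(\<beta>, \<gamma>)\<in>splittings \<alpha>. P \<beta> * Q \<gamma>) = (\<Sum>(\<beta>, \<gamma>)\<in>splittings \<alpha>. Q \<beta> * P \<gamma>)"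
      by (rule sum.reindex_bij_witness[where i = prod.swap and j = prod.swap])
        (auto simp: splittings_def add.commute mult.commute)
  qed
  show "P * Q * R = P * (Q * R)"
  proof (transfer, rule ext)
    fix P Q R :: "('b \<Rightarrow> nat) \<Rightarrow> 'a" and \<alpha>
    have "(\<Sum>(\<beta>, \<gamma>)\<in>splittings \<alpha>. (\<Sum>(\<delta>, \<epsilon>)\<in>splittings \<beta>. P \<delta> * Q \<epsilon>) * R \<gamma>)
        = (\<Sum>(p, q)\<in>(SIGMA p:splittings \<alpha>. splittings (fst p)). P (fst q) * Q (snd q) * R (snd p))"
      by (simp add: sum.Sigma sum_distrib_right case_prod_unfold)
    also have "\<dots> = (\<Sum>(p, q)\<in>(SIGMA p:splittings \<alpha>. splittings (snd p)).
        P (fst p) * (Q (fst q) * R (snd q)))"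
      by (rule sum.reindex_bij_witness[where
            j = "\<lambda>(p, q). ((fst q, \<lambda>j. snd q j + snd p j), (snd q, snd p))" and
            i = "\<lambda>(p, q). ((\<lambda>j. fst p j + fst q j, snd q), (fst p, fst q))"])
        (auto simp: splittings_def mult.assoc fun_eq_iff, metis add.assoc, metis add.assoc)
    also have "\<dots> = (\<Sum>(\<beta>, \<gamma>)\<in>splittings \<alpha>. P \<beta> * (\<Sum>(\<delta>, \<epsilon>)\<in>splittings \<gamma>. Q \<delta> * R \<epsilon>))"
      by (simp add: sum.Sigma sum_distrib_left case_prod_unfold)
    finally show "(\<Sum>(\<beta>, \<gamma>)\<in>splittings \<alpha>. (\<Sum>(\<delta>, \<epsilon>)\<in>splittings \<beta>. P \<delta> * Q \<epsilon>) * R \<gamma>)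
        = (\<Sum>(\<beta>, \<gamma>)\<in>splittings \<alpha>. P \<beta> * (\<Sum>(\<delta>, \<epsilon>)\<in>splittings \<gamma>. Q \<delta> * R \<epsilon>))" .
  qed
qed

end

lift_definition mfps_const :: "'a::comm_ring_1 \<Rightarrow> ('a, 'n::finite) mfps"
  is "\<lambda>c \<alpha>. if \<alpha> = (\<lambda>j. 0) then c else 0" .

text \<open>
  A formal map of \<open>n\<close>-space is a vector of series. If every component of \<open>F\<close> has zero constant
  term, then \<open>F\<^sup>\<beta>\<close> has no terms of degree less than \<open>|\<beta>|\<close>, so only the finitely many \<open>\<beta>\<close> with
  \<open>|\<beta>| \<le> |\<alpha>|\<close> contribute to the coefficient of \<open>\<alpha>\<close> in the composition; the definition is
  meaningful only for such \<open>F\<close>.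
\<close>

definition mfps_comp ::
    "('a::comm_ring_1, 'n::finite) mfps ^ 'n \<Rightarrow> ('a, 'n) mfps ^ 'n \<Rightarrow> ('a, 'n) mfps ^ 'n" where
  "mfps_comp h F = (\<chi> i. Abs_mfps (\<lambda>\<alpha>.
     \<Sum>\<beta> | (\<Sum>j\<in>UNIV. \<beta> j) \<le> (\<Sum>j\<in>UNIV. \<alpha> j).
       mfps_nth (h $ i) \<beta> * mfps_nth (\<Prod>j\<in>UNIV. (F $ j) ^ \<beta> j) \<alpha>))"


section \<open>Holomorphic germs at the origin\<close>

definition holomorphic_germ :: "(complex ^ 'n \<Rightarrow> complex ^ 'n) \<Rightarrow> bool" where
  "holomorphic_germ f \<longleftrightarrow>
     (\<forall>\<^sub>F z in nhds 0. \<exists>J :: complex ^ 'n ^ 'n. (f has_derivative (\<lambda>v. J *v v)) (at z))"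

definition diffeo_germ :: "(complex ^ 'n \<Rightarrow> complex ^ 'n) \<Rightarrow> bool" where
  "diffeo_germ H \<longleftrightarrow> holomorphic_germ H \<and> H 0 = 0 \<and>
     (\<exists>G. holomorphic_germ G \<and> G 0 = 0 \<and> (\<forall>\<^sub>F z in nhds 0. G (H z) = z \<and> H (G z) = z))"

definition monomial :: "complex ^ 'n \<Rightarrow> ('n \<Rightarrow> nat) \<Rightarrow> complex" where
  "monomial z \<alpha> = (\<Prod>j\<in>UNIV. (z $ j) ^ \<alpha> j)"

definition has_mfps_expansion ::
    "(complex ^ 'n \<Rightarrow> complex ^ 'n) \<Rightarrow> (complex, 'n) mfps ^ 'n \<Rightarrow> bool"
    (infixl "has'_mfps'_expansion" 60) where
  "f has_mfps_expansion F \<longleftrightarrow>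
     (\<forall>\<^sub>F z in nhds 0. \<forall>i. ((\<lambda>\<alpha>. mfps_nth (F $ i) \<alpha> * monomial z \<alpha>) has_sum f z $ i) UNIV)"

definition taylor_series :: "(complex ^ 'n \<Rightarrow> complex ^ 'n) \<Rightarrow> (complex, 'n) mfps ^ 'n" where
  "taylor_series f = (THE F. f has_mfps_expansion F)"

text \<open>Balls are taken in the Euclidean (Hermitian) norm.\<close>

definition mfps_conv_radius :: "(complex, 'n::finite) mfps ^ 'n \<Rightarrow> ereal" where
  "mfps_conv_radius F = Sup {ereal r | r. 0 \<le> r \<and>
     (\<forall>z. norm z < r \<longrightarrow> (\<forall>i. (\<lambda>\<alpha>. mfps_nth (F $ i) \<alpha> * monomial z \<alpha>) summable_on UNIV))}"

definition defines_diffeo_germ :: "(complex, 'n::finite) mfps ^ 'n \<Rightarrow> bool" where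
  "defines_diffeo_germ h \<longleftrightarrow> (\<exists>H. diffeo_germ H \<and> H has_mfps_expansion h)"


section \<open>Formal linearization\<close>

definition eigenvalues_with_multiplicity :: "complex ^ 'n ^ 'n \<Rightarrow> ('n \<Rightarrow> complex) \<Rightarrow> bool" where
  "eigenvalues_with_multiplicity A ev \<longleftrightarrow> (\<forall>x. det (mat x - A) = (\<Prod>j\<in>UNIV. x - ev j))"

definition non_resonant :: "('n::finite \<Rightarrow> complex) \<Rightarrow> bool" where
  "non_resonant ev \<longleftrightarrow>
     (\<forall>j k. (\<Sum>i\<in>UNIV. k i) \<ge> (2 :: nat) \<longrightarrow> ev j - (\<Prod>i\<in>UNIV. ev i ^ k i) \<noteq> 0)"

definition formal_linearization ::
    "complex ^ 'n ^ 'n \<Rightarrow> (complex ^ 'n \<Rightarrow> complex ^ 'n) \<Rightarrow> (complex, 'n) mfps ^ 'n \<Rightarrow> bool" where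
  "formal_linearization A f h \<longleftrightarrow>
     (\<forall>i. mfps_nth (h $ i) (\<lambda>_. 0) = 0) \<and>
     (\<forall>i j. mfps_nth (h $ i) ((\<lambda>_. 0)(j := 1)) = (if i = j then 1 else 0)) \<and>
     mfps_comp h (taylor_series f) = map_matrix mfps_const A *v h"


section \<open>Complex space with a variable number of coordinates\<close>

text \<open>
  The dimension of the parameter space changes in the iterated projections below, so its points
  are sequences vanishing from index \<open>m\<close> on. With the product topology on functions, this
  is homeomorphic to the usual complex \<open>m\<close>-space.
\<close>

definition cspace :: "nat \<Rightarrow> (nat \<Rightarrow> complex) set" where
  "cspace m = {t. \<forall>j\<ge>m. t j = 0}"

definition cspace_norm :: "nat \<Rightarrow> (nat \<Rightarrow> complex) \<Rightarrow> real" where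
  "cspace_norm m t = L2_set (\<lambda>j. cmod (t j)) {..<m}"

definition multi_indices :: "nat \<Rightarrow> nat \<Rightarrow> (nat \<Rightarrow> nat) set" where
  "multi_indices m d = {i. (\<forall>j\<ge>m. i j = 0) \<and> (\<Sum>j<m. i j) \<le> d}"

definition unitary :: "nat \<Rightarrow> (nat \<Rightarrow> nat \<Rightarrow> complex) \<Rightarrow> bool" where
  "unitary m u \<longleftrightarrow> (\<forall>i<m. \<forall>j<m. (\<Sum>k<m. u i k * cnj (u j k)) = (if i = j then 1 else 0))"

definition mat_apply ::
    "nat \<Rightarrow> (nat \<Rightarrow> nat \<Rightarrow> complex) \<Rightarrow> (nat \<Rightarrow> complex) \<Rightarrow> nat \<Rightarrow> complex" where
  "mat_apply m u t = (\<lambda>j. if j < m then \<Sum>k<m. u j k * t k else 0)"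


section \<open>Capacities\<close>

text \<open>
  The energy of a measure is the double integral of \<open>log |z - w|\<close>, which is \<open>-\<infinity>\<close> on the
  diagonal (whereas \<open>ln 0 = 0\<close> in HOL). It is computed as the integral of the positive part
  minus that of the negative part (note that \<^const>\<open>e2ennreal\<close> sends negative numbers to 0);
  for a finite measure of bounded support the former is finite. The capacity of an
  arbitrary set is the inner one, i.e. the supremum of \<open>exp\<close> of the energy over all Borel
  probability measures carried by a compact subset.
\<close>

definition log_kernel :: "complex \<Rightarrow> complex \<Rightarrow> ereal" where
  "log_kernel z w = (if z = w then -\<infinity> else ereal (ln (cmod (z - w))))"

definition log_energy :: "complex measure \<Rightarrow> ereal" where
  "log_energy \<mu> =
     enn2ereal (\<integral>\<^sup>+z. \<integral>\<^sup>+w. e2ennreal (log_kernel z w) \<partial>\<mu> \<partial>\<mu>) -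
     enn2ereal (\<integral>\<^sup>+z. \<integral>\<^sup>+w. e2ennreal (- log_kernel z w) \<partial>\<mu> \<partial>\<mu>)"

definition exp_ereal :: "ereal \<Rightarrow> ennreal" where
  "exp_ereal x = (if x = \<infinity> then \<infinity> else if x = -\<infinity> then 0 else ennreal (exp (real_of_ereal x)))"

definition log_capacity :: "complex set \<Rightarrow> ennreal" where
  "log_capacity E = Sup {exp_ereal (log_energy \<mu>) | \<mu> K.
     compact K \<and> K \<subseteq> E \<and> sets \<mu> = sets borel \<and> emeasure \<mu> UNIV = 1 \<and> emeasure \<mu> (- K) = 0}"

definition Gamma_step :: "nat \<Rightarrow> (nat \<Rightarrow> complex) set \<Rightarrow> (nat \<Rightarrow> complex) set" where
  "Gamma_step k E = {z \<in> cspace k. log_capacity {w. z(k := w) \<in> E} > 0}"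

text \<open>
  The step \<open>Gamma_step k\<close> goes from dimension \<open>k + 1\<close> to dimension \<open>k\<close>, so
  \<open>Gamma_iter k\<close> goes from dimension \<open>k + 1\<close> to dimension 1.
\<close>

fun Gamma_iter :: "nat \<Rightarrow> (nat \<Rightarrow> complex) set \<Rightarrow> (nat \<Rightarrow> complex) set" where
  "Gamma_iter 0 E = E"
| "Gamma_iter (Suc k) E = Gamma_iter k (Gamma_step (Suc k) E)"

definition Gamma_proj :: "nat \<Rightarrow> (nat \<Rightarrow> complex) set \<Rightarrow> complex set" where
  "Gamma_proj m E = (\<lambda>z. z 0) ` Gamma_iter (m - 1) E"

definition Gamma_capacity :: "nat \<Rightarrow> (nat \<Rightarrow> complex) set \<Rightarrow> ennreal" where
  "Gamma_capacity m E = (SUP u\<in>{u. unitary m u}. log_capacity (Gamma_proj m (mat_apply m u ` E)))"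


section \<open>The family\<close>

text \<open>
  The coefficients of degree \<open>k\<close> of the linearization of \<open>family A m d f t\<close> are polynomials in \<open>t\<close>
  of degree at most \<open>d * (k - 1)\<close>, so the radius of convergence decays like the \<open>d\<close>-th power of
  \<open>1 / norm t\<close>. No smaller power suffices: the germ \<open>z/2 + t\<^sup>d z\<^sup>2\<close> is conjugate to
  \<open>z/2 + z\<^sup>2\<close> by a scaling of ratio \<open>t\<^sup>d\<close>.
\<close>

definition family ::
    "complex ^ 'n ^ 'n \<Rightarrow> nat \<Rightarrow> nat \<Rightarrow> ((nat \<Rightarrow> nat) \<Rightarrow> complex ^ 'n \<Rightarrow> complex ^ 'n) \<Rightarrow>
      (nat \<Rightarrow> complex) \<Rightarrow> complex ^ 'n \<Rightarrow> complex ^ 'n" where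
  "family A m d f t z = A *v z + (\<Sum>i\<in>multi_indices m d. (\<Prod>j<m. t j ^ i j) *s f i z)"

definition linearization ::
    "complex ^ 'n ^ 'n \<Rightarrow> (complex ^ 'n \<Rightarrow> complex ^ 'n) \<Rightarrow> (complex, 'n) mfps ^ 'n" where
  "linearization A f = (THE h. formal_linearization A f h)"

end

theory Submission
  imports Defs "HOL-Complex_Analysis.Complex_Analysis"
    "HOL-Computational_Algebra.Fundamental_Theorem_Algebra"
begin

text \<open>
  Non-resonance makes the homological operator \<open>g \<mapsto> g \<circ> A - A g\<close> invertible on homogeneous maps
  of every degree \<open>k \<ge> 2\<close>: its generalized eigenvalues are the differences
  \<open>\<lambda>\<^sup>\<alpha> - \<lambda>\<^sub>j\<close> with \<open>|\<alpha>| = k\<close>. Hence the linearization exists, is unique, and its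
  coefficients of degree \<open>k\<close> are polynomials in \<open>t\<close> of degree at most \<open>d (k - 1)\<close>.
  If the germs converge on a set of parameters of positive capacity, these coefficients are
  geometrically bounded on a subset of positive capacity, and the Bernstein-Walsh inequality,
  applied to one coordinate of \<open>t\<close> at a time, spreads a geometric bound to all parameters.
\<close>

text \<open>Two non-uniformities shape the proof. The rate of convergence is not controlled by the
  parameter, so the convergent parameters are exhausted by countably many closed sets, one per
  integer rate. A measure of finite energy has a part of positive mass and bounded potential on a
  compact subset of one of them, and the growth inequality needs no more. Next, the constant found
  on a slice depends on the slice without control. Dividing each polynomial by
  \<open>(1 + cmod w) ^ (d * k)\<close>, for every value \<open>w\<close> of the eliminated
  coordinate, turns the slice estimate into a geometric bound at a point of one dimension less, so
  the argument iterates along the Gamma-projections. The degree \<open>d * (k - 1)\<close> comes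
  from giving a term of order k in z the weight k - 1: weights add up under composition, and each
  nonlinear term of the family has degree at most d in t and weight at least 1. As the matrix need
  not be diagonalizable, the spectrum of the homological operator is found by a product rule for
  generalized eigenspaces. The two cases exclude each other because the whole parameter space has
  positive Gamma-capacity.\<close>

no_notation fps_nth (infixl "$" 75)

section \<open>Capacity and polynomial growth\<close>

text \<open>This is log 1/|z - w| truncated at 0. Potentials become nonnegative integrals, and only
  the finiteness of the double integral of \<open>neglog\<close> decides whether the energy is
  -infinity.\<close>

definition neglog :: "complex \<Rightarrow> complex \<Rightarrow> ennreal" where
  "neglog z w = e2ennreal (- log_kernel z w)"

lemma neglog_eq: "neglog z w = (if z = w then \<infinity> else ennreal (- ln (cmod (z - w))))"
  by (auto simp: neglog_def log_kernel_def e2ennreal_infty simp flip: e2ennreal_ereal)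

lemma measurable_neglog [measurable]:
  assumes [measurable]: "f \<in> borel_measurable M" "g \<in> borel_measurable M"
  shows "(\<lambda>x. neglog (f x) (g x)) \<in> borel_measurable M"
proof -
  have "(\<lambda>x. neglog (f x) (g x)) =
      (\<lambda>x. if cmod (f x - g x) = 0 then \<infinity> else ennreal (- ln (cmod (f x - g x))))"
    by (auto simp: neglog_eq)
  then show ?thesis by simp
qed

text \<open>The positive part of the kernel is bounded on the compact carrier, so its double
  integral is finite; an energy other than -infinity then forces the negative part to be finite. The
  order matters, since infinity minus infinity is infinity in \<open>ereal\<close>.\<close>

lemma finite_energy_measure:
  assumes "log_capacity E > 0"
  obtains \<mu> K where "compact K" "K \<subseteq> E" "sets \<mu> = sets borel" "emeasure \<mu> UNIV = 1"
    "emeasure \<mu> (- K) = 0" "(\<integral>\<^sup>+z. \<integral>\<^sup>+w. neglog z w \<partial>\<mu> \<partial>\<mu>) < \<infinity>"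
proof -
  obtain \<mu> K where *: "compact K" "K \<subseteq> E" "sets \<mu> = sets borel" "emeasure \<mu> UNIV = 1"
      "emeasure \<mu> (- K) = 0" and pos: "exp_ereal (log_energy \<mu>) > 0"
    using assms unfolding log_capacity_def less_Sup_iff by blast
  have sp: "space \<mu> = UNIV" using sets_eq_imp_space_eq[OF *(3)] by simp
  have AEK: "AE z in \<mu>. z \<in> K"
    by (rule AE_I[of _ _ "- K"]) (use * sp compact_imp_closed[of K] in auto)
  obtain R where R: "\<And>z. z \<in> K \<Longrightarrow> norm z \<le> R" "R > 0"
    using compact_imp_bounded[OF *(1)] bounded_pos by blast
  define B where "B = ennreal (ln (2 * R + 1))"
  have pt: "e2ennreal (log_kernel z w) \<le> B" if "z \<in> K" "w \<in> K" for z w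
  proof (cases "z = w")
    case False
    have "cmod (z - w) \<le> 2 * R + 1" using norm_triangle_ineq4[of z w] R(1)[of z] R(1)[of w] that by linarith
    then have "ln (cmod (z - w)) \<le> ln (2 * R + 1)" using False R(2) by (subst ln_le_cancel_iff) auto
    then show ?thesis using False by (simp add: log_kernel_def B_def ennreal_leI)
  qed (simp add: log_kernel_def e2ennreal_neg)
  have "(\<integral>\<^sup>+z. \<integral>\<^sup>+w. e2ennreal (log_kernel z w) \<partial>\<mu> \<partial>\<mu>) \<le> (\<integral>\<^sup>+z. \<integral>\<^sup>+w. B \<partial>\<mu> \<partial>\<mu>)"
  proof (rule nn_integral_mono_AE)
    show "AE z in \<mu>. (\<integral>\<^sup>+w. e2ennreal (log_kernel z w) \<partial>\<mu>) \<le> (\<integral>\<^sup>+w. B \<partial>\<mu>)"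
      using AEK
    proof (eventually_elim)
      case (elim z)
      show ?case by (rule nn_integral_mono_AE) (use AEK in eventually_elim, use pt elim in auto)
    qed
  qed
  also have "\<dots> = B" using *(4) sp by simp
  finally have "(\<integral>\<^sup>+z. \<integral>\<^sup>+w. e2ennreal (log_kernel z w) \<partial>\<mu> \<partial>\<mu>) < \<infinity>"
    by (simp add: B_def order_le_less_trans)
  moreover have "log_energy \<mu> \<noteq> -\<infinity>" using pos by (auto simp: exp_ereal_def)
  ultimately have "(\<integral>\<^sup>+z. \<integral>\<^sup>+w. neglog z w \<partial>\<mu> \<partial>\<mu>) < \<infinity>"
    unfolding log_energy_def neglog_def[symmetric]
    by (cases "\<integral>\<^sup>+z. \<integral>\<^sup>+w. e2ennreal (log_kernel z w) \<partial>\<mu> \<partial>\<mu>";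
        cases "\<integral>\<^sup>+z. \<integral>\<^sup>+w. neglog z w \<partial>\<mu> \<partial>\<mu>") (auto simp: less_top[symmetric])
  with * that show ?thesis by blast
qed

text \<open>Compares the potential at \<open>z\<close> with that at a nearest point
  \<open>z'\<close> of a compact set: for \<open>w\<close> in the set, |z' - w| is at most |z' - z|
  + |z - w|, hence at most twice |z - w|.\<close>

lemma neglog_le_double:
  assumes "cmod (z' - w) \<le> 2 * cmod (z - w)"
  shows "neglog z w \<le> neglog z' w + ennreal (ln 2)"
proof (cases "z = w \<or> z' = w")
  case True
  then show ?thesis using assms by (auto simp: neglog_eq)
next
  case False
  then have "ln (cmod (z' - w)) \<le> ln (2 * cmod (z - w))"
    using assms by (subst ln_le_cancel_iff) auto
  also have "\<dots> = ln 2 + ln (cmod (z - w))" using False by (subst ln_mult) auto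
  finally have "- ln (cmod (z - w)) \<le> - ln (cmod (z' - w)) + ln 2" by simp
  then have "ennreal (- ln (cmod (z - w))) \<le> ennreal (max 0 (- ln (cmod (z' - w))) + ln 2)"
    by (intro ennreal_leI) auto
  also have "\<dots> = ennreal (- ln (cmod (z' - w))) + ennreal (ln 2)"
    by (subst ennreal_plus) (auto simp: max_def ennreal_neg)
  finally show ?thesis using False by (simp add: neglog_eq)
qed

text \<open>The factor is normalized by 1 + |z| so that one constant serves roots near and far. If
  |w - z| is at least 1, then 1 + |z| is at most (R + 2)|w - z|; otherwise |z| < R + 1, the quotient
  is at most 1, and the exponential alone suffices.\<close>

lemma cmod_ge_exp_neglog:
  assumes "neglog z w = ennreal c" "c \<ge> 0" "cmod w \<le> R"
  shows "cmod (w - z) \<ge> (1 + cmod z) / (R + 2) * exp (- c)"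
proof -
  have ne: "z \<noteq> w" using assms by (auto simp: neglog_eq)
  have R: "R \<ge> 0" using assms(3) norm_ge_zero order_trans by blast
  have t: "cmod z \<le> R + cmod (w - z)"
    using norm_triangle_ineq4[of w "w - z"] assms(3) by simp
  have c: "- ln (cmod (w - z)) \<le> c"
  proof (cases "- ln (cmod (w - z)) \<ge> 0")
    case True
    have "ennreal (- ln (cmod (w - z))) = ennreal c"
      using assms(1) ne by (simp add: neglog_eq norm_minus_commute[of z])
    then show ?thesis using ennreal_inj[OF True assms(2)] by blast
  qed (use assms(2) in linarith)
  have e: "exp (- c) \<le> cmod (w - z)" using c ne
    by (metis exp_le_cancel_iff exp_ln minus_le_iff right_minus_eq zero_less_norm_iff)
  show ?thesis
  proof (cases "cmod (w - z) \<ge> 1")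
    case True
    have "1 + cmod z \<le> (R + 2) * cmod (w - z)"
      using t mult_left_mono[OF True R] True by (simp add: algebra_simps)
    then have "(1 + cmod z) / (R + 2) \<le> cmod (w - z)" using R by (simp add: field_simps)
    moreover have "exp (- c) \<le> 1" using assms(2) by simp
    ultimately have "(1 + cmod z) / (R + 2) * exp (- c) \<le> cmod (w - z) * 1"
      using R by (intro mult_mono) auto
    then show ?thesis by simp
  next
    case False
    then have "(1 + cmod z) / (R + 2) \<le> 1" using t R by (simp add: field_simps)
    then have "(1 + cmod z) / (R + 2) * exp (- c) \<le> 1 * exp (- c)" by (intro mult_right_mono) auto
    with e show ?thesis by simp
  qed
qed

text \<open>
  The potential is bounded on \<open>X\<close> by the choice of \<open>X\<close>, and elsewhere by comparison with a nearest
  point of \<open>X\<close>.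
\<close>

lemma bounded_potential_subset:
  assumes "log_capacity E > 0" "E \<subseteq> (\<Union>N::nat. W N)" "\<And>N. closed (W N)"
  obtains \<mu> X N B where "compact X" "X \<subseteq> W N" "sets \<mu> = sets borel" "emeasure \<mu> X > 0"
    "emeasure \<mu> UNIV = 1" "0 < B" "\<And>z. (\<integral>\<^sup>+w. neglog z w * indicator X w \<partial>\<mu>) \<le> ennreal B"
proof -
  obtain \<mu> K where *: "compact K" "K \<subseteq> E" "sets \<mu> = sets borel" "emeasure \<mu> UNIV = 1"
      "emeasure \<mu> (- K) = 0" and fin: "(\<integral>\<^sup>+z. \<integral>\<^sup>+w. neglog z w \<partial>\<mu> \<partial>\<mu>) < \<infinity>"
    using finite_energy_measure[OF assms(1)] .
  have sp: "space \<mu> = UNIV" using sets_eq_imp_space_eq[OF *(3)] by simp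
  note [measurable_cong] = *(3)
  interpret finite_measure \<mu> by standard (simp add: sp *(4))
  define g where "g z = (\<integral>\<^sup>+w. neglog z w \<partial>\<mu>)" for z
  have [measurable]: "g \<in> borel_measurable \<mu>"
    unfolding g_def by measurable
  have "AE z in \<mu>. g z \<noteq> \<infinity>"
    by (rule nn_integral_PInf_AE) (use fin g_def in auto)
  moreover have AEK: "AE z in \<mu>. z \<in> K"
    by (rule AE_I[of _ _ "- K"]) (use * sp compact_imp_closed[of K] in auto)
  \<comment> \<open>Up to a null set these countably many sets cover \<open>K\<close>: the
    \<open>W N\<close> cover \<open>E\<close>, and finite energy makes the potential
    \<open>g\<close> finite almost everywhere. Hence one of them has positive measure.\<close>
  define Y where "Y = (\<lambda>(N, M). {z \<in> K \<inter> W N. g z \<le> of_nat M})"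
  have Kb: "K \<in> sets borel" using compact_imp_closed[OF *(1)] by auto
  have Ym [measurable]: "Y p \<in> sets \<mu>" for p
  proof -
    obtain N M where p: "p = (N, M)" by (cases p)
    have [measurable]: "K \<in> sets \<mu>" "W N \<in> sets \<mu>" using Kb assms(3) *(3) by auto
    have "Y p = {z \<in> space \<mu>. z \<in> K \<and> z \<in> W N \<and> g z \<le> of_nat M}" by (auto simp: Y_def p sp)
    also have "\<dots> \<in> sets \<mu>" by measurable
    finally show ?thesis .
  qed
  have Yb: "Y p \<in> sets borel" for p using Ym[of p] unfolding *(3) .
  have "\<exists>p. emeasure \<mu> (Y p) \<noteq> 0"
  proof (rule ccontr)
    assume "\<not> ?thesis"
    then have "(\<Union>p. Y p) \<in> null_sets \<mu>" by (intro null_sets_UN) auto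
    then have "AE z in \<mu>. z \<notin> (\<Union>p. Y p)" by (rule AE_not_in)
    then have "AE z in \<mu>. False"
      using AEK \<open>AE z in \<mu>. g z \<noteq> \<infinity>\<close>
    proof eventually_elim
      case (elim z)
      obtain N where "z \<in> W N" using elim *(2) assms(2) by blast
      moreover obtain M where "g z \<le> of_nat M"
        using elim(3) ennreal_Ex_less_of_nat[of "g z"]
        by (metis infinity_ennreal_def less_imp_le less_top)
      ultimately show ?case using elim by (auto simp: Y_def)
    qed
    then show False using *(4) sp by (auto simp: AE_iff_null null_sets_def)
  qed
  then obtain N M where NM: "emeasure \<mu> (Y (N, M)) > 0"
    by (metis surj_pair zero_less_iff_neq_zero)
  \<comment> \<open>Inner regularity replaces the Borel set by a compact one, in which nearest
    points exist.\<close>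
  have "emeasure \<mu> (Y (N, M)) = (SUP K\<in>{K. K \<subseteq> Y (N, M) \<and> compact K}. emeasure \<mu> K)"
    by (rule inner_regular) (use *(3) Yb in auto)
  with NM obtain X where X: "X \<subseteq> Y (N, M)" "compact X" "emeasure \<mu> X > 0"
    by (auto simp: less_SUP_iff)
  have Xne: "X \<noteq> {}" using X by auto
  have [measurable]: "X \<in> sets \<mu>" using compact_imp_closed[OF X(2)] *(3) by auto
  have "(\<integral>\<^sup>+w. neglog z w * indicator X w \<partial>\<mu>) \<le> ennreal (M + ln 2)" for z
  proof -
    obtain z' where z': "z' \<in> X" "\<And>w. w \<in> X \<Longrightarrow> dist z z' \<le> dist z w"
      using distance_attains_inf[OF compact_imp_closed[OF X(2)] Xne] by blast
    have "(\<integral>\<^sup>+w. neglog z w * indicator X w \<partial>\<mu>) \<le> (\<integral>\<^sup>+w. neglog z' w + ennreal (ln 2) \<partial>\<mu>)"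
    proof (rule nn_integral_mono)
      fix w
      show "neglog z w * indicator X w \<le> neglog z' w + ennreal (ln 2)"
      proof (cases "w \<in> X")
        case True
        have "cmod (z' - w) \<le> 2 * cmod (z - w)"
          using z'(2)[OF True] dist_triangle3[of z' w z] by (simp add: dist_norm)
        with True show ?thesis by (simp add: neglog_le_double)
      qed simp
    qed
    also have "\<dots> = g z' + ennreal (ln 2)"
      unfolding g_def using *(4) sp by (subst nn_integral_add) auto
    also have "\<dots> \<le> of_nat M + ennreal (ln 2)"
      using z'(1) X(1) by (intro add_mono) (auto simp: Y_def)
    also have "\<dots> = ennreal (M + ln 2)" by (simp add: ennreal_of_nat_eq_real_of_nat)
    finally show ?thesis .
  qed
  moreover have "real M + ln 2 > 0" by (simp add: add_nonneg_pos)
  moreover have "X \<subseteq> W N" using X by (auto simp: Y_def)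
  ultimately show ?thesis using that X *(3,4) by blast
qed

text \<open>
  Averaging the logarithms of the distances to the roots \<open>a\<close> of \<open>p\<close> gives a point \<open>v\<close> of \<open>X\<close> at
  which \<open>\<Prod>(1 + |a|)\<close> is at most \<open>C\<close> to the degree times \<open>\<Prod>|v - a|\<close>; this replaces the
  Green function of \<open>X\<close>.
\<close>

lemma bernstein_walsh:
  assumes "log_capacity E > 0" "E \<subseteq> (\<Union>N::nat. W N)" "\<And>N. closed (W N)"
  shows "\<exists>N. \<exists>C\<ge>1. \<forall>p D M w. degree p \<le> D \<longrightarrow> (\<forall>v\<in>W N. cmod (poly p v) \<le> M) \<longrightarrow>
      cmod (poly p w) \<le> M * (C * (1 + cmod w)) ^ D"
proof -
  have [measurable]: "(\<lambda>x. \<Sum>a\<leftarrow>as. neglog a x) \<in> borel_measurable \<mu>"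
    if [measurable_cong]: "sets \<mu> = sets borel" for \<mu> as
    by (induction as) auto
  obtain \<mu> :: "complex measure" and X N and B :: real
    where X: "compact X" "X \<subseteq> W N" "sets \<mu> = sets borel" "emeasure \<mu> X > 0"
    "emeasure \<mu> UNIV = 1" "0 < B" "\<And>z. (\<integral>\<^sup>+w. neglog z w * indicator X w \<partial>\<mu>) \<le> ennreal B"
    by (rule bounded_potential_subset[where W = W, OF assms]) (rule that)
  have sp: "space \<mu> = UNIV" using sets_eq_imp_space_eq[OF X(3)] by simp
  note [measurable_cong] = X(3)
  have [measurable]: "X \<in> sets \<mu>" using compact_imp_closed[OF X(1)] X(3) by auto
  obtain R where R: "\<And>z. z \<in> X \<Longrightarrow> norm z \<le> R" "R > 0"
    using compact_imp_bounded[OF X(1)] bounded_pos by blast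
  define b where "b = measure \<mu> X"
  have "emeasure \<mu> X \<le> 1" using X(5) emeasure_mono[of X UNIV \<mu>] sp by (metis sets.top top_greatest)
  then have b: "emeasure \<mu> X = ennreal b" "b > 0"
  proof -
    have "emeasure \<mu> X \<noteq> top" using \<open>emeasure \<mu> X \<le> 1\<close> by (auto simp: top_unique)
    then show "emeasure \<mu> X = ennreal b" unfolding b_def by (rule emeasure_eq_ennreal_measure)
    with X(4) show "b > 0" by simp
  qed
  \<comment> \<open>The loss per root: \<open>R + 2\<close> comes from
    \<open>cmod_ge_exp_neglog\<close>, \<open>B / b\<close> bounds the mean potential over
    \<open>X\<close>, and the factor 2 makes the averaging argument strict.\<close>
  define C where "C = (R + 2) * exp (2 * B / b)"
  have C1: "C \<ge> 1"
  proof -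
    have "1 * 1 \<le> (R + 2) * exp (2 * B / b)"
      using R b X(6) by (intro mult_mono) auto
    then show ?thesis by (simp add: C_def)
  qed
  have key: "cmod (poly p w) \<le> M * (C * (1 + cmod w)) ^ D"
    if deg: "degree p \<le> D" and bd: "\<And>v. v \<in> W N \<Longrightarrow> cmod (poly p v) \<le> M" for p D M w
  proof (cases "p = 0")
    case True
    obtain v where "v \<in> X" using X(4) by fastforce
    then have "M \<ge> 0" using bd[of v] X(2) True by auto
    then show ?thesis using True C1 by simp
  next
    case False
    obtain A where A: "size A = degree p" "p = smult (lead_coeff p) (\<Prod>x\<in>#A. [:- x, 1:])"
      using alg_closed_imp_factorization[OF False] by blast
    obtain as where as: "A = mset as" using ex_mset by metis
    have len: "length as = degree p" using A as by simp
    have pp: "cmod (poly p v) = cmod (lead_coeff p) * (\<Prod>a\<leftarrow>as. cmod (v - a))" for v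
    proof -
      have "poly (\<Prod>x\<in>#mset as. [:- x, 1:]) v = (\<Prod>a\<leftarrow>as. v - a)" for as :: "complex list"
        by (induction as) (auto simp: algebra_simps)
      moreover have "cmod (\<Prod>a\<leftarrow>as. v - a) = (\<Prod>a\<leftarrow>as. cmod (v - a))" for as :: "complex list"
        by (induction as) (auto simp: norm_mult)
      ultimately show ?thesis
        by (subst A(2)) (simp add: as norm_mult)
    qed
    have "(\<integral>\<^sup>+w. (\<Sum>a\<leftarrow>as. neglog a w) * indicator X w \<partial>\<mu>) \<le> ennreal (length as * B)"
    proof (induction as)
      case (Cons a as)
      have "(\<integral>\<^sup>+w. (\<Sum>a\<leftarrow>a # as. neglog a w) * indicator X w \<partial>\<mu>) =
          (\<integral>\<^sup>+w. neglog a w * indicator X w + (\<Sum>a\<leftarrow>as. neglog a w) * indicator X w \<partial>\<mu>)"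
        by (simp add: distrib_right)
      also have "\<dots> = (\<integral>\<^sup>+w. neglog a w * indicator X w \<partial>\<mu>) + (\<integral>\<^sup>+w. (\<Sum>a\<leftarrow>as. neglog a w) * indicator X w \<partial>\<mu>)"
        by (rule nn_integral_add) auto
      also have "\<dots> \<le> ennreal B + ennreal (length as * B)"
        by (intro add_mono Cons X(7))
      also have "\<dots> = ennreal (length (a # as) * B)"
        using X(6) by (simp flip: ennreal_plus add: algebra_simps)
      finally show ?case .
    qed simp
    define T where "T = 2 * (length as * B) / b"
    have T0: "T \<ge> 0" using X(6) b by (simp add: T_def)
    \<comment> \<open>If the sum exceeded \<open>T\<close> on all of \<open>X\<close>, integration
      would give \<open>T * b\<close> at most \<open>length as * B\<close>, while
      \<open>T * b\<close> is twice that number. Without roots the empty sum is 0 and any point of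
      \<open>X\<close> serves.\<close>
    have "\<exists>v\<in>X. (\<Sum>a\<leftarrow>as. neglog a v) \<le> ennreal T"
    proof (rule ccontr)
      assume no: "\<not> ?thesis"
      have lenpos: "length as > 0" using no X(4) T0 by (cases as) fastforce+
      have "ennreal (T * b) = (\<integral>\<^sup>+w. ennreal T * indicator X w \<partial>\<mu>)"
        using b T0 by (simp add: nn_integral_cmult_indicator ennreal_mult)
      also have "\<dots> \<le> (\<integral>\<^sup>+w. (\<Sum>a\<leftarrow>as. neglog a w) * indicator X w \<partial>\<mu>)"
        using no by (intro nn_integral_mono) (auto simp: indicator_def not_le less_imp_le)
      also have "\<dots> \<le> ennreal (length as * B)" by fact
      finally have "T * b \<le> length as * B" using X(6) by (simp add: ennreal_le_iff)
      moreover have "T * b = 2 * (length as * B)" using b by (simp add: T_def)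
      moreover have "length as * B > 0" using lenpos X(6) by simp
      ultimately show False by linarith
    qed
    then obtain v where v: "v \<in> X" "(\<Sum>a\<leftarrow>as. neglog a v) \<le> ennreal T" by blast
    define c where "c a = enn2real (neglog a v)" for a
    have ca: "neglog a v = ennreal (c a)" "c a \<ge> 0" if "a \<in> set as" for a
    proof -
      have "neglog a v \<le> ennreal T"
        using v(2) member_le_sum_list[of "neglog a v" "map (\<lambda>a. neglog a v) as"] that by force
      then show "neglog a v = ennreal (c a)" "c a \<ge> 0"
        unfolding c_def by (auto simp: ennreal_enn2real_if top_unique)
    qed
    have "(\<Sum>a\<leftarrow>as. neglog a v) = ennreal (\<Sum>a\<leftarrow>as. c a)"
      using ca
    proof (induction as)
      case (Cons a as)
      have "(\<Sum>a\<leftarrow>as. c a) \<ge> 0" using Cons.prems(2) by (intro sum_list_nonneg) auto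
      with Cons show ?case by (auto simp: ennreal_plus)
    qed simp
    then have sumc: "(\<Sum>a\<leftarrow>as. c a) \<le> T" using v(2) T0 by (simp add: ennreal_le_iff)
    have "(\<Prod>a\<leftarrow>as. (1 + cmod a) / (R + 2) * exp (- c a)) \<le> (\<Prod>a\<leftarrow>as. cmod (v - a)) \<and>
        0 \<le> (\<Prod>a\<leftarrow>as. (1 + cmod a) / (R + 2) * exp (- c a))"
      using ca
    proof (induction as)
      case (Cons a as)
      then have "(1 + cmod a) / (R + 2) * exp (- c a) \<le> cmod (v - a)"
        using cmod_ge_exp_neglog[of a v "c a" R] R v by auto
      moreover have "(\<Prod>a\<leftarrow>as. (1 + cmod a) / (R + 2) * exp (- c a)) \<le> (\<Prod>a\<leftarrow>as. cmod (v - a)) \<and>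
        0 \<le> (\<Prod>a\<leftarrow>as. (1 + cmod a) / (R + 2) * exp (- c a))"
        by (rule Cons.IH) (use Cons.prems in auto)
      ultimately show ?case
        unfolding list.map prod_list.Cons using R(2)
        by (intro conjI mult_mono mult_nonneg_nonneg) auto
    qed simp
    moreover have "(\<Prod>a\<leftarrow>as. (1 + cmod a) / (R + 2) * exp (- c a)) =
        (\<Prod>a\<leftarrow>as. 1 + cmod a) / (R + 2) ^ length as * exp (- (\<Sum>a\<leftarrow>as. c a))"
      by (induction as) (auto simp: exp_diff exp_minus exp_add divide_simps)
    ultimately have 1: "(\<Prod>a\<leftarrow>as. 1 + cmod a) / (R + 2) ^ length as * exp (- (\<Sum>a\<leftarrow>as. c a)) \<le> (\<Prod>a\<leftarrow>as. cmod (v - a))"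
      by simp
    have P0: "(\<Prod>a\<leftarrow>as. 1 + cmod a) \<ge> 0" by (intro prod_list_nonneg) auto
    have "exp (- T) \<le> exp (- (\<Sum>a\<leftarrow>as. c a))" using sumc by simp
    then have "(\<Prod>a\<leftarrow>as. 1 + cmod a) / (R + 2) ^ length as * exp (- T) \<le>
        (\<Prod>a\<leftarrow>as. 1 + cmod a) / (R + 2) ^ length as * exp (- (\<Sum>a\<leftarrow>as. c a))"
      using R P0 by (intro mult_left_mono) auto
    with 1 have 2: "(\<Prod>a\<leftarrow>as. 1 + cmod a) / (R + 2) ^ length as * exp (- T) \<le> (\<Prod>a\<leftarrow>as. cmod (v - a))"
      by linarith
    have "exp T = exp (2 * B / b) ^ length as"
      by (simp add: T_def flip: exp_of_nat_mult)
    then have "C ^ length as = (R + 2) ^ length as * exp T"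
      by (simp add: C_def power_mult_distrib)
    then have "(\<Prod>a\<leftarrow>as. 1 + cmod a) = C ^ length as * ((\<Prod>a\<leftarrow>as. 1 + cmod a) / (R + 2) ^ length as * exp (- T))"
      using R by (simp add: exp_minus field_simps)
    also have "\<dots> \<le> C ^ length as * (\<Prod>a\<leftarrow>as. cmod (v - a))"
      using 2 C1 by (intro mult_left_mono) auto
    finally have 3: "(\<Prod>a\<leftarrow>as. 1 + cmod a) \<le> C ^ length as * (\<Prod>a\<leftarrow>as. cmod (v - a))" .
    \<comment> \<open>An upper bound at \<open>w\<close> with the same normalization 1 + |a| as the
      lower bound at \<open>v\<close>, so that the normalizing factors cancel.\<close>
    have "(\<Prod>a\<leftarrow>as. cmod (w - a)) \<le> (\<Prod>a\<leftarrow>as. 1 + cmod a) * (1 + cmod w) ^ length as"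
    proof (induction as)
      case (Cons a as)
      have "cmod (w - a) \<le> (1 + cmod a) * (1 + cmod w)"
      proof -
        have "cmod (w - a) \<le> cmod w + cmod a" by (rule norm_triangle_ineq4)
        moreover have "0 \<le> cmod a * cmod w" by simp
        ultimately show ?thesis unfolding distrib_right distrib_left mult_1 mult_1_right by linarith
      qed
      then have "cmod (w - a) * (\<Prod>a\<leftarrow>as. cmod (w - a)) \<le>
          ((1 + cmod a) * (1 + cmod w)) * ((\<Prod>a\<leftarrow>as. 1 + cmod a) * (1 + cmod w) ^ length as)"
        using Cons by (intro mult_mono) (auto intro!: prod_list_nonneg)
      then show ?case by (simp add: mult_ac)
    qed simp
    also have "\<dots> \<le> (C ^ length as * (\<Prod>a\<leftarrow>as. cmod (v - a))) * (1 + cmod w) ^ length as"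
      using 3 by (intro mult_right_mono) auto
    finally have "cmod (poly p w) \<le> cmod (lead_coeff p) * ((C ^ length as * (\<Prod>a\<leftarrow>as. cmod (v - a))) * (1 + cmod w) ^ length as)"
      unfolding pp by (intro mult_left_mono) auto
    also have "\<dots> = cmod (poly p v) * (C * (1 + cmod w)) ^ length as"
      unfolding pp by (simp add: power_mult_distrib mult_ac)
    also have "\<dots> \<le> M * (C * (1 + cmod w)) ^ D"
    proof (intro mult_mono bd power_increasing)
      show "v \<in> W N" using v X by auto
      show "length as \<le> D" using len deg by simp
      have "1 * 1 \<le> C * (1 + cmod w)" using C1 by (intro mult_mono) auto
      then show "1 \<le> C * (1 + cmod w)" by simp
      show "0 \<le> M" using bd[of v] v X norm_ge_zero order_trans by blast
      show "0 \<le> (C * (1 + cmod w)) ^ length as" using C1 by simp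
    qed
    finally show ?thesis .
  qed
  show ?thesis using C1 key by blast
qed

lemma log_capacity_mono: "E \<subseteq> F \<Longrightarrow> log_capacity E \<le> log_capacity F"
  unfolding log_capacity_def by (rule Sup_subset_mono) blast

text \<open>The uniform measure on [0, 1] has finite energy: at distance s the kernel is at most the
  number of n with s \<le> exp (- n), and the interval of radius exp (- n) has measure at most 2 exp
  (- n), which is summable.\<close>

lemma log_capacity_segment_pos:
  assumes "complex_of_real ` {0..1} \<subseteq> E"
  shows "log_capacity E > 0"
proof -
  define \<nu> where "\<nu> = uniform_measure lborel {0..1::real}"
  define \<mu> where "\<mu> = distr \<nu> borel complex_of_real"
  have [measurable_cong]: "sets \<nu> = sets borel" by (simp add: \<nu>_def)
  interpret finite_measure \<nu>
    by standard (simp add: \<nu>_def emeasure_uniform_measure)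
  have inner: "(\<integral>\<^sup>+x. neglog (of_real y) (of_real x) \<partial>\<nu>) \<le> (\<Sum>n. ennreal (2 * exp (- real n)))" for y
  proof -
    have pt: "neglog (of_real y) (of_real x) \<le> (\<Sum>n. indicator {y - exp (- real n)..y + exp (- real n)} x)"
      (is "_ \<le> ?S") for x
    proof -
      have ge: "of_nat N \<le> ?S" if "\<And>n. n < N \<Longrightarrow> \<bar>y - x\<bar> \<le> exp (- real n)" for N
      proof -
        have "(\<Sum>n<N. indicator {y - exp (- real n)..y + exp (- real n)} x :: ennreal) = of_nat N"
          using that by (subst sum.cong[OF refl, where h = "\<lambda>_. 1"]) (auto simp: indicator_def abs_le_iff algebra_simps)
        moreover have "(\<Sum>n<N. indicator {y - exp (- real n)..y + exp (- real n)} x :: ennreal) \<le> ?S"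
          by (rule sum_le_suminf) auto
        ultimately show ?thesis by simp
      qed
      show ?thesis
      proof (cases "x = y")
        case True
        have "?S = top"
        proof (rule ccontr)
          assume "?S \<noteq> top"
          then obtain M where "?S < of_nat M" using ennreal_Ex_less_of_nat less_top by blast
          with ge[of M] True show False by (simp add: leD)
        qed
        then show ?thesis by simp
      next
        case False
        \<comment> \<open>The number of integers n \<ge> 0 with n \<le> - ln |y - x|. It is at least
          - ln |y - x|, and it is 0 if |y - x| > 1.\<close>
        define N where "N = (if - ln \<bar>y - x\<bar> < 0 then 0 else Suc (nat \<lfloor>- ln \<bar>y - x\<bar>\<rfloor>))"
        have "\<bar>y - x\<bar> \<le> exp (- real n)" if "n < N" for n
        proof -
          have "real n \<le> - ln \<bar>y - x\<bar>"
            using that by (auto simp: N_def less_Suc_eq_le le_nat_floor split: if_splits) linarith+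
          then have "ln \<bar>y - x\<bar> \<le> - real n" by simp
          then show ?thesis using False by (metis abs_0_eq abs_ge_zero exp_le_cancel_iff exp_ln
                eq_iff_diff_eq_0 less_eq_real_def zero_less_abs_iff)
        qed
        note ge = ge[of N, OF this]
        have "- ln \<bar>y - x\<bar> \<le> real N" unfolding N_def by auto linarith
        then have "ennreal (- ln \<bar>y - x\<bar>) \<le> of_nat N"
          by (simp add: ennreal_leI flip: ennreal_of_nat_eq_real_of_nat)
        moreover have "cmod (of_real y - of_real x) = \<bar>y - x\<bar>" by (metis norm_of_real of_real_diff)
        ultimately have "neglog (of_real y) (of_real x) \<le> of_nat N"
          using False by (simp add: neglog_eq)
        also note ge
        finally show ?thesis .
      qed
    qed
    have "(\<integral>\<^sup>+x. neglog (of_real y) (of_real x) \<partial>\<nu>) \<le>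
        (\<integral>\<^sup>+x. (\<Sum>n. indicator {y - exp (- real n)..y + exp (- real n)} x) \<partial>\<nu>)"
      by (rule nn_integral_mono) (rule pt)
    also have "\<dots> = (\<Sum>n. emeasure \<nu> {y - exp (- real n)..y + exp (- real n)})"
      by (subst nn_integral_suminf) (auto simp: \<nu>_def)
    also have "\<dots> \<le> (\<Sum>n. ennreal (2 * exp (- real n)))"
    proof (rule suminf_le)
      fix n
      have "emeasure \<nu> {y - exp (- real n)..y + exp (- real n)} =
          emeasure lborel ({0..1} \<inter> {y - exp (- real n)..y + exp (- real n)})"
        unfolding \<nu>_def by (subst emeasure_uniform_measure) (auto simp: divide_ennreal_def simp del: Int_atLeastAtMost)
      also have "\<dots> \<le> emeasure lborel {y - exp (- real n)..y + exp (- real n)}"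
        by (rule emeasure_mono) auto
      finally have "emeasure \<nu> {y - exp (- real n)..y + exp (- real n)} \<le> emeasure lborel {y - exp (- real n)..y + exp (- real n)}" .
      then show "emeasure \<nu> {y - exp (- real n)..y + exp (- real n)} \<le> ennreal (2 * exp (- real n))"
        by simp
    qed auto
    finally show ?thesis .
  qed
  have "summable (\<lambda>n. 2 * exp (- 1 :: real) ^ n)" by (intro summable_mult summable_geometric) auto
  moreover have "exp (- real n) = exp (- 1) ^ n" for n by (simp flip: exp_of_nat_mult)
  ultimately have "summable (\<lambda>n. 2 * exp (- real n))" by simp
  then have fin: "(\<Sum>n. ennreal (2 * exp (- real n))) < \<infinity>"
    by (subst suminf_ennreal2) auto
  have em: "emeasure \<nu> UNIV = 1" by (simp add: \<nu>_def emeasure_uniform_measure)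
  have sp: "space \<nu> = UNIV" by (simp add: \<nu>_def)
  have "(\<integral>\<^sup>+z. \<integral>\<^sup>+w. neglog z w \<partial>\<mu> \<partial>\<mu>) = (\<integral>\<^sup>+y. \<integral>\<^sup>+x. neglog (of_real y) (of_real x) \<partial>\<nu> \<partial>\<nu>)"
  proof -
    have "(\<integral>\<^sup>+w. neglog z w \<partial>\<mu>) = (\<integral>\<^sup>+x. neglog z (of_real x) \<partial>\<nu>)" for z
      unfolding \<mu>_def by (rule nn_integral_distr) measurable
    then have "(\<integral>\<^sup>+z. \<integral>\<^sup>+w. neglog z w \<partial>\<mu> \<partial>\<mu>) = (\<integral>\<^sup>+z. \<integral>\<^sup>+x. neglog z (of_real x) \<partial>\<nu> \<partial>\<mu>)" by simp
    also have "\<dots> = (\<integral>\<^sup>+y. \<integral>\<^sup>+x. neglog (of_real y) (of_real x) \<partial>\<nu> \<partial>\<nu>)"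
      unfolding \<mu>_def by (rule nn_integral_distr) measurable
    finally show ?thesis .
  qed
  also have "\<dots> \<le> (\<integral>\<^sup>+y. (\<Sum>n. ennreal (2 * exp (- real n))) \<partial>\<nu>)"
    by (rule nn_integral_mono) (rule inner)
  also have "\<dots> = (\<Sum>n. ennreal (2 * exp (- real n)))" using em sp by simp
  also note fin
  finally have fin2: "(\<integral>\<^sup>+z. \<integral>\<^sup>+w. neglog z w \<partial>\<mu> \<partial>\<mu>) < \<infinity>" .
  then have "log_energy \<mu> \<noteq> -\<infinity>"
    unfolding log_energy_def neglog_def[symmetric]
    by (cases "\<integral>\<^sup>+z. \<integral>\<^sup>+w. e2ennreal (log_kernel z w) \<partial>\<mu> \<partial>\<mu>";
        cases "\<integral>\<^sup>+z. \<integral>\<^sup>+w. neglog z w \<partial>\<mu> \<partial>\<mu>") (auto simp: less_top[symmetric])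
  then have pos: "exp_ereal (log_energy \<mu>) > 0" by (auto simp: exp_ereal_def)
  have "compact (complex_of_real ` {0..1})" by (intro compact_continuous_image continuous_intros) auto
  moreover have "sets \<mu> = sets borel" by (simp add: \<mu>_def)
  moreover have "emeasure \<mu> UNIV = 1" using em sp by (simp add: \<mu>_def emeasure_distr)
  moreover have "emeasure \<mu> (- complex_of_real ` {0..1}) = 0"
  proof -
    have "- complex_of_real ` {0..1} \<in> sets borel"
      using compact_imp_closed[OF \<open>compact (complex_of_real ` {0..1})\<close>] by auto
    moreover have "{0..1} \<inter> complex_of_real -` (- complex_of_real ` {0..1}) = {}" by blast
    moreover from calculation(1) have "complex_of_real -` (- complex_of_real ` {0..1}) \<in> sets lborel"
      using measurable_sets_borel[of complex_of_real borel "- complex_of_real ` {0..1}"] by simp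
    ultimately show ?thesis
      unfolding \<mu>_def
      by (subst emeasure_distr) (simp_all add: \<nu>_def emeasure_uniform_measure del: vimage_Compl)
  qed
  ultimately have "exp_ereal (log_energy \<mu>) \<le> log_capacity E"
    unfolding log_capacity_def using assms
    by (intro Sup_upper CollectI exI[of _ \<mu>] exI[of _ "complex_of_real ` {0..1}"] conjI refl)
  with pos show ?thesis by (rule order_less_le_trans)
qed

section \<open>Polynomials on complex lines\<close>

text \<open>Stands for a polynomial of total degree at most \<open>D\<close> in the parameters.
  Restrictions to affine lines are all that the one-variable growth inequality uses, and the
  property survives linear changes of the parameters and the freezing of a coordinate.\<close>

definition line_poly :: "nat \<Rightarrow> ((nat \<Rightarrow> complex) \<Rightarrow> complex) \<Rightarrow> bool" where
  "line_poly D Q \<longleftrightarrow> (\<forall>a b. \<exists>p. degree p \<le> D \<and> (\<forall>w. Q (\<lambda>j. a j + w * b j) = poly p w))"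

lemma line_poly_const: "line_poly D (\<lambda>t. c)"
  unfolding line_poly_def by (intro allI exI[of _ "[:c:]"]) auto

lemma line_poly_coord: "line_poly 1 (\<lambda>t. t j)"
  unfolding line_poly_def
proof (intro allI)
  fix a b :: "nat \<Rightarrow> complex"
  show "\<exists>p. degree p \<le> 1 \<and> (\<forall>w. a j + w * b j = poly p w)"
    by (intro exI[of _ "[:a j, b j:]"]) auto
qed

lemma line_poly_mono: "line_poly D Q \<Longrightarrow> D \<le> D' \<Longrightarrow> line_poly D' Q"
  unfolding line_poly_def by (meson order_trans)

lemma line_poly_add:
  assumes "line_poly D P" "line_poly D Q"
  shows "line_poly D (\<lambda>t. P t + Q t)"
  unfolding line_poly_def
proof (intro allI)
  fix a b
  obtain p q where "degree p \<le> D" "\<forall>w. P (\<lambda>j. a j + w * b j) = poly p w"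
    "degree q \<le> D" "\<forall>w. Q (\<lambda>j. a j + w * b j) = poly q w"
    using assms unfolding line_poly_def by meson
  then show "\<exists>p. degree p \<le> D \<and> (\<forall>w. P (\<lambda>j. a j + w * b j) + Q (\<lambda>j. a j + w * b j) = poly p w)"
    by (intro exI[of _ "p + q"]) (auto intro: degree_add_le)
qed

lemma line_poly_mult:
  assumes "line_poly D P" "line_poly D' Q"
  shows "line_poly (D + D') (\<lambda>t. P t * Q t)"
  unfolding line_poly_def
proof (intro allI)
  fix a b
  obtain p q where "degree p \<le> D" "\<forall>w. P (\<lambda>j. a j + w * b j) = poly p w"
    "degree q \<le> D'" "\<forall>w. Q (\<lambda>j. a j + w * b j) = poly q w"
    using assms unfolding line_poly_def by meson
  then show "\<exists>p. degree p \<le> D + D' \<and> (\<forall>w. P (\<lambda>j. a j + w * b j) * Q (\<lambda>j. a j + w * b j) = poly p w)"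
    by (intro exI[of _ "p * q"]) (auto intro: order_trans[OF degree_mult_le] add_mono)
qed

lemma line_poly_cmult: "line_poly D Q \<Longrightarrow> line_poly D (\<lambda>t. c * Q t)"
  using line_poly_mult[OF line_poly_const[of 0 c]] by simp

lemma line_poly_sum: "(\<And>i. i \<in> I \<Longrightarrow> line_poly D (Q i)) \<Longrightarrow> line_poly D (\<lambda>t. \<Sum>i\<in>I. Q i t)"
  by (induction I rule: infinite_finite_induct) (auto intro: line_poly_const line_poly_add)

lemma line_poly_monomial: "line_poly (\<Sum>j<m. i j) (\<lambda>t. \<Prod>j<m. t j ^ i j)"
proof (induction m)
  case (Suc m)
  have "line_poly k (\<lambda>t. t m ^ k)" for k
  proof (induction k)
    case (Suc k)
    then show ?case using line_poly_mult[OF line_poly_coord Suc, of m] by simp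
  qed (simp add: line_poly_const)
  then show ?case using line_poly_mult[OF Suc, of "i m" "\<lambda>t. t m ^ i m"] by simp
qed (simp add: line_poly_const)

lemma line_poly_upd:
  assumes "line_poly D Q"
  shows "line_poly D (\<lambda>t. Q (t(n := c)))"
  unfolding line_poly_def
proof (intro allI)
  fix a b
  have "(\<lambda>j. a j + w * b j)(n := c) = (\<lambda>j. (a(n := c)) j + w * (b(n := 0)) j)" for w by auto
  then show "\<exists>p. degree p \<le> D \<and> (\<forall>w. Q ((\<lambda>j. a j + w * b j)(n := c)) = poly p w)"
    using assms unfolding line_poly_def by metis
qed

lemma line_poly_mat_apply:
  assumes "line_poly D Q"
  shows "line_poly D (\<lambda>t. Q (mat_apply m u t))"
  unfolding line_poly_def
proof (intro allI)
  fix a b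
  have "mat_apply m u (\<lambda>j. a j + w * b j) = (\<lambda>j. mat_apply m u a j + w * mat_apply m u b j)" for w
    by (auto simp: mat_apply_def algebra_simps sum.distrib sum_distrib_left)
  then show "\<exists>p. degree p \<le> D \<and> (\<forall>w. Q (mat_apply m u (\<lambda>j. a j + w * b j)) = poly p w)"
    using assms unfolding line_poly_def by metis
qed

section \<open>Geometric bounds, one coordinate at a time\<close>

text \<open>\<open>N\<close> depends on \<open>t\<close> but not on the member of \<open>S\<close>.
  It is a natural number so that the set of all such \<open>t\<close> is a countable union.\<close>

definition geometric_at :: "(nat \<times> ((nat \<Rightarrow> complex) \<Rightarrow> complex)) set \<Rightarrow> (nat \<Rightarrow> complex) \<Rightarrow> bool" where
  "geometric_at S t \<longleftrightarrow> (\<exists>N::nat. \<forall>(k, Q)\<in>S. cmod (Q t) \<le> real N ^ k)"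

text \<open>For fixed \<open>N\<close> the condition cuts out a closed set of \<open>w\<close>, as
  an intersection of sublevel sets of polynomials. The constant of \<open>bernstein_walsh\<close>
  does not depend on the polynomial, hence one \<open>C\<close> serves all of \<open>S\<close>,
  however large.\<close>

lemma slice_bound:
  assumes S: "\<And>k Q. (k, Q) \<in> S \<Longrightarrow> line_poly (d * k) Q"
    and cap: "log_capacity {w. geometric_at S (a(n := w))} > 0"
  shows "\<exists>C\<ge>1. \<forall>(k, Q)\<in>S. \<forall>w. cmod (Q (a(n := w))) \<le> (C * (1 + cmod w) ^ d) ^ k"
proof -
  define W where "W N = {w. \<forall>(k, Q)\<in>S. cmod (Q (a(n := w))) \<le> real N ^ k}" for N :: nat
  have p: "\<exists>p. degree p \<le> d * k \<and> (\<forall>w. Q (a(n := w)) = poly p w)" if "(k, Q) \<in> S" for k Q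
  proof -
    have "a(n := w) = (\<lambda>j. (a(n := 0)) j + w * ((\<lambda>_. 0)(n := 1)) j)" for w by auto
    then show ?thesis using S[OF that] unfolding line_poly_def by metis
  qed
  have W: "closed (W N)" for N
  proof -
    have "closed {w. cmod (Q (a(n := w))) \<le> real N ^ k}" if "(k, Q) \<in> S" for k Q
    proof -
      obtain p where "\<forall>w. Q (a(n := w)) = poly p w" using p[OF \<open>(k, Q) \<in> S\<close>] by blast
      then show ?thesis by (auto intro!: closed_Collect_le continuous_intros)
    qed
    moreover have "W N = (\<Inter>(k, Q)\<in>S. {w. cmod (Q (a(n := w))) \<le> real N ^ k})" by (auto simp: W_def)
    ultimately show ?thesis by auto
  qed
  have "{w. geometric_at S (a(n := w))} \<subseteq> (\<Union>N. W N)" by (auto simp: geometric_at_def W_def)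
  from bernstein_walsh[where W = W, OF cap this W] obtain N C where C: "C \<ge> 1"
    "\<And>p D M w. degree p \<le> D \<Longrightarrow> (\<And>v. v \<in> W N \<Longrightarrow> cmod (poly p v) \<le> M) \<Longrightarrow>
      cmod (poly p w) \<le> M * (C * (1 + cmod w)) ^ D"
    by metis
  have "1 * 1 \<le> (real N + 1) * C ^ d" using C(1) by (intro mult_mono) auto
  show ?thesis
  \<comment> \<open>\<open>real N + 1\<close> rather than \<open>real N\<close> keeps the constant
    at least 1 when \<open>N = 0\<close>.\<close>
  proof (intro exI[of _ "(real N + 1) * C ^ d"] conjI ballI, goal_cases)
    case 1
    have "1 * 1 \<le> (real N + 1) * C ^ d" using C(1) by (intro mult_mono) auto
    then show "(real N + 1) * C ^ d \<ge> 1" by simp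
  next
    case (2 x)
    then show ?case
    proof (clarify)
    fix k Q w assume Q: "(k, Q) \<in> S"
    obtain p where p: "degree p \<le> d * k" "\<And>w. Q (a(n := w)) = poly p w" using p[OF Q] by blast
    have "cmod (Q (a(n := w))) \<le> real N ^ k * (C * (1 + cmod w)) ^ (d * k)"
      unfolding p(2) by (rule C(2)[OF p(1)]) (use Q in \<open>auto simp: W_def simp flip: p(2)\<close>)
    also have "\<dots> = (real N * C ^ d * (1 + cmod w) ^ d) ^ k"
      by (simp add: power_mult_distrib power_mult)
    also have "\<dots> \<le> ((real N + 1) * C ^ d * (1 + cmod w) ^ d) ^ k"
      using C(1) by (intro power_mono mult_right_mono) auto
    finally show "cmod (Q (a(n := w))) \<le> ((real N + 1) * C ^ d * (1 + cmod w) ^ d) ^ k" .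
    qed
  qed
qed

lemma Gamma_step_mono: "E \<subseteq> F \<Longrightarrow> Gamma_step k E \<subseteq> Gamma_step k F"
  unfolding Gamma_step_def
  by (auto intro: order_less_le_trans[OF _ log_capacity_mono])

lemma Gamma_iter_mono: "E \<subseteq> F \<Longrightarrow> Gamma_iter k E \<subseteq> Gamma_iter k F"
  by (induction k arbitrary: E F) (auto dest: Gamma_step_mono)

text \<open>Induction on the number of coordinates. Nothing is claimed about how the constant of a
  slice depends on its base point \<open>z\<close>; that constant only has to show that
  \<open>z\<close> is a point of geometric boundedness for an enlarged family in fewer
  variables.\<close>

lemma Gamma_iter_bound:
  assumes "\<And>k Q. (k, Q) \<in> S \<Longrightarrow> line_poly (d * k) Q"
    and "log_capacity ((\<lambda>z. z 0) ` Gamma_iter n {t \<in> cspace (Suc n). geometric_at S t}) > 0"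
  shows "\<exists>C\<ge>1. \<forall>(k, Q)\<in>S. \<forall>t\<in>cspace (Suc n). cmod (Q t) \<le> (C * (\<Prod>j\<le>n. (1 + cmod (t j)) ^ d)) ^ k"
  using assms
proof (induction n arbitrary: S)
  case 0
  have eq: "t = (\<lambda>_. 0)(0 := t 0)" if "t \<in> cspace 1" for t
    using that by (auto simp: cspace_def)
  have "(\<lambda>z. z 0) ` {t \<in> cspace 1. geometric_at S t} \<subseteq> {w. geometric_at S ((\<lambda>_. 0)(0 := w))}"
  proof safe
    fix t assume "t \<in> cspace 1" "geometric_at S t"
    then show "geometric_at S ((\<lambda>_. 0)(0 := t 0))" using eq[of t] by simp
  qed
  from log_capacity_mono[OF this] have "log_capacity {w. geometric_at S ((\<lambda>_. 0)(0 := w))} > 0"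
    using 0(2) by simp
  from slice_bound[OF 0(1) this] obtain C where C: "C \<ge> 1"
    "\<And>k Q w. (k, Q) \<in> S \<Longrightarrow> cmod (Q ((\<lambda>_. 0)(0 := w))) \<le> (C * (1 + cmod w) ^ d) ^ k"
    by blast
  have "cmod (Q t) \<le> (C * (1 + cmod (t 0)) ^ d) ^ k" if "(k, Q) \<in> S" "t \<in> cspace 1" for k Q t
    using C(2)[OF that(1), of "t 0"] eq[OF that(2)] by metis
  then show ?case
    using C(1) by (intro exI[of _ C]) auto
next
  case (Suc n)
  \<comment> \<open>All slices of all members, divided by their expected growth in \<open>w\<close>.
    A bound on this family at \<open>z\<close> is a bound on the slice over \<open>z\<close> that is
    uniform in \<open>w\<close>; the index \<open>k\<close> and the degree in \<open>z\<close> are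
    kept.\<close>
  define S' where "S' = {(k, \<lambda>z. inverse (of_real ((1 + cmod w) ^ (d * k))) * Q (z(Suc n := w))) | k Q w. (k, Q) \<in> S}"
  have S': "line_poly (d * k) Q" if S': "(k, Q) \<in> S'" for k Q
  proof -
    obtain Q0 w where "(k, Q0) \<in> S" and Q: "Q = (\<lambda>z. inverse (of_real ((1 + cmod w) ^ (d * k))) * Q0 (z(Suc n := w)))"
      using S' unfolding S'_def by blast
    then show ?thesis unfolding Q by (intro line_poly_cmult line_poly_upd Suc.prems(1))
  qed
  have "Gamma_step (Suc n) {t \<in> cspace (Suc (Suc n)). geometric_at S t} \<subseteq> {z \<in> cspace (Suc n). geometric_at S' z}"
  proof safe
    fix z assume z: "z \<in> Gamma_step (Suc n) {t \<in> cspace (Suc (Suc n)). geometric_at S t}"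
    then show "z \<in> cspace (Suc n)" by (simp add: Gamma_step_def)
    have "log_capacity {w. geometric_at S (z(Suc n := w))} > 0"
      using z unfolding Gamma_step_def
      by (auto elim!: order_less_le_trans intro!: log_capacity_mono)
    from slice_bound[OF Suc.prems(1) this] obtain C where C: "C \<ge> 1"
      "\<And>k Q w. (k, Q) \<in> S \<Longrightarrow> cmod (Q (z(Suc n := w))) \<le> (C * (1 + cmod w) ^ d) ^ k"
      by blast
    show "geometric_at S' z"
      unfolding geometric_at_def
    proof (intro exI ballI, clarify)
      fix k Q assume "(k, Q) \<in> S'"
      then obtain Q0 w where Q: "(k, Q0) \<in> S"
        "Q = (\<lambda>z. inverse (of_real ((1 + cmod w) ^ (d * k))) * Q0 (z(Suc n := w)))"
        unfolding S'_def by blast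
      have w: "(1 + cmod w) ^ (d * k) > 0" by (simp add: add_pos_nonneg)
      have "cmod (Q z) = cmod (Q0 (z(Suc n := w))) / (1 + cmod w) ^ (d * k)"
        using w unfolding Q(2) norm_mult norm_inverse norm_of_real by (simp add: divide_inverse)
      also have "\<dots> \<le> C ^ k"
        using C(2)[OF Q(1), of w] w by (simp add: divide_le_eq power_mult_distrib power_mult)
      also have "\<dots> \<le> real (nat \<lceil>C\<rceil>) ^ k" using C(1) by (intro power_mono) linarith+
      finally show "cmod (Q z) \<le> real (nat \<lceil>C\<rceil>) ^ k" .
    qed
  qed
  then have "(\<lambda>z. z 0) ` Gamma_iter n (Gamma_step (Suc n) {t \<in> cspace (Suc (Suc n)). geometric_at S t}) \<subseteq>
      (\<lambda>z. z 0) ` Gamma_iter n {z \<in> cspace (Suc n). geometric_at S' z}"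
    by (intro image_mono Gamma_iter_mono)
  from log_capacity_mono[OF this]
  have "log_capacity ((\<lambda>z. z 0) ` Gamma_iter n {z \<in> cspace (Suc n). geometric_at S' z}) > 0"
    using Suc.prems(2) by simp
  \<comment> \<open>The induction hypothesis makes the constant uniform in \<open>z\<close>;
    multiplying back by the power of \<open>1 + cmod w\<close> then adds the factor of the last
    coordinate to the product.\<close>
  from Suc.IH[OF S' this] obtain C where C: "C \<ge> 1"
    "\<And>k Q t. (k, Q) \<in> S' \<Longrightarrow> t \<in> cspace (Suc n) \<Longrightarrow> cmod (Q t) \<le> (C * (\<Prod>j\<le>n. (1 + cmod (t j)) ^ d)) ^ k"
    by blast
  show ?case
  proof (intro exI conjI ballI, rule C(1), clarify)
    fix k Q t assume Q: "(k, Q) \<in> S" and t: "t \<in> cspace (Suc (Suc n))"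
    define z where "z = t(Suc n := 0)"
    define w where "w = t (Suc n)"
    have z: "z \<in> cspace (Suc n)" using t by (auto simp: z_def cspace_def le_Suc_eq)
    have w: "(1 + cmod w) ^ (d * k) > 0" by (simp add: add_pos_nonneg)
    have "(k, \<lambda>z. inverse (of_real ((1 + cmod w) ^ (d * k))) * Q (z(Suc n := w))) \<in> S'"
      using Q unfolding S'_def by blast
    from C(2)[OF this z] have "cmod (Q t) / (1 + cmod w) ^ (d * k) \<le> (C * (\<Prod>j\<le>n. (1 + cmod (z j)) ^ d)) ^ k"
      using w unfolding norm_mult norm_inverse norm_of_real
      by (simp add: divide_inverse z_def w_def mult.commute)
    then have "cmod (Q t) \<le> (C * (\<Prod>j\<le>n. (1 + cmod (z j)) ^ d)) ^ k * (1 + cmod w) ^ (d * k)"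
      using w by (simp add: pos_divide_le_eq)
    also have "\<dots> = (C * (\<Prod>j\<le>n. (1 + cmod (z j)) ^ d) * (1 + cmod w) ^ d) ^ k"
      by (simp add: power_mult_distrib power_mult)
    also have "(\<Prod>j\<le>n. (1 + cmod (z j)) ^ d) = (\<Prod>j\<le>n. (1 + cmod (t j)) ^ d)"
      by (rule prod.cong) (auto simp: z_def)
    finally show "cmod (Q t) \<le> (C * (\<Prod>j\<le>Suc n. (1 + cmod (t j)) ^ d)) ^ k"
      by (simp add: w_def mult_ac)
  qed
qed

section \<open>Unitary changes of the parameters\<close>

lemma unitary_row_le: 
  assumes "unitary m u" "i < m" "j < m"
  shows "cmod (u i j) \<le> 1"
proof -
  have "complex_of_real (\<Sum>k<m. cmod (u i k) ^ 2) = (\<Sum>k<m. u i k * cnj (u i k))"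
    by (simp only: of_real_sum complex_norm_square)
  also have "\<dots> = 1" using assms by (simp add: unitary_def)
  finally have "(\<Sum>k<m. cmod (u i k) ^ 2) = 1" by (metis of_real_eq_1_iff)
  then have "cmod (u i j) ^ 2 \<le> 1"
    using member_le_sum[of j "{..<m}" "\<lambda>k. cmod (u i k) ^ 2"] assms by auto
  then show ?thesis by (simp add: power_le_one_iff abs_square_le_1)
qed

text \<open>The projection \<open>1 - u\<^sup>* u\<close> has trace 0, hence Hilbert--Schmidt norm 0.\<close>

lemma unitary_columns:
  assumes u: "unitary m u" and "i < m" "j < m"
  shows "(\<Sum>k<m. cnj (u k i) * u k j) = (if i = j then 1 else 0)"
proof -
  define p where "p i j = (\<Sum>k<m. cnj (u k i) * u k j)" for i j
  define e where "e i j = (if i = j then 1 else 0 :: complex)" for i j :: nat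
  have uu: "(\<Sum>k<m. u i k * cnj (u j k)) = e i j" if "i < m" "j < m" for i j
    using u that by (simp add: unitary_def e_def)
  have tr: "(\<Sum>i<m. p i i) = of_nat m"
  proof -
    have "(\<Sum>i<m. p i i) = (\<Sum>k<m. \<Sum>i<m. u k i * cnj (u k i))"
      unfolding p_def by (subst sum.swap) (simp add: mult.commute)
    then show ?thesis using uu by (simp add: e_def)
  qed
  have cp: "cnj (p i j) = p j i" for i j by (simp add: p_def mult.commute)
  have sq: "(\<Sum>i<m. \<Sum>j<m. p i j * cnj (p i j)) = of_nat m"
  proof -
    \<comment> \<open>\<open>p\<close> is Hermitian, and idempotent because the rows of
      \<open>u\<close> are orthonormal, so the squared norm of a row is its diagonal entry.\<close>
    have "(\<Sum>j<m. p i j * cnj (p i j)) = p i i" for i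
    proof -
      have "(\<Sum>j<m. p i j * cnj (p i j)) = (\<Sum>j<m. \<Sum>k<m. \<Sum>l<m. cnj (u k i) * u l i * (u k j * cnj (u l j)))"
        unfolding cp by (simp add: p_def sum_product mult_ac)
      also have "\<dots> = (\<Sum>k<m. \<Sum>j<m. \<Sum>l<m. cnj (u k i) * u l i * (u k j * cnj (u l j)))"
        by (rule sum.swap)
      also have "\<dots> = (\<Sum>k<m. \<Sum>l<m. \<Sum>j<m. cnj (u k i) * u l i * (u k j * cnj (u l j)))"
        by (intro sum.cong refl sum.swap)
      also have "\<dots> = (\<Sum>k<m. \<Sum>l<m. cnj (u k i) * u l i * e k l)"
        by (simp add: uu flip: sum_distrib_left)
      also have "\<dots> = p i i" by (simp add: p_def e_def if_distrib cong: if_cong)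
      finally show ?thesis .
    qed
    then show ?thesis using tr by simp
  qed
  \<comment> \<open>Expanding the square leaves m - 2m + m.\<close>
  have "(\<Sum>i<m. \<Sum>j<m. (e i j - p i j) * cnj (e i j - p i j)) =
      (\<Sum>i<m. \<Sum>j<m. e i j) - (\<Sum>i<m. \<Sum>j<m. e i j * cnj (p i j)) - (\<Sum>i<m. \<Sum>j<m. e i j * p i j) +
      (\<Sum>i<m. \<Sum>j<m. p i j * cnj (p i j))"
    by (simp add: sum.distrib[symmetric] sum_subtractf[symmetric])
      (intro sum.cong refl, auto simp: e_def algebra_simps)
  also have "(\<Sum>i<m. \<Sum>j<m. e i j * cnj (p i j)) = (\<Sum>i<m. p i i)"
    by (simp add: cp e_def if_distrib[where f = "\<lambda>x. x * _"] cong: if_cong)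
  also have "(\<Sum>i<m. \<Sum>j<m. e i j * p i j) = (\<Sum>i<m. p i i)"
    by (simp add: e_def if_distrib[where f = "\<lambda>x. x * _"] cong: if_cong)
  also have "(\<Sum>i<m. \<Sum>j<m. e i j) = of_nat m" by (simp add: e_def)
  finally have "(\<Sum>i<m. \<Sum>j<m. (e i j - p i j) * cnj (e i j - p i j)) = 0"
    using tr sq by simp
  then have "complex_of_real (\<Sum>i<m. \<Sum>j<m. cmod (e i j - p i j) ^ 2) = 0"
    by (simp only: of_real_sum complex_norm_square)
  then have *: "(\<Sum>i<m. \<Sum>j<m. cmod (e i j - p i j) ^ 2) = 0" unfolding of_real_eq_0_iff .
  have "(\<Sum>j<m. cmod (e i j - p i j) ^ 2) = 0"
    by (rule sum_nonneg_0[OF _ _ *]) (use assms in \<open>auto intro: sum_nonneg\<close>)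
  then have "cmod (e i j - p i j) ^ 2 = 0"
    by (rule sum_nonneg_0[OF _ _ _, rotated 2]) (use assms in auto)
  then show ?thesis by (simp add: p_def e_def)
qed

lemma mat_apply_in_cspace [simp]: "mat_apply m u t \<in> cspace m"
  by (simp add: mat_apply_def cspace_def)

lemma mat_apply_adjoint:
  assumes "unitary m u" "t \<in> cspace m"
  shows "mat_apply m (\<lambda>i j. cnj (u j i)) (mat_apply m u t) = t"
proof
  fix i
  show "mat_apply m (\<lambda>i j. cnj (u j i)) (mat_apply m u t) i = t i"
  proof (cases "i < m")
    case True
    have "(\<Sum>j<m. cnj (u j i) * (\<Sum>k<m. u j k * t k)) = (\<Sum>j<m. \<Sum>k<m. cnj (u j i) * u j k * t k)"
      by (simp add: sum_distrib_left mult_ac)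
    also have "\<dots> = (\<Sum>k<m. \<Sum>j<m. cnj (u j i) * u j k * t k)" by (rule sum.swap)
    also have "\<dots> = (\<Sum>k<m. (if i = k then 1 else 0) * t k)"
      by (intro sum.cong refl) (use assms True in \<open>auto simp: unitary_columns simp flip: sum_distrib_right\<close>)
    also have "\<dots> = t i" using True by (simp add: if_distrib[where f = "\<lambda>x. x * _"] cong: if_cong)
    finally show ?thesis using True by (simp add: mat_apply_def)
  qed (use assms in \<open>auto simp: mat_apply_def cspace_def\<close>)
qed

lemma cspace_norm_nonneg [simp]: "cspace_norm m t \<ge> 0"
  by (simp add: cspace_norm_def L2_set_nonneg)

lemma cmod_le_cspace_norm: "j < m \<Longrightarrow> cmod (t j) \<le> cspace_norm m t"
  unfolding cspace_norm_def by (rule member_le_L2_set) auto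

text \<open>On the complex line through 0 and \<open>t\<close>, with base vector t / T in the unit
  polydisc and T = 1 + |t|, a bound on the polydisc becomes a bound on the unit disc;
  \<open>t\<close> itself is the point w = T. \<open>B\<close> is the growth constant of the disc
  alone.\<close>

lemma bound_from_unit_polydisc:
  "\<exists>B\<ge>1. \<forall>k d Q C. line_poly (d * k) Q \<longrightarrow>
    (\<forall>t\<in>cspace m. (\<forall>j. cmod (t j) \<le> 1) \<longrightarrow> cmod (Q t) \<le> C ^ k) \<longrightarrow> C \<ge> 0 \<longrightarrow>
    (\<forall>t\<in>cspace m. cmod (Q t) \<le> (C * B ^ d * (1 + cspace_norm m t) ^ d) ^ k)"
proof -
  have "complex_of_real ` {0..1} \<subseteq> cball 0 1" by auto
  then have "log_capacity (cball 0 1) > 0" by (rule log_capacity_segment_pos)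
  from bernstein_walsh[OF this, where W = "\<lambda>_. cball 0 1"]
  obtain B where B: "B \<ge> 1"
    "\<And>p D M w. degree p \<le> D \<Longrightarrow> (\<And>v. v \<in> cball 0 1 \<Longrightarrow> cmod (poly p v) \<le> M) \<Longrightarrow>
      cmod (poly p w) \<le> M * (B * (1 + cmod w)) ^ D"
    by (metis UN_I UNIV_I closed_cball subsetI)
  show ?thesis
  \<comment> \<open>The factor 2 absorbs 1 + T \<le> 2T, valid as T is at least 1.\<close>
  proof (intro exI[of _ "2 * B"] conjI allI impI ballI)
    show "2 * B \<ge> 1" using B by simp
    fix k d Q C t assume Q: "line_poly (d * k) Q"
      and C: "\<forall>t\<in>cspace m. (\<forall>j. cmod (t j) \<le> 1) \<longrightarrow> cmod (Q t) \<le> C ^ k" "C \<ge> 0"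
      and t: "t \<in> cspace m"
    define T where "T = 1 + cspace_norm m t"
    have T: "T \<ge> 1" by (simp add: T_def)
    define s where "s j = t j / of_real T" for j
    obtain p where p: "degree p \<le> d * k" "\<And>w. Q (\<lambda>j. 0 + w * s j) = poly p w"
      using Q unfolding line_poly_def by meson
    have s: "cmod (s j) \<le> 1" for j
    proof (cases "j < m")
      case True
      then show ?thesis using cmod_le_cspace_norm[OF True, of t] T
        by (simp add: s_def norm_divide norm_of_real T_def divide_le_eq_1 add_pos_nonneg del: of_real_add)
    next
      case False
      then show ?thesis using t by (simp add: s_def cspace_def)
    qed
    have "cmod (poly p w) \<le> C ^ k" if "w \<in> cball 0 1" for w
      unfolding p(2)[symmetric]
    proof (rule C(1)[rule_format])
      show "(\<lambda>j. 0 + w * s j) \<in> cspace m" using t by (simp add: cspace_def s_def)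
      show "cmod (0 + w * s j) \<le> 1" for j using that s by (simp add: norm_mult mult_le_one)
    qed
    then have "cmod (poly p (of_real T)) \<le> C ^ k * (B * (1 + cmod (of_real T))) ^ (d * k)"
      by (rule B(2)[OF p(1)])
    also have "\<dots> \<le> C ^ k * (B * (2 * T)) ^ (d * k)"
      using T B(1) C(2) by (intro mult_left_mono power_mono) auto
    also have "\<dots> = (C * (2 * B) ^ d * T ^ d) ^ k"
      by (simp add: power_mult_distrib power_mult mult_ac)
    also have "poly p (of_real T) = Q t"
      using T by (simp add: s_def flip: p(2))
    finally show "cmod (Q t) \<le> (C * (2 * B) ^ d * (1 + cspace_norm m t) ^ d) ^ k"
      by (simp add: T_def)
  qed
qed

text \<open>In rotated coordinates the growth bound is a product over coordinates. It is used only
  on the unit polydisc, where it is a constant; \<open>bound_from_unit_polydisc\<close> then gives a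
  bound in the norm, in the original coordinates.\<close>

lemma Gamma_capacity_bound:
  assumes "m \<ge> 1" and S: "\<And>k Q. (k, Q) \<in> S \<Longrightarrow> line_poly (d * k) Q"
    and E: "E \<subseteq> cspace m" "\<And>t. t \<in> E \<Longrightarrow> geometric_at S t"
    and cap: "Gamma_capacity m E \<noteq> 0"
  shows "\<exists>C\<ge>1. \<forall>(k, Q)\<in>S. \<forall>t\<in>cspace m. cmod (Q t) \<le> (C * (1 + cspace_norm m t) ^ d) ^ k"
proof -
  obtain n where m: "m = Suc n" using assms(1) by (cases m) auto
  obtain u where u: "unitary m u" and pos: "log_capacity (Gamma_proj m (mat_apply m u ` E)) > 0"
    using cap unfolding Gamma_capacity_def by (metis (mono_tags, lifting) SUP_bot_conv(2) bot_ennreal mem_Collect_eq zero_less_iff_neq_zero)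
  define v where "v = (\<lambda>i j. cnj (u j i))"
  define S' where "S' = {(k, \<lambda>t. Q (mat_apply m v t)) | k Q. (k, Q) \<in> S}"
  have S': "line_poly (d * k) Q" if "(k, Q) \<in> S'" for k Q
    using that S by (auto simp: S'_def intro: line_poly_mat_apply)
  have vu: "mat_apply m v (mat_apply m u t) = t" if "t \<in> cspace m" for t
    unfolding v_def using mat_apply_adjoint[OF u that] .
  have "mat_apply m u ` E \<subseteq> {t \<in> cspace (Suc n). geometric_at S' t}"
  proof safe
    fix t assume t: "t \<in> E"
    show "mat_apply m u t \<in> cspace (Suc n)" unfolding m[symmetric] by simp
    have "t \<in> cspace m" using t E(1) by blast
    from vu[OF this] have "mat_apply m v (mat_apply m u t) = t" .
    moreover obtain N where "\<forall>(k, Q)\<in>S. cmod (Q t) \<le> real N ^ k"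
      using E(2)[OF t] unfolding geometric_at_def by blast
    ultimately show "geometric_at S' (mat_apply m u t)"
      unfolding geometric_at_def S'_def by (intro exI[of _ N]) auto
  qed
  then have "Gamma_proj m (mat_apply m u ` E) \<subseteq> (\<lambda>z. z 0) ` Gamma_iter n {t \<in> cspace (Suc n). geometric_at S' t}"
    unfolding Gamma_proj_def m by (simp add: Gamma_iter_mono image_mono)
  then have "log_capacity ((\<lambda>z. z 0) ` Gamma_iter n {t \<in> cspace (Suc n). geometric_at S' t}) > 0"
    using pos log_capacity_mono order_less_le_trans by blast
  from Gamma_iter_bound[OF S' this] obtain C where C: "C \<ge> 1"
    "\<And>k Q t. (k, Q) \<in> S' \<Longrightarrow> t \<in> cspace m \<Longrightarrow> cmod (Q t) \<le> (C * (\<Prod>j\<le>n. (1 + cmod (t j)) ^ d)) ^ k"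
    unfolding m by blast
  \<comment> \<open>For \<open>t\<close> in the unit polydisc each coordinate of the rotated point
    is a sum of \<open>m\<close> numbers of modulus at most 1, and the product has \<open>m\<close>
    factors.\<close>
  define C1 where "C1 = C * ((1 + real m) ^ d) ^ m"
  have C1: "C1 \<ge> 1"
  proof -
    have "1 * 1 \<le> C * ((1 + real m) ^ d) ^ m" using C(1) by (intro mult_mono one_le_power) auto
    then show ?thesis by (simp add: C1_def)
  qed
  have 1: "cmod (Q t) \<le> C1 ^ k" if "(k, Q) \<in> S" "t \<in> cspace m" "\<forall>j. cmod (t j) \<le> 1" for k Q t
  proof -
    have "cmod (mat_apply m u t j) \<le> real m" if "j < m" for j
    proof -
      have "cmod (\<Sum>k<m. u j k * t k) \<le> (\<Sum>k<m. 1)"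
        by (rule sum_norm_le) (use unitary_row_le[OF u that] \<open>\<forall>j. cmod (t j) \<le> 1\<close> in
          \<open>auto simp: norm_mult intro!: mult_le_one\<close>)
      then show ?thesis using that by (simp add: mat_apply_def)
    qed
    then have "(\<Prod>j\<le>n. (1 + cmod (mat_apply m u t j)) ^ d) \<le> (\<Prod>j\<le>n. (1 + real m) ^ d)"
      by (intro prod_mono) (auto simp: m intro!: power_mono)
    then have "(C * (\<Prod>j\<le>n. (1 + cmod (mat_apply m u t j)) ^ d)) ^ k \<le> C1 ^ k"
      using C(1) unfolding C1_def
      by (intro power_mono mult_left_mono mult_nonneg_nonneg prod_nonneg) (auto simp: m)
    moreover have "(k, \<lambda>t. Q (mat_apply m v t)) \<in> S'" using that(1) by (auto simp: S'_def)
    from C(2)[OF this, of "mat_apply m u t"]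
    have "cmod (Q t) \<le> (C * (\<Prod>j\<le>n. (1 + cmod (mat_apply m u t j)) ^ d)) ^ k"
      using vu[OF that(2)] by simp
    ultimately show ?thesis by linarith
  qed
  obtain B where B: "B \<ge> 1" "\<And>k d Q C t. line_poly (d * k) Q \<Longrightarrow>
    (\<And>t. t \<in> cspace m \<Longrightarrow> (\<forall>j. cmod (t j) \<le> 1) \<Longrightarrow> cmod (Q t) \<le> C ^ k) \<Longrightarrow> C \<ge> 0 \<Longrightarrow>
    t \<in> cspace m \<Longrightarrow> cmod (Q t) \<le> (C * B ^ d * (1 + cspace_norm m t) ^ d) ^ k"
    using bound_from_unit_polydisc[of m] by metis
  have "1 * 1 \<le> C1 * B ^ d" using C1 B(1) by (intro mult_mono one_le_power) auto
  moreover have "cmod (Q t) \<le> (C1 * B ^ d * (1 + cspace_norm m t) ^ d) ^ k"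
    if "(k, Q) \<in> S" "t \<in> cspace m" for k Q t
    by (rule B(2)[OF S[OF that(1)] 1[OF that(1)]]) (use C1 that in auto)
  ultimately show ?thesis by (intro exI[of _ "C1 * B ^ d"]) auto
qed

text \<open>The identity is a unitary transformation, and every slice of the full space is the whole
  plane, so each projection is again full. This excludes that an exceptional set of capacity 0 is
  the whole space.\<close>

lemma Gamma_capacity_cspace_pos:
  assumes "m \<ge> 1"
  shows "Gamma_capacity m (cspace m) \<noteq> 0"
proof -
  obtain n where m: "m = Suc n" using assms(1) by (cases m) auto
  define u where "u = (\<lambda>(i::nat) j. if i = j then 1 else 0 :: complex)"
  have u: "unitary m u" by (auto simp: unitary_def u_def if_distrib[where f = "\<lambda>x. x * _"] cong: if_cong)
  have "mat_apply m u t = t" if "t \<in> cspace m" for t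
    using that by (auto simp: mat_apply_def u_def cspace_def fun_eq_iff if_distrib[where f = "\<lambda>x. x * _"] cong: if_cong)
  then have im: "mat_apply m u ` cspace m = cspace m" by simp
  have pos: "log_capacity UNIV > 0" by (rule log_capacity_segment_pos) auto
  have "Gamma_step k (cspace (Suc k)) = cspace k" for k
  proof -
    have "{w. z(k := w) \<in> cspace (Suc k)} = UNIV" if "z \<in> cspace k" for z
      using that by (auto simp: cspace_def)
    then show ?thesis using pos by (auto simp: Gamma_step_def)
  qed
  then have "Gamma_iter k (cspace (Suc k)) = cspace 1" for k
    by (induction k) auto
  moreover have "w \<in> (\<lambda>z. z 0) ` cspace 1" for w
    by (rule image_eqI[of _ _ "(\<lambda>_. 0)(0 := w)"]) (auto simp: cspace_def)
  moreover have "m = Suc (m - 1)" using m by simp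
  ultimately have "Gamma_proj m (mat_apply m u ` cspace m) = UNIV"
    unfolding Gamma_proj_def im by (metis UNIV_eq_I)
  then have "0 < log_capacity (Gamma_proj m (mat_apply m u ` cspace m))" using pos by simp
  also have "\<dots> \<le> Gamma_capacity m (cspace m)"
    unfolding Gamma_capacity_def by (rule SUP_upper) (use u in auto)
  finally show ?thesis by simp
qed

section \<open>Generalized eigenspaces\<close>

text \<open>The vectors annihilated by a finite composition of operators \<open>D - a\<close> with
  \<open>a\<close> in \<open>S\<close>: for linear \<open>D\<close>, the sum of the generalized
  eigenspaces for \<open>S\<close>. The inductive form makes sense on the infinite-dimensional
  spaces of series and needs no bound on the length of the chain.\<close>

inductive_set gen_eigenspace :: "(complex \<Rightarrow> 'v \<Rightarrow> 'v) \<Rightarrow> ('v \<Rightarrow> 'v) \<Rightarrow> complex set \<Rightarrow> 'v::ab_group_add set"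
  for sc D S where
  zero: "0 \<in> gen_eigenspace sc D S"
| step: "a \<in> S \<Longrightarrow> D v - sc a v \<in> gen_eigenspace sc D S \<Longrightarrow> v \<in> gen_eigenspace sc D S"

lemma gen_eigenspace_mono:
  assumes "v \<in> gen_eigenspace sc D S" "S \<subseteq> T"
  shows "v \<in> gen_eigenspace sc D T"
  using assms(1) by induction (use assms(2) in \<open>auto intro: gen_eigenspace.intros\<close>)

locale complex_endo = Vector_Spaces.linear sc sc D
  for sc :: "complex \<Rightarrow> 'v::ab_group_add \<Rightarrow> 'v" and D
begin

abbreviation "G \<equiv> gen_eigenspace sc D"

lemma gen_invariant: "v \<in> G S \<Longrightarrow> D v - sc b v \<in> G S"
proof (induction rule: gen_eigenspace.induct)
  case (step a v)
  have "D (D v - sc b v) - sc a (D v - sc b v) = D (D v - sc a v) - sc b (D v - sc a v)"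
    by (simp add: diff scale vs1.scale_right_diff_distrib algebra_simps)
  with step show ?case by (metis gen_eigenspace.step)
qed (simp add: gen_eigenspace.zero)

text \<open>The chain of \<open>v\<close> is followed first; meanwhile \<open>w\<close> stays in the
  set by \<open>gen_invariant\<close>, which holds because the operators \<open>D - a\<close> and
  \<open>D - b\<close> commute.\<close>

lemma gen_add: "v \<in> G S \<Longrightarrow> w \<in> G S \<Longrightarrow> v + w \<in> G S"
proof (induction arbitrary: w rule: gen_eigenspace.induct)
  case (step a v)
  have "D (v + w) - sc a (v + w) = (D v - sc a v) + (D w - sc a w)"
    by (simp add: add vs1.scale_right_distrib)
  with step show ?case by (metis gen_eigenspace.step gen_invariant)
qed simp

lemma gen_scale: "v \<in> G S \<Longrightarrow> sc c v \<in> G S"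
proof (induction rule: gen_eigenspace.induct)
  case (step a v)
  have "D (sc c v) - sc a (sc c v) = sc c (D v - sc a v)"
    by (simp add: scale vs1.scale_right_diff_distrib mult.commute)
  with step show ?case by (metis gen_eigenspace.step)
qed (simp add: gen_eigenspace.zero)

lemma gen_sum: "(\<And>i. i \<in> I \<Longrightarrow> f i \<in> G S) \<Longrightarrow> (\<Sum>i\<in>I. f i) \<in> G S"
  by (induction I rule: infinite_finite_induct) (auto intro: gen_add gen_eigenspace.zero)

text \<open>If (D - a) w = (D - s) v, then (D - a)(v - w) = (s - a) v, and s - a can be divided out.
  The invariant subspace \<open>W\<close> records that the solution has the same type as the
  right-hand side; below it consists of homogeneous maps.\<close>

lemma gen_solve:
  assumes "v \<in> G S" "v \<in> W" "a \<notin> S" and W: "vs1.subspace W" "\<And>w. w \<in> W \<Longrightarrow> D w \<in> W"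
  shows "\<exists>w\<in>W. D w - sc a w = v"
  using assms(1,2)
proof (induction rule: gen_eigenspace.induct)
  case zero
  then show ?case using vs1.subspace_0[OF W(1)] by (intro bexI[of _ 0]) auto
next
  case (step s v)
  then obtain w where w: "w \<in> W" "D w - sc a w = D v - sc s v"
    using W by (meson vs1.subspace_diff vs1.subspace_scale)
  have sa: "s - a \<noteq> 0" using step assms(3) by auto
  have "D (v - w) - sc a (v - w) = sc (s - a) v"
    using w(2) by (simp add: diff vs1.scale_right_diff_distrib vs1.scale_left_diff_distrib algebra_simps)
  then have "D (sc (1 / (s - a)) (v - w)) - sc a (sc (1 / (s - a)) (v - w)) = sc (1 / (s - a)) (sc (s - a) v)"
    by (metis scale vs1.scale_right_diff_distrib vs1.scale_left_commute)
  also have "\<dots> = v" using sa by simp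
  finally show ?case
    using step w W by (intro bexI[of _ "sc (1 / (s - a)) (v - w)"])
      (auto intro: vs1.subspace_diff vs1.subspace_scale)
qed

text \<open>On an eigenvector for \<open>a\<close> the operator \<open>D - s\<close> is
  multiplication by a - s, so the end 0 of the chain forces the vector to be 0.\<close>

lemma gen_eigenvector_zero:
  assumes "v \<in> G S" "D v = sc a v" "a \<notin> S"
  shows "v = 0"
  using assms(1,2)
proof (induction rule: gen_eigenspace.induct)
  case (step s v)
  have eq: "D v - sc s v = sc (a - s) v" using step by (simp add: vs1.scale_left_diff_distrib)
  then have "D (D v - sc s v) = sc a (D v - sc s v)"
    using step by (simp add: scale mult.commute)
  then have "sc (a - s) v = 0" using step eq by simp
  then show ?case using step assms(3) by auto
qed simp

end

text \<open>Product rule for tensor-like operations: eigenvalues multiply. With D1 u = u' + s u and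
  D2 v = v' + t v, the image of b(u, v) under D3 - st is b(u', v') + t b(u', v) + s b(u, v'), whose
  terms are all earlier in one of the two chains.\<close>

lemma gen_eigenspace_bilinear:
  assumes "complex_endo sc1 D1" "complex_endo sc2 D2" "complex_endo sc3 D3"
    and add: "\<And>u u' v. b (u + u') v = b u v + b u' v" "\<And>u v v'. b u (v + v') = b u v + b u v'"
    and scale: "\<And>c u v. b (sc1 c u) v = sc3 c (b u v)" "\<And>c u v. b u (sc2 c v) = sc3 c (b u v)"
    and D: "\<And>u v. D3 (b u v) = b (D1 u) (D2 v)"
    and "u \<in> gen_eigenspace sc1 D1 S" "v \<in> gen_eigenspace sc2 D2 T"
  shows "b u v \<in> gen_eigenspace sc3 D3 {s * t | s t. s \<in> S \<and> t \<in> T}"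
  using assms(9,10)
proof (induction arbitrary: v rule: gen_eigenspace.induct)
  case (zero v)
  have "b 0 v = 0" using add(1)[of 0 0 v] by simp
  then show ?case by (simp add: gen_eigenspace.zero)
next
  case (step s u v)
  interpret e3: complex_endo sc3 D3 by fact
  interpret e1: complex_endo sc1 D1 by fact
  interpret e2: complex_endo sc2 D2 by fact
  note outer = step.IH and s = step.hyps(1)
  show ?case
    using step.prems
  proof (induction rule: gen_eigenspace.induct)
    case zero
    have "b u 0 = 0" using add(2)[of u 0 0] by simp
    then show ?case by (simp add: gen_eigenspace.zero)
  next
    case (step t v)
    define u' where "u' = D1 u - sc1 s u"
    define v' where "v' = D2 v - sc2 t v"
    have eq: "D1 u = u' + sc1 s u" "D2 v = v' + sc2 t v" by (auto simp: u'_def v'_def)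
    have "D3 (b u v) - sc3 (s * t) (b u v) = b u' v' + sc3 t (b u' v) + sc3 s (b u v')"
      unfolding D eq add scale by (simp add: e3.vs1.scale_right_distrib mult.commute)
    moreover have "b u' v' \<in> e3.G {s * t | s t. s \<in> S \<and> t \<in> T}" "b u' v \<in> e3.G {s * t | s t. s \<in> S \<and> t \<in> T}"
      unfolding u'_def v'_def using outer[OF step.hyps(2)] outer[OF gen_eigenspace.step[OF step.hyps(1,2)]] .
    moreover have "b u v' \<in> e3.G {s * t | s t. s \<in> S \<and> t \<in> T}" using step.IH by (simp add: v'_def)
    ultimately have "D3 (b u v) - sc3 (s * t) (b u v) \<in> e3.G {s * t | s t. s \<in> S \<and> t \<in> T}"
      by (simp only: e3.gen_add e3.gen_scale)
    moreover have "s * t \<in> {s * t | s t. s \<in> S \<and> t \<in> T}" using s step.hyps(1) by blast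
    ultimately show ?case by (rule gen_eigenspace.step[rotated])
  qed
qed

lemma gen_eigenspace_intertwine:
  assumes "v \<in> gen_eigenspace sc1 D1 S"
    and "\<phi> 0 = 0" "\<And>v w. \<phi> (v - w) = \<phi> v - \<phi> w" "\<And>c v. \<phi> (sc1 c v) = sc2 c (\<phi> v)" "\<And>v. \<phi> (D1 v) = D2 (\<phi> v)"
  shows "\<phi> v \<in> gen_eigenspace sc2 D2 S"
  using assms(1) by induction (use assms(2-) in \<open>auto intro: gen_eigenspace.intros\<close>)

section \<open>Generalized eigenspaces of a complex matrix\<close>

definition poly_apply :: "complex ^ 'n ^ 'n \<Rightarrow> complex poly \<Rightarrow> complex ^ 'n \<Rightarrow> complex ^ 'n" where
  "poly_apply B q v = (\<Sum>i\<le>degree q. coeff q i *s ((*v) B ^^ i) v)"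

lemma poly_apply_altdef:
  assumes "degree q \<le> N"
  shows "poly_apply B q v = (\<Sum>i\<le>N. coeff q i *s ((*v) B ^^ i) v)"
  unfolding poly_apply_def using assms
  by (intro sum.mono_neutral_left) (auto simp: coeff_eq_0)

lemma matrix_funpow_add: "((*v) B ^^ i) (v + w) = ((*v) B ^^ i) v + ((*v) (B :: complex ^ 'n ^ 'n) ^^ i) w"
  by (induction i) (auto simp: matrix_vector_right_distrib)

lemma matrix_funpow_scale: "((*v) B ^^ i) (c *s v) = c *s ((*v) (B :: complex ^ 'n ^ 'n) ^^ i) v"
  by (induction i) (auto simp: vec.scale)

lemma poly_apply_root:
  "poly_apply B ([:- a, 1:] * q) v = poly_apply B q (B *v v - a *s v)" (is ?A)
  "poly_apply B q (B *v v - a *s v) = B *v poly_apply B q v - a *s poly_apply B q v" (is ?B)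
proof -
  define N where "N = degree q"
  have eq: "((*v) B ^^ i) (B *v v - a *s v) = ((*v) B ^^ Suc i) v - a *s ((*v) B ^^ i) v" for i
    using matrix_funpow_add[of i B "B *v v" "(- a) *s v"] matrix_funpow_scale[of i B "- a" v]
    by (simp del: funpow.simps add: funpow_Suc_right)
  have "poly_apply B ([:- a, 1:] * q) v = (\<Sum>i\<le>Suc N. coeff ([:- a, 1:] * q) i *s ((*v) B ^^ i) v)"
    using degree_mult_le[of "[:- a, 1:]" q] by (intro poly_apply_altdef) (auto simp: N_def)
  also have "\<dots> = (\<Sum>i\<le>Suc N. coeff (pCons 0 q) i *s ((*v) B ^^ i) v) - a *s (\<Sum>i\<le>Suc N. coeff q i *s ((*v) B ^^ i) v)"
    by (simp add: vec.scale_sum_right sum_subtractf[symmetric] vec.scale_left_diff_distrib algebra_simps del: sum.atMost_Suc)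
  also have "(\<Sum>i\<le>Suc N. coeff (pCons 0 q) i *s ((*v) B ^^ i) v) = (\<Sum>i\<le>N. coeff q i *s ((*v) B ^^ Suc i) v)"
    by (subst sum.atMost_Suc_shift) simp
  also have "(\<Sum>i\<le>Suc N. coeff q i *s ((*v) B ^^ i) v) = (\<Sum>i\<le>N. coeff q i *s ((*v) B ^^ i) v)"
    by (simp add: coeff_eq_0 N_def)
  finally have 1: "poly_apply B ([:- a, 1:] * q) v =
      (\<Sum>i\<le>N. coeff q i *s ((*v) B ^^ Suc i) v) - a *s (\<Sum>i\<le>N. coeff q i *s ((*v) B ^^ i) v)" .
  have 2: "poly_apply B q (B *v v - a *s v) =
      (\<Sum>i\<le>N. coeff q i *s ((*v) B ^^ Suc i) v) - a *s (\<Sum>i\<le>N. coeff q i *s ((*v) B ^^ i) v)"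
    unfolding poly_apply_def N_def[symmetric] eq
    by (simp add: vec.scale_sum_right sum_subtractf[symmetric] vec.scale_right_diff_distrib mult.commute)
  show ?A using 1 2 by simp
  have "B *v poly_apply B q v = (\<Sum>i\<le>N. coeff q i *s ((*v) B ^^ Suc i) v)"
    unfolding poly_apply_def N_def[symmetric] by (simp add: vec.sum vec.scale)
  then show ?B using 2 by (simp add: poly_apply_def N_def)
qed

text \<open>Every vector is killed by some nonzero polynomial in \<open>B\<close>, and over the
  complex numbers that polynomial splits; removing one linear factor after another produces the
  chain required by \<open>gen_eigenspace\<close>.\<close>

lemma gen_eigenspace_matrix:
  fixes B :: "complex ^ 'n ^ 'n"
  assumes S: "\<And>a v. v \<noteq> 0 \<Longrightarrow> B *v v = a *s v \<Longrightarrow> a \<in> S"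
  shows "v \<in> gen_eigenspace (*s) ((*v) B) S"
proof -
  have main: "v \<in> gen_eigenspace (*s) ((*v) B) S" if "q \<noteq> 0" "poly_apply B q v = 0" for q v
    using that
  proof (induction "degree q" arbitrary: q v)
    case 0
    then obtain c where "q = [:c:]" "c \<noteq> 0" by (metis degree_eq_zeroE pCons_0_0)
    with 0 have "v = 0" by (simp add: poly_apply_def)
    then show ?case by (simp add: gen_eigenspace.zero)
  next
    case (Suc n)
    then have "\<not> constant (poly q)" by (simp add: constant_degree)
    then obtain a where "poly q a = 0" using fundamental_theorem_of_algebra by blast
    then obtain r where q: "q = [:- a, 1:] * r" using poly_eq_0_iff_dvd by (metis dvdE)
    have r: "r \<noteq> 0" using Suc q by auto
    have n: "n = degree r" using Suc(2) unfolding q by (subst (asm) degree_mult_eq) (use r in auto)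
    have 0: "poly_apply B r (B *v v - a *s v) = 0" using Suc poly_apply_root(1) q by metis
    show ?case
    proof (cases "a \<in> S")
      case True
      then show ?thesis using Suc(1)[OF n r 0] by (rule gen_eigenspace.step)
    next
      case False
      \<comment> \<open>A root outside \<open>S\<close> is not an eigenvalue, so
        \<open>B - a\<close> is injective and the factor can be cancelled.\<close>
      have "poly_apply B r v = 0" using S[of "poly_apply B r v" a] 0 poly_apply_root(2)[of B r v a] False by auto
      then show ?thesis by (rule Suc(1)[OF n r])
    qed
  qed
  define p where "p i = ((*v) B ^^ i) v" for i
  define N where "N = CARD('n)"
  \<comment> \<open>N + 1 iterates in dimension N are dependent. Repeated iterates are treated
    apart, since dependence of a set does not see repetitions.\<close>
  have "\<exists>u. (\<exists>i\<le>N. u i \<noteq> 0) \<and> (\<Sum>i\<le>N. u i *s p i) = 0"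
  proof (cases "inj_on p {..N}")
    case True
    have "vec.dim (p ` {..N}) \<le> N"
      using vec.dim_subset_UNIV[of "p ` {..N}"] by (simp add: vec.dimension_def card_cart_basis N_def)
    then have "vec.dependent (p ` {..N})"
      by (intro vec.dependent_biggerset_general) (simp add: card_image[OF True])
    then obtain u where u: "\<exists>v\<in>p ` {..N}. u v \<noteq> 0" "(\<Sum>v\<in>p ` {..N}. u v *s v) = 0"
      using vec.dependent_finite by blast
    have "(\<Sum>i\<le>N. u (p i) *s p i) = 0" using u(2) by (simp add: sum.reindex[OF True])
    then show ?thesis using u(1) by (intro exI[of _ "\<lambda>i. u (p i)"]) auto
  next
    case False
    then obtain i j where ij: "i \<le> N" "j \<le> N" "i \<noteq> j" "p i = p j" by (auto simp: inj_on_def)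
    have "(\<Sum>k\<le>N. (if k = i then 1 else if k = j then - 1 else 0) *s p k) =
        (\<Sum>k\<in>{i, j}. (if k = i then 1 else if k = j then - 1 else 0) *s p k)"
      using ij by (intro sum.mono_neutral_right) auto
    also have "\<dots> = 0" using ij by simp
    finally show ?thesis using ij(1)
      by (intro exI[of _ "\<lambda>k. if k = i then 1 else if k = j then - 1 else 0"]) auto
  qed
  then obtain u i where u: "i \<le> N" "u i \<noteq> 0" "(\<Sum>i\<le>N. u i *s p i) = 0" by blast
  define q where "q = (\<Sum>i\<le>N. monom (u i) i)"
  have cq: "coeff q i = (if i \<le> N then u i else 0)" for i
    unfolding q_def by (simp add: coeff_sum)
  have "q \<noteq> 0" using u cq by (metis coeff_0)
  moreover have "degree q \<le> N" by (rule degree_le) (simp add: cq)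
  then have "poly_apply B q v = 0" using u(3) by (simp add: poly_apply_altdef cq p_def)
  ultimately show ?thesis by (rule main)
qed

lemma matrix_inv_mult:
  assumes "invertible A"
  shows "A ** matrix_inv A = mat 1" "matrix_inv A ** A = mat 1"
  using someI_ex[OF assms[unfolded invertible_def]] unfolding matrix_inv_def by blast+

text \<open>The homological equation acts on maps from both sides: composition with \<open>A\<close>
  acts on linear forms through the transpose, and division by \<open>A\<close> acts on values
  through the inverse.\<close>

lemma gen_eigenspace_transpose_inverse:
  fixes A :: "complex ^ 'n ^ 'n"
  assumes ev: "eigenvalues_with_multiplicity A ev" and A: "invertible A"
  shows "v \<in> gen_eigenspace (*s) ((*v) (transpose A)) (range ev)"
    and "v \<in> gen_eigenspace (*s) ((*v) (matrix_inv A)) (range (\<lambda>j. inverse (ev j)))"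
proof -
  have eig: "a \<in> range ev" if "w \<noteq> 0" "B *v w = a *s w" "B = A \<or> B = transpose A" for w a B
  proof -
    have "(mat a - B) *v w = 0"
      using that(2) by (simp add: matrix_vector_mult_def mat_def vec_eq_iff left_diff_distrib sum_subtractf
          if_distrib[where f = "\<lambda>x. x * _"] cong: if_cong)
    then have "det (mat a - B) = 0"
      using that(1) invertible_det_nz[of "mat a - B"]
      by (metis matrix_left_invertible_ker invertible_def)
    moreover have "det (mat a - transpose A) = det (mat a - A)"
    proof -
      have "mat a - transpose A = transpose (mat a - A)" by (simp add: transpose_def mat_def vec_eq_iff)
      then show ?thesis by (simp add: det_transpose)
    qed
    ultimately have "(\<Prod>j\<in>UNIV. a - ev j) = 0"
      using ev that(3) unfolding eigenvalues_with_multiplicity_def by auto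
    then show ?thesis by auto
  qed
  show "v \<in> gen_eigenspace (*s) ((*v) (transpose A)) (range ev)"
    by (rule gen_eigenspace_matrix) (use eig in blast)
  show "v \<in> gen_eigenspace (*s) ((*v) (matrix_inv A)) (range (\<lambda>j. inverse (ev j)))"
  proof (rule gen_eigenspace_matrix)
    fix a w assume w: "w \<noteq> 0" "matrix_inv A *v w = a *s w"
    then have "A *v (matrix_inv A *v w) = a *s (A *v w)" by (simp add: vec.scale)
    then have eq: "w = a *s (A *v w)" using A by (simp add: matrix_vector_mul_assoc matrix_inv_mult)
    then have a: "a \<noteq> 0" using w(1) by auto
    then have "A *v w = inverse a *s w" by (metis eq vec.scale_scale left_inverse vec.scale_one)
    then obtain j where "inverse a = ev j" using eig[of w A] w(1) by blast
    then have "a = inverse (ev j)" by (metis inverse_inverse_eq)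
    then show "a \<in> range (\<lambda>j. inverse (ev j))" by simp
  qed
qed

section \<open>Formal power series\<close>

lemma mfps_nth_0 [simp]: "mfps_nth 0 \<alpha> = 0" by (simp add: zero_mfps.rep_eq)
lemma mfps_nth_1: "mfps_nth 1 \<alpha> = (if \<alpha> = (\<lambda>_. 0) then 1 else 0)" by (simp add: one_mfps.rep_eq)
lemma mfps_nth_add [simp]: "mfps_nth (P + Q) \<alpha> = mfps_nth P \<alpha> + mfps_nth Q \<alpha>" by (simp add: plus_mfps.rep_eq)
lemma mfps_nth_diff [simp]: "mfps_nth (P - Q) \<alpha> = mfps_nth P \<alpha> - mfps_nth Q \<alpha>" by (simp add: minus_mfps.rep_eq)
lemma mfps_nth_mult: "mfps_nth (P * Q) \<alpha> = (\<Sum>(\<beta>, \<gamma>)\<in>splittings \<alpha>. mfps_nth P \<beta> * mfps_nth Q \<gamma>)" by (simp add: times_mfps.rep_eq)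
lemma mfps_nth_Abs [simp]: "mfps_nth (Abs_mfps f) = f" by (simp add: Abs_mfps_inverse)
lemma mfps_nth_sum [simp]: "mfps_nth (\<Sum>i\<in>I. P i) \<alpha> = (\<Sum>i\<in>I. mfps_nth (P i) \<alpha>)"
  by (induction I rule: infinite_finite_induct) auto

lemma sum_splitting: "(\<beta>, \<gamma>) \<in> splittings \<alpha> \<Longrightarrow> sum \<alpha> UNIV = sum \<beta> UNIV + sum \<gamma> UNIV"
  by (simp add: splittings_def flip: sum.distrib)

lemma finite_degree_le [simp]: "finite {\<beta> :: 'n::finite \<Rightarrow> nat. sum \<beta> UNIV \<le> k}"
proof (rule finite_subset)
  show "{\<beta> :: 'n \<Rightarrow> nat. sum \<beta> UNIV \<le> k} \<subseteq> PiE UNIV (\<lambda>_. {..k})"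
  proof
    fix \<beta> :: "'n \<Rightarrow> nat" assume \<beta>: "\<beta> \<in> {\<beta>. sum \<beta> UNIV \<le> k}"
    have "\<beta> i \<le> k" for i
      using member_le_sum[of i UNIV \<beta>] \<beta> by simp
    then show "\<beta> \<in> PiE UNIV (\<lambda>_. {..k})" by (simp add: PiE_iff)
  qed
qed (auto intro: finite_PiE)

lemma finite_degree_eq [simp]: "finite {\<beta> :: 'n::finite \<Rightarrow> nat. sum \<beta> UNIV = k}"
  by (rule finite_subset[OF _ finite_degree_le[of k]]) auto

lemma mfps_nth_const_mult [simp]:
  fixes P :: "('a::comm_ring_1, 'n::finite) mfps"
  shows "mfps_nth (mfps_const c * P) \<alpha> = c * mfps_nth P \<alpha>"
proof -
  have "(\<Sum>(\<beta>, \<gamma>)\<in>splittings \<alpha>. mfps_nth (mfps_const c) \<beta> * mfps_nth P \<gamma>) =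
      (\<Sum>(\<beta>, \<gamma>)\<in>{((\<lambda>_. 0) :: 'n \<Rightarrow> nat, \<alpha>)}. mfps_nth (mfps_const c) \<beta> * mfps_nth P \<gamma>)"
  proof (rule sum.mono_neutral_right)
    show "{((\<lambda>_. 0), \<alpha>)} \<subseteq> splittings \<alpha>" by (simp add: splittings_def)
    show "\<forall>p\<in>splittings \<alpha> - {((\<lambda>_. 0), \<alpha>)}. (case p of (\<beta>, \<gamma>) \<Rightarrow> mfps_nth (mfps_const c) \<beta> * mfps_nth P \<gamma>) = 0"
    proof
      fix p assume p: "p \<in> splittings \<alpha> - {((\<lambda>_. 0), \<alpha>)}"
      obtain \<beta> \<gamma> where "p = (\<beta>, \<gamma>)" by (cases p)
      moreover from this have "\<beta> \<noteq> (\<lambda>_. 0)" using p by (auto simp: splittings_def)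
      ultimately show "(case p of (\<beta>, \<gamma>) \<Rightarrow> mfps_nth (mfps_const c) \<beta> * mfps_nth P \<gamma>) = 0"
        by (simp add: mfps_const.rep_eq)
    qed
  qed simp
  then show ?thesis by (simp add: mfps_nth_mult mfps_const.rep_eq)
qed

definition mfps_monom :: "('n \<Rightarrow> nat) \<Rightarrow> ('a::comm_ring_1, 'n::finite) mfps" where
  "mfps_monom \<beta> = Abs_mfps (\<lambda>\<alpha>. if \<alpha> = \<beta> then 1 else 0)"

lemma mfps_nth_monom [simp]: "mfps_nth (mfps_monom \<beta>) \<alpha> = (if \<alpha> = \<beta> then 1 else 0)"
  by (simp add: mfps_monom_def)

lemma mfps_monom_mult: "mfps_monom \<beta> * mfps_monom \<gamma> = mfps_monom (\<lambda>j. \<beta> j + \<gamma> j)"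
proof (rule mfps_eqI)
  fix \<alpha>
  have "mfps_nth (mfps_monom \<beta> * mfps_monom \<gamma>) \<alpha> =
      (\<Sum>p\<in>splittings \<alpha>. if p = (\<beta>, \<gamma>) then 1 else 0)"
    unfolding mfps_nth_mult by (intro sum.cong refl) (simp add: prod_eq_iff case_prod_unfold)
  also have "\<dots> = (if (\<beta>, \<gamma>) \<in> splittings \<alpha> then 1 else 0)" by simp
  also have "(\<beta>, \<gamma>) \<in> splittings \<alpha> \<longleftrightarrow> \<alpha> = (\<lambda>j. \<beta> j + \<gamma> j)" by (auto simp: splittings_def)
  finally show "mfps_nth (mfps_monom \<beta> * mfps_monom \<gamma>) \<alpha> = mfps_nth (mfps_monom (\<lambda>j. \<beta> j + \<gamma> j)) \<alpha>"
    by simp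
qed

abbreviation mfps_X :: "'n \<Rightarrow> ('a::comm_ring_1, 'n::finite) mfps" where
  "mfps_X j \<equiv> mfps_monom ((\<lambda>_. 0)(j := 1))"

lemma mfps_monom_0: "mfps_monom (\<lambda>_. 0) = 1"
  by (rule mfps_eqI) (simp add: mfps_nth_1)

lemma mfps_X_prod:
  fixes \<beta> :: "'n::finite \<Rightarrow> nat"
  shows "(\<Prod>j\<in>UNIV. mfps_X j ^ \<beta> j) = mfps_monom \<beta>"
proof -
  have X: "mfps_X j ^ k = mfps_monom ((\<lambda>_. 0)(j := k))" for j :: 'n and k
  proof (induction k)
    case 0
    have "(\<lambda>_. 0)(j := 0) = (\<lambda>_. 0 :: nat)" by auto
    then show ?case by (simp add: mfps_monom_0)
  next
    case (Suc k)
    have *: "(\<lambda>i. ((\<lambda>_. 0)(j := 1)) i + ((\<lambda>_. 0)(j := k)) i) = (\<lambda>_. 0 :: nat)(j := Suc k)" by auto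
    show ?case unfolding power_Suc Suc mfps_monom_mult * ..
  qed
  have "(\<Prod>j\<in>S. mfps_X j ^ \<beta> j) = mfps_monom (\<lambda>j. if j \<in> S then \<beta> j else 0)" if "finite S" for S
    using that
  proof (induction S rule: finite_induct)
    case (insert j S)
    have *: "(\<lambda>i. ((\<lambda>_. 0)(j := \<beta> j)) i + (if i \<in> S then \<beta> i else 0)) = (\<lambda>i. if i \<in> insert j S then \<beta> i else 0)"
      using insert(2) by auto
    show ?case
      unfolding prod.insert[OF insert(1,2)] insert(3) unfolding X mfps_monom_mult * ..
  qed (simp add: mfps_monom_0)
  from this[of UNIV] show ?thesis by simp
qed

section \<open>Graded products and powers of formal maps\<close>

text \<open>Common scheme of the degree counts below. The index type \<open>'t\<close> is
  \<open>unit\<close> for a single series, \<open>bool\<close> for comparing two maps, and the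
  parameter space for polynomial dependence on \<open>t\<close>.\<close>

lemma graded_power_prod:
  fixes F :: "'t \<Rightarrow> 'n::finite \<Rightarrow> 'r::comm_ring_1"
  assumes one: "G 0 (\<lambda>t. 1)"
    and mult: "\<And>a b P Q. G a P \<Longrightarrow> G b Q \<Longrightarrow> G (a + b) (\<lambda>t. P t * Q t)"
    and F: "\<And>j. G 1 (\<lambda>t. F t j)"
  shows "G (sum \<beta> UNIV) (\<lambda>t. \<Prod>j\<in>UNIV. F t j ^ \<beta> j)"
proof -
  have pow: "G k (\<lambda>t. F t j ^ k)" for j k
  proof (induction k)
    case (Suc k)
    then show ?case using mult[OF F Suc, of j] by simp
  qed (simp add: one)
  have "G (sum \<beta> S) (\<lambda>t. \<Prod>j\<in>S. F t j ^ \<beta> j)" if "finite S" for S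
    using that
  proof (induction S rule: finite_induct)
    case (insert j S)
    then show ?case using mult[OF pow insert(3), of "\<beta> j" j] by simp
  qed (simp add: one)
  then show ?thesis by simp
qed

definition mfps_pow :: "('a::comm_ring_1, 'n::finite) mfps ^ 'n \<Rightarrow> ('n \<Rightarrow> nat) \<Rightarrow> ('a, 'n) mfps" where
  "mfps_pow F \<beta> = (\<Prod>j\<in>UNIV. (F $ j) ^ \<beta> j)"

lemma mfps_pow_add: "mfps_pow F (\<lambda>j. \<beta> j + \<gamma> j) = mfps_pow F \<beta> * mfps_pow F \<gamma>"
  by (simp add: mfps_pow_def power_add prod.distrib)

lemma mfps_pow_low:
  fixes F :: "('a::comm_ring_1, 'b::finite) mfps ^ 'b"
  assumes "\<And>j. mfps_nth (F $ j) (\<lambda>_. 0) = 0" "sum \<alpha> UNIV < sum \<beta> UNIV"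
  shows "mfps_nth (mfps_pow F \<beta>) \<alpha> = 0"
proof -
  define G where "G k (P :: unit \<Rightarrow> ('a, 'b) mfps) \<longleftrightarrow> (\<forall>\<alpha>. sum \<alpha> UNIV < k \<longrightarrow> mfps_nth (P ()) \<alpha> = 0)" for k P
  have "G (sum \<beta> UNIV) (\<lambda>_. \<Prod>j\<in>UNIV. (F $ j) ^ \<beta> j)"
  proof (rule graded_power_prod)
    show "G 0 (\<lambda>_. 1)" by (simp add: G_def)
    show "G 1 (\<lambda>_. F $ j)" for j
    proof -
      have "\<alpha> = (\<lambda>_. 0)" if "sum \<alpha> UNIV < (1 :: nat)" for \<alpha> :: "'b \<Rightarrow> nat" using that by auto
      then show ?thesis using assms(1) unfolding G_def by metis
    qed
    show "G (a + b) (\<lambda>t. P t * Q t)" if P: "G a P" "G b Q" for a b P Q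
      unfolding G_def
    proof (intro allI impI)
      fix \<alpha> :: "'b \<Rightarrow> nat" assume \<alpha>: "sum \<alpha> UNIV < a + b"
      show "mfps_nth (P () * Q ()) \<alpha> = 0"
        unfolding mfps_nth_mult
      proof (rule sum.neutral, clarify)
        fix \<beta> \<gamma> assume "(\<beta>, \<gamma>) \<in> splittings \<alpha>"
        with \<alpha> have "sum \<beta> UNIV < a \<or> sum \<gamma> UNIV < b" by (auto simp: sum_splitting)
        then show "mfps_nth (P ()) \<beta> * mfps_nth (Q ()) \<gamma> = 0" using P by (auto simp: G_def)
      qed
    qed
  qed
  then show ?thesis using assms(2) by (simp add: G_def mfps_pow_def)
qed

lemma degree_0_index: "sum \<alpha> UNIV < 1 \<Longrightarrow> \<alpha> = (\<lambda>_. 0 :: nat)" for \<alpha> :: "'n::finite \<Rightarrow> nat"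
  by auto

lemma degree_1_index:
  fixes \<alpha> :: "'n::finite \<Rightarrow> nat"
  assumes \<alpha>: "sum \<alpha> UNIV = 1"
  shows "\<exists>j. \<alpha> = (\<lambda>_. 0)(j := 1)"
proof -
  obtain j where "\<alpha> j = 1" "\<forall>i\<in>UNIV. j \<noteq> i \<longrightarrow> \<alpha> i = 0"
    using \<alpha> sum_eq_1_iff[of UNIV \<alpha>] by auto
  then show ?thesis by (intro exI[of _ j]) auto
qed

text \<open>The lowest-degree part of a product is the product of the lowest-degree parts, so it
  depends only on the linear parts. Vanishing below the degree is carried along in \<open>G\<close>
  because the product step needs it.\<close>

lemma mfps_pow_leading:
  fixes F :: "('a::comm_ring_1, 'b::finite) mfps ^ 'b"
  assumes "\<And>j. mfps_nth (F $ j) (\<lambda>_. 0) = 0" "\<And>j. mfps_nth (F' $ j) (\<lambda>_. 0) = 0"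
    and "\<And>i j. mfps_nth (F $ i) ((\<lambda>_. 0)(j := 1)) = mfps_nth (F' $ i) ((\<lambda>_. 0)(j := 1))"
    and "sum \<alpha> UNIV = sum \<beta> UNIV"
  shows "mfps_nth (mfps_pow F \<beta>) \<alpha> = mfps_nth (mfps_pow F' \<beta>) \<alpha>"
proof -
  define G where "G k (P :: bool \<Rightarrow> ('a, 'b) mfps) \<longleftrightarrow>
    (\<forall>\<alpha>. (sum \<alpha> UNIV < k \<longrightarrow> (\<forall>x. mfps_nth (P x) \<alpha> = 0)) \<and>
         (sum \<alpha> UNIV = k \<longrightarrow> mfps_nth (P True) \<alpha> = mfps_nth (P False) \<alpha>))" for k P
  have "G (sum \<beta> UNIV) (\<lambda>x. \<Prod>j\<in>UNIV. ((if x then F else F') $ j) ^ \<beta> j)"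
  proof (rule graded_power_prod)
    show "G 0 (\<lambda>_. 1)" by (simp add: G_def)
    show "G 1 (\<lambda>x. (if x then F else F') $ j)" for j
    proof -
      show ?thesis unfolding G_def
      proof (intro allI conjI impI)
        fix \<alpha> :: "'b \<Rightarrow> nat" and x assume "sum \<alpha> UNIV < 1"
        then have "\<alpha> = (\<lambda>_. 0)" by (rule degree_0_index)
        then show "mfps_nth ((if x then F else F') $ j) \<alpha> = 0" using assms(1,2) by simp
      next
        fix \<alpha> :: "'b \<Rightarrow> nat" assume "sum \<alpha> UNIV = 1"
        then obtain i where "\<alpha> = (\<lambda>_. 0)(i := 1)" using degree_1_index by blast
        then show "mfps_nth ((if True then F else F') $ j) \<alpha> = mfps_nth ((if False then F else F') $ j) \<alpha>"
          using assms(3) by simp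
      qed
    qed
    show "G (a + b) (\<lambda>t. P t * Q t)" if P: "G a P" "G b Q" for a b P Q
      unfolding G_def
    proof (intro allI impI conjI)
      fix \<alpha> :: "'b \<Rightarrow> nat" and x assume \<alpha>: "sum \<alpha> UNIV < a + b"
      show "mfps_nth (P x * Q x) \<alpha> = 0"
        unfolding mfps_nth_mult
      proof (rule sum.neutral, clarify)
        fix \<beta> \<gamma> assume "(\<beta>, \<gamma>) \<in> splittings \<alpha>"
        with \<alpha> have "sum \<beta> UNIV < a \<or> sum \<gamma> UNIV < b" by (auto simp: sum_splitting)
        then show "mfps_nth (P x) \<beta> * mfps_nth (Q x) \<gamma> = 0" using P by (auto simp: G_def)
      qed
    next
      fix \<alpha> :: "'b \<Rightarrow> nat" assume \<alpha>: "sum \<alpha> UNIV = a + b"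
      show "mfps_nth (P True * Q True) \<alpha> = mfps_nth (P False * Q False) \<alpha>"
        unfolding mfps_nth_mult
      proof (rule sum.cong, simp, clarify)
        fix \<beta> \<gamma> assume "(\<beta>, \<gamma>) \<in> splittings \<alpha>"
        with \<alpha> have "sum \<beta> UNIV < a \<or> sum \<gamma> UNIV < b \<or> sum \<beta> UNIV = a \<and> sum \<gamma> UNIV = b"
          by (auto simp: sum_splitting)
        then show "mfps_nth (P True) \<beta> * mfps_nth (Q True) \<gamma> = mfps_nth (P False) \<beta> * mfps_nth (Q False) \<gamma>"
          using P by (auto simp: G_def)
      qed
    qed
  qed
  then show ?thesis using assms(4) by (simp add: G_def mfps_pow_def)
qed

section \<open>Substitution as a ring homomorphism\<close>

definition mfps_subst :: "('a::comm_ring_1, 'n::finite) mfps ^ 'n \<Rightarrow> ('a, 'n) mfps \<Rightarrow> ('a, 'n) mfps" where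
  "mfps_subst F P = Abs_mfps (\<lambda>\<alpha>. \<Sum>\<beta> | sum \<beta> UNIV \<le> sum \<alpha> UNIV. mfps_nth P \<beta> * mfps_nth (mfps_pow F \<beta>) \<alpha>)"

lemma mfps_comp_eq_subst: "mfps_comp h F $ i = mfps_subst F (h $ i)"
  by (simp add: mfps_comp_def mfps_subst_def mfps_pow_def)

text \<open>Indices of degree above that of \<alpha> contribute 0, so any larger truncation
  \<open>N\<close> is allowed and sums for different \<alpha> can be taken over one index
  set.\<close>

lemma mfps_nth_subst:
  assumes "\<And>j. mfps_nth (F $ j) (\<lambda>_. 0) = 0" "sum \<alpha> UNIV \<le> N"
  shows "mfps_nth (mfps_subst F P) \<alpha> = (\<Sum>\<beta> | sum \<beta> UNIV \<le> N. mfps_nth P \<beta> * mfps_nth (mfps_pow F \<beta>) \<alpha>)"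
  unfolding mfps_subst_def mfps_nth_Abs
  using assms(2) by (intro sum.mono_neutral_left) (auto simp: mfps_pow_low[OF assms(1)])

lemma mfps_subst_add: "mfps_subst F (P + Q) = mfps_subst F P + mfps_subst F Q"
  by (rule mfps_eqI) (simp add: mfps_subst_def distrib_right sum.distrib)

lemma mfps_subst_const_mult: "mfps_subst F (mfps_const c * P) = mfps_const c * mfps_subst F P"
  by (rule mfps_eqI) (simp add: mfps_subst_def sum_distrib_left mult.assoc)

lemma mfps_subst_monom:
  fixes F :: "('a::comm_ring_1, 'b::finite) mfps ^ 'b"
  assumes "\<And>j. mfps_nth (F $ j) (\<lambda>_. 0) = 0"
  shows "mfps_subst F (mfps_monom \<beta>) = mfps_pow F \<beta>"
proof (rule mfps_eqI)
  fix \<alpha> :: "'b \<Rightarrow> nat"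
  define N where "N = sum \<alpha> UNIV + sum \<beta> UNIV"
  show "mfps_nth (mfps_subst F (mfps_monom \<beta>)) \<alpha> = mfps_nth (mfps_pow F \<beta>) \<alpha>"
    by (subst mfps_nth_subst[OF assms, of _ N])
      (simp_all add: N_def if_distrib[where f = "\<lambda>x. x * _"] cong: if_cong)
qed

text \<open>Powers of \<open>F\<close> turn sums of indices into products, so both sides are sums
  over pairs of indices; the work is to pass from pairs of bounded total degree to a square of
  pairs, where the sum factors.\<close>

lemma mfps_subst_mult:
  fixes F :: "('a::comm_ring_1, 'b::finite) mfps ^ 'b"
  assumes F: "\<And>j. mfps_nth (F $ j) (\<lambda>_. 0) = 0"
  shows "mfps_subst F (P * Q) = mfps_subst F P * mfps_subst F Q"
proof (rule mfps_eqI)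
  fix \<alpha> :: "'b \<Rightarrow> nat"
  define N where "N = sum \<alpha> UNIV"
  define B where "B = {\<beta> :: 'b \<Rightarrow> nat. sum \<beta> UNIV \<le> N}"
  define f where "f p = mfps_nth P (fst p) * mfps_nth Q (snd p) *
    mfps_nth (mfps_pow F (\<lambda>j. fst p j + snd p j)) \<alpha>" for p
  have fin: "finite B" by (simp add: B_def)
  have "mfps_nth (mfps_subst F (P * Q)) \<alpha> =
      (\<Sum>\<beta>\<in>B. \<Sum>p\<in>splittings \<beta>. f p)"
  proof -
    have "(\<Sum>(\<gamma>, \<delta>)\<in>splittings \<beta>. mfps_nth P \<gamma> * mfps_nth Q \<delta>) * mfps_nth (mfps_pow F \<beta>) \<alpha> =
        (\<Sum>p\<in>splittings \<beta>. f p)" for \<beta>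
      unfolding sum_distrib_right by (rule sum.cong) (auto simp: f_def splittings_def fun_eq_iff[symmetric] simp flip: ext)
    then show ?thesis by (simp add: mfps_nth_subst[OF F, of _ N] N_def[symmetric] B_def mfps_nth_mult)
  qed
  also have "\<dots> = (\<Sum>q\<in>(SIGMA \<beta>:B. splittings \<beta>). f (snd q))"
    using fin by (simp add: sum.Sigma case_prod_unfold)
  also have "\<dots> = (\<Sum>p | p \<in> B \<times> B \<and> (\<lambda>j. fst p j + snd p j) \<in> B. f p)"
  proof (rule sum.reindex_bij_witness[where i = "\<lambda>p. (\<lambda>j. fst p j + snd p j, p)" and j = snd])
    fix q assume q: "q \<in> (SIGMA \<beta>:B. splittings \<beta>)"
    obtain \<beta> \<gamma> \<delta> where q': "q = (\<beta>, \<gamma>, \<delta>)" by (cases q)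
    have \<beta>: "\<beta> = (\<lambda>j. \<gamma> j + \<delta> j)" "sum \<beta> UNIV = sum \<gamma> UNIV + sum \<delta> UNIV"
      using q sum_splitting[of \<gamma> \<delta> \<beta>] by (auto simp: q' splittings_def)
    show "(\<lambda>j. fst (snd q) j + snd (snd q) j, snd q) = q" using \<beta>(1) by (simp add: q')
    show "snd q \<in> {p. p \<in> B \<times> B \<and> (\<lambda>j. fst p j + snd p j) \<in> B}"
      using q \<beta> by (auto simp: q' B_def)
  qed (auto simp: B_def splittings_def)
  \<comment> \<open>The added pairs have total degree above \<open>N\<close>, where the power of
    \<open>F\<close> has no coefficient at \<alpha>.\<close>
  also have "\<dots> = (\<Sum>p\<in>B \<times> B. f p)"
  proof (rule sum.mono_neutral_left)
    show "\<forall>p\<in>B \<times> B - {p \<in> B \<times> B. (\<lambda>j. fst p j + snd p j) \<in> B}. f p = 0"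
    proof
      fix p assume "p \<in> B \<times> B - {p \<in> B \<times> B. (\<lambda>j. fst p j + snd p j) \<in> B}"
      then have "sum \<alpha> UNIV < sum (\<lambda>j. fst p j + snd p j) UNIV" by (auto simp: B_def N_def)
      then show "f p = 0" unfolding f_def by (simp add: mfps_pow_low[OF F])
    qed
  qed (use fin in auto)
  also have "\<dots> = (\<Sum>\<gamma>\<in>B. \<Sum>\<delta>\<in>B. mfps_nth P \<gamma> * mfps_nth Q \<delta> *
      (\<Sum>(\<alpha>1, \<alpha>2)\<in>splittings \<alpha>. mfps_nth (mfps_pow F \<gamma>) \<alpha>1 * mfps_nth (mfps_pow F \<delta>) \<alpha>2))"
    by (simp add: sum.cartesian_product f_def mfps_pow_add mfps_nth_mult case_prod_unfold)
  also have "\<dots> = (\<Sum>\<gamma>\<in>B. \<Sum>\<delta>\<in>B. \<Sum>q\<in>splittings \<alpha>. (mfps_nth P \<gamma> * mfps_nth (mfps_pow F \<gamma>) (fst q)) *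
      (mfps_nth Q \<delta> * mfps_nth (mfps_pow F \<delta>) (snd q)))"
    by (simp add: sum_distrib_left case_prod_unfold mult_ac)
  also have "\<dots> = (\<Sum>\<gamma>\<in>B. \<Sum>q\<in>splittings \<alpha>. \<Sum>\<delta>\<in>B. (mfps_nth P \<gamma> * mfps_nth (mfps_pow F \<gamma>) (fst q)) *
      (mfps_nth Q \<delta> * mfps_nth (mfps_pow F \<delta>) (snd q)))"
    by (intro sum.cong refl sum.swap)
  also have "\<dots> = (\<Sum>q\<in>splittings \<alpha>. \<Sum>\<gamma>\<in>B. \<Sum>\<delta>\<in>B. (mfps_nth P \<gamma> * mfps_nth (mfps_pow F \<gamma>) (fst q)) *
      (mfps_nth Q \<delta> * mfps_nth (mfps_pow F \<delta>) (snd q)))"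
    by (rule sum.swap)
  also have "\<dots> = (\<Sum>q\<in>splittings \<alpha>. mfps_nth (mfps_subst F P) (fst q) * mfps_nth (mfps_subst F Q) (snd q))"
  proof (rule sum.cong)
    fix q assume "q \<in> splittings \<alpha>"
    then have "sum (fst q) UNIV \<le> N" "sum (snd q) UNIV \<le> N"
      using sum_splitting[of "fst q" "snd q" \<alpha>] by (auto simp: N_def)
    then show "(\<Sum>\<gamma>\<in>B. \<Sum>\<delta>\<in>B. (mfps_nth P \<gamma> * mfps_nth (mfps_pow F \<gamma>) (fst q)) *
      (mfps_nth Q \<delta> * mfps_nth (mfps_pow F \<delta>) (snd q))) =
      mfps_nth (mfps_subst F P) (fst q) * mfps_nth (mfps_subst F Q) (snd q)"
      by (simp add: mfps_nth_subst[OF F, of _ N] B_def sum_product)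
  qed simp
  also have "\<dots> = mfps_nth (mfps_subst F P * mfps_subst F Q) \<alpha>"
    by (simp add: mfps_nth_mult case_prod_unfold)
  finally show "mfps_nth (mfps_subst F (P * Q)) \<alpha> = mfps_nth (mfps_subst F P * mfps_subst F Q) \<alpha>" .
qed

definition linear_mfps :: "'a::comm_ring_1 ^ 'n ^ 'n \<Rightarrow> ('a, 'n::finite) mfps ^ 'n" where
  "linear_mfps A = (\<chi> i. \<Sum>j\<in>UNIV. mfps_const (A $ i $ j) * mfps_X j)"

lemma unit_index_neq_0: "(\<lambda>_. 0 :: nat)(j := 1) \<noteq> (\<lambda>_. 0)" "(\<lambda>_. 0) \<noteq> (\<lambda>_. 0 :: nat)(j := 1)"
  by (metis fun_upd_same zero_neq_one)+

lemma unit_index_eq_iff: "(\<lambda>_. 0 :: nat)(i := 1) = (\<lambda>_. 0)(j := 1) \<longleftrightarrow> i = j"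
  by (metis fun_upd_apply zero_neq_one)

lemmas unit_index_simps [simp] =
  unit_index_neq_0 unit_index_neq_0[unfolded One_nat_def]
  unit_index_eq_iff unit_index_eq_iff[unfolded One_nat_def]

lemma linear_mfps_nth:
  "mfps_nth (linear_mfps A $ i) (\<lambda>_. 0) = 0"
  "mfps_nth (linear_mfps A $ i) ((\<lambda>_. 0)(j := 1)) = A $ i $ j"
  by (simp_all add: linear_mfps_def unit_index_neq_0 unit_index_eq_iff if_distrib[where f = "\<lambda>x. _ * x"] cong: if_cong)

lemma linear_mfps_pow_homogeneous:
  fixes A :: "'a::comm_ring_1 ^ 'b ^ 'b::finite"
  assumes "sum \<alpha> UNIV \<noteq> sum \<beta> UNIV"
  shows "mfps_nth (mfps_pow (linear_mfps A) \<beta>) \<alpha> = 0"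
proof -
  define G where "G k (P :: unit \<Rightarrow> ('a, 'b) mfps) \<longleftrightarrow> (\<forall>\<alpha>. sum \<alpha> UNIV \<noteq> k \<longrightarrow> mfps_nth (P ()) \<alpha> = 0)" for k P
  have "G (sum \<beta> UNIV) (\<lambda>_. \<Prod>j\<in>UNIV. (linear_mfps A $ j) ^ \<beta> j)"
  proof (rule graded_power_prod)
    show "G 0 (\<lambda>_. 1)" by (simp add: G_def mfps_nth_1)
    show "G 1 (\<lambda>_. linear_mfps A $ j)" for j
      by (auto simp: G_def linear_mfps_def intro!: sum.neutral)
    show "G (a + b) (\<lambda>t. P t * Q t)" if P: "G a P" "G b Q" for a b P Q
      unfolding G_def
    proof (intro allI impI)
      fix \<alpha> :: "'b \<Rightarrow> nat" assume \<alpha>: "sum \<alpha> UNIV \<noteq> a + b"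
      show "mfps_nth (P () * Q ()) \<alpha> = 0"
        unfolding mfps_nth_mult
      proof (rule sum.neutral, clarify)
        fix \<beta> \<gamma> assume "(\<beta>, \<gamma>) \<in> splittings \<alpha>"
        with \<alpha> have "sum \<beta> UNIV \<noteq> a \<or> sum \<gamma> UNIV \<noteq> b" by (auto simp: sum_splitting)
        then show "mfps_nth (P ()) \<beta> * mfps_nth (Q ()) \<gamma> = 0" using P by (auto simp: G_def)
      qed
    qed
  qed
  then show ?thesis using assms by (simp add: G_def mfps_pow_def)
qed

definition homogeneous :: "nat \<Rightarrow> ('a::comm_ring_1, 'n::finite) mfps ^ 'n \<Rightarrow> bool" where
  "homogeneous k g \<longleftrightarrow> (\<forall>i \<alpha>. sum \<alpha> UNIV \<noteq> k \<longrightarrow> mfps_nth (g $ i) \<alpha> = 0)"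

lemma mfps_const_matrix_mult:
  "map_matrix mfps_const B *v (map_matrix mfps_const A *v g) = map_matrix mfps_const (B ** A) *v g"
proof -
  have "(\<Sum>j\<in>UNIV. mfps_const (B $ i $ j) * (\<Sum>k\<in>UNIV. mfps_const (A $ j $ k) * g $ k)) =
      (\<Sum>k\<in>UNIV. mfps_const (\<Sum>j\<in>UNIV. B $ i $ j * A $ j $ k) * g $ k)" for i
  proof (rule mfps_eqI)
    fix \<alpha>
    show "mfps_nth (\<Sum>j\<in>UNIV. mfps_const (B $ i $ j) * (\<Sum>k\<in>UNIV. mfps_const (A $ j $ k) * g $ k)) \<alpha> =
      mfps_nth (\<Sum>k\<in>UNIV. mfps_const (\<Sum>j\<in>UNIV. B $ i $ j * A $ j $ k) * g $ k) \<alpha>"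
      by (simp add: sum_distrib_left sum_distrib_right mult.assoc) (rule sum.swap)
  qed
  then show ?thesis
    by (simp add: vec_eq_iff matrix_vector_mult_def matrix_matrix_mult_def map_matrix_def)
qed

lemma mfps_nth_const_matrix:
  "mfps_nth ((map_matrix mfps_const A *v g) $ i) \<alpha> = (\<Sum>j\<in>UNIV. A $ i $ j * mfps_nth (g $ j) \<alpha>)"
  by (simp add: matrix_vector_mult_def map_matrix_def)

lemma mfps_const_matrix_1: "map_matrix mfps_const (mat 1) *v g = g"
  by (auto simp: vec_eq_iff mfps_nth_const_matrix mat_def if_distrib[where f = "\<lambda>x. x * _"] intro!: mfps_eqI cong: if_cong)

lemma complex_endo_intro:
  assumes "vector_space sc" "\<And>x y. D (x + y) = D x + D y" "\<And>c x. D (sc c x) = sc c (D x)"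
  shows "complex_endo sc D"
  unfolding complex_endo_def Vector_Spaces.linear_iff using assms by auto

abbreviation scale_mfps :: "complex \<Rightarrow> (complex, 'n::finite) mfps \<Rightarrow> (complex, 'n) mfps" where
  "scale_mfps c P \<equiv> mfps_const c * P"

abbreviation scale_mfps_vec :: "complex \<Rightarrow> (complex, 'n::finite) mfps ^ 'n \<Rightarrow> (complex, 'n) mfps ^ 'n" where
  "scale_mfps_vec c g \<equiv> mfps_const c *s g"

lemma vector_space_mfps: "vector_space scale_mfps"
  by standard (auto intro!: mfps_eqI simp: distrib_left distrib_right mult.assoc)

lemma vector_space_mfps_vec: "vector_space scale_mfps_vec"
  by standard (auto intro!: mfps_eqI simp: vec_eq_iff distrib_left distrib_right mult.assoc)

definition power_products :: "('n \<Rightarrow> complex) \<Rightarrow> nat \<Rightarrow> complex set" where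
  "power_products ev k = {\<Prod>i\<in>UNIV. ev i ^ \<beta> i | \<beta>. sum \<beta> UNIV = k}"

text \<open>Substitution of \<open>A\<close> is multiplicative, hence
  \<open>gen_eigenspace_bilinear\<close> applies to products of series: coordinates have eigenvalues
  in \<open>range ev\<close>, and a monomial of degree k has products of k of them. No
  diagonalization of \<open>A\<close> enters.\<close>

lemma monom_in_gen_eigenspace:
  fixes A :: "complex ^ 'n ^ 'n"
  assumes ev: "eigenvalues_with_multiplicity A ev" and A: "invertible A"
  shows "mfps_monom \<beta> \<in> gen_eigenspace scale_mfps (mfps_subst (linear_mfps A)) (power_products ev (sum \<beta> UNIV))"
proof -
  define C where "C = mfps_subst (linear_mfps A)"
  have C_mult: "C (P * Q) = C P * C Q" for P Q
    unfolding C_def by (rule mfps_subst_mult) (rule linear_mfps_nth)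
  have C: "complex_endo scale_mfps C"
    by (rule complex_endo_intro[OF vector_space_mfps])
      (simp_all add: C_def mfps_subst_add mfps_subst_const_mult)
  interpret C: complex_endo scale_mfps C by (rule C)
  define G where "G k (P :: unit \<Rightarrow> (complex, 'n) mfps) \<longleftrightarrow> P () \<in> gen_eigenspace scale_mfps C (power_products ev k)" for k P
  have "G (sum \<beta> UNIV) (\<lambda>_. \<Prod>j\<in>UNIV. mfps_X j ^ \<beta> j)"
  proof (rule graded_power_prod)
    have "C 1 = 1" unfolding C_def mfps_monom_0[symmetric]
      by (subst mfps_subst_monom) (auto simp: linear_mfps_nth mfps_pow_def mfps_monom_0)
    moreover have "1 \<in> power_products ev 0"
      unfolding power_products_def by (rule CollectI, rule exI[of _ "\<lambda>_. 0"]) simp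
    moreover have "C 1 - scale_mfps 1 1 = 0" unfolding \<open>C 1 = 1\<close> by (rule mfps_eqI) (simp add: mfps_nth_1 mfps_const.rep_eq)
    ultimately show "G 0 (\<lambda>_. 1)"
      unfolding G_def by (metis gen_eigenspace.step gen_eigenspace.zero)
    show "G 1 (\<lambda>_. mfps_X j)" for j
    proof -
      \<comment> \<open>Reads a vector as the linear form with these coefficients; substituting
        \<open>A\<close> into the form applies the transpose to the vector.\<close>
      define \<phi> where "\<phi> v = (\<Sum>i\<in>UNIV. mfps_const (v $ i) * mfps_X i)" for v :: "complex ^ 'n"
      have "\<phi> (axis j 1) \<in> gen_eigenspace scale_mfps C (range ev)"
      proof (rule gen_eigenspace_intertwine[OF gen_eigenspace_transpose_inverse(1)[OF ev A]])
        show "\<phi> 0 = 0" "\<And>v w. \<phi> (v - w) = \<phi> v - \<phi> w" "\<And>c v. \<phi> (c *s v) = scale_mfps c (\<phi> v)"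
          by (auto intro!: mfps_eqI simp: \<phi>_def left_diff_distrib mult.assoc sum_subtractf sum_distrib_left)
        show "\<phi> (transpose A *v v) = C (\<phi> v)" for v
        proof -
          have CX: "C (mfps_X i) = linear_mfps A $ i" for i
          proof -
            have "C (mfps_X i) = mfps_pow (linear_mfps A) ((\<lambda>_. 0)(i := 1))"
              unfolding C_def by (rule mfps_subst_monom) (rule linear_mfps_nth)
            also have "\<dots> = (\<Prod>j\<in>UNIV. if j = i then linear_mfps A $ j else 1)"
              unfolding mfps_pow_def by (rule prod.cong) auto
            finally show ?thesis by simp
          qed
          have "C (\<phi> v) = (\<Sum>i\<in>UNIV. mfps_const (v $ i) * linear_mfps A $ i)"
            unfolding \<phi>_def C.sum C.scale CX ..
          also have "(\<Sum>i\<in>UNIV. mfps_const (v $ i) * linear_mfps A $ i) = \<phi> (transpose A *v v)"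
          proof (rule mfps_eqI)
            fix \<alpha>
            define m where "m k = mfps_nth (mfps_X k :: (complex, 'n) mfps) \<alpha>" for k
            have "mfps_nth (\<Sum>i\<in>UNIV. mfps_const (v $ i) * linear_mfps A $ i) \<alpha> =
                (\<Sum>x\<in>UNIV. v $ x * (\<Sum>k\<in>UNIV. A $ x $ k * m k))"
              by (simp add: linear_mfps_def m_def del: mfps_nth_monom)
            also have "\<dots> = (\<Sum>k\<in>UNIV. (\<Sum>x\<in>UNIV. A $ x $ k * v $ x) * m k)"
              by (simp add: sum_distrib_left sum_distrib_right mult_ac) (rule sum.swap)
            also have "\<dots> = mfps_nth (\<phi> (transpose A *v v)) \<alpha>"
              by (simp add: \<phi>_def m_def matrix_vector_mult_def transpose_def del: mfps_nth_monom)
            finally show "mfps_nth (\<Sum>i\<in>UNIV. mfps_const (v $ i) * linear_mfps A $ i) \<alpha> =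
                mfps_nth (\<phi> (transpose A *v v)) \<alpha>" .
          qed
          finally show ?thesis by simp
        qed
      qed
      also have "\<phi> (axis j 1) = mfps_X j"
        by (rule mfps_eqI) (simp add: \<phi>_def axis_def if_distrib[where f = "\<lambda>x. x * _"] del: mfps_nth_monom cong: if_cong)
      finally have "mfps_X j \<in> gen_eigenspace scale_mfps C (range ev)" .
      moreover have "ev i \<in> power_products ev 1" for i
        unfolding power_products_def
      proof (intro CollectI exI[of _ "(\<lambda>_. 0)(i := 1)"] conjI)
        have "(\<Prod>k\<in>UNIV. ev k ^ ((\<lambda>_. 0)(i := 1)) k) = (\<Prod>k\<in>UNIV. if k = i then ev k else 1)"
          by (rule prod.cong) auto
        then show "ev i = (\<Prod>k\<in>UNIV. ev k ^ ((\<lambda>_. 0)(i := 1)) k)" by simp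
        have "sum ((\<lambda>_. 0)(i := 1)) UNIV = (\<Sum>k\<in>UNIV. if k = i then 1 else 0 :: nat)"
          by (rule sum.cong) auto
        then show "sum ((\<lambda>_. 0)(i := 1)) UNIV = (1 :: nat)" by simp
      qed
      ultimately show ?thesis unfolding G_def by (auto intro: gen_eigenspace_mono)
    qed
    show "G (a + b) (\<lambda>t. P t * Q t)" if P: "G a P" "G b Q" for a b P Q
    proof -
      have "P () * Q () \<in> gen_eigenspace scale_mfps C {s * t | s t. s \<in> power_products ev a \<and> t \<in> power_products ev b}"
        by (rule gen_eigenspace_bilinear[OF C C C])
          (use P in \<open>auto simp: G_def C_mult algebra_simps\<close>)
      moreover have "{s * t | s t. s \<in> power_products ev a \<and> t \<in> power_products ev b} \<subseteq> power_products ev (a + b)"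
      proof safe
        fix s t assume "s \<in> power_products ev a" "t \<in> power_products ev b"
        then obtain \<beta> \<gamma> where "s = (\<Prod>i\<in>UNIV. ev i ^ \<beta> i)" "t = (\<Prod>i\<in>UNIV. ev i ^ \<gamma> i)"
          "sum \<beta> UNIV = a" "sum \<gamma> UNIV = b" by (auto simp: power_products_def)
        then show "s * t \<in> power_products ev (a + b)"
          unfolding power_products_def
          by (intro CollectI exI[of _ "\<lambda>i. \<beta> i + \<gamma> i"]) (simp add: sum.distrib power_add prod.distrib)
      qed
      ultimately show ?thesis unfolding G_def by (rule gen_eigenspace_mono)
    qed
  qed
  then show ?thesis unfolding G_def C_def mfps_X_prod .
qed

section \<open>Formal linearization\<close>

lemma degree_less_2_cases:
  fixes \<alpha> :: "'n::finite \<Rightarrow> nat"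
  assumes "sum \<alpha> UNIV < 2"
  obtains "\<alpha> = (\<lambda>_. 0)" | j where "\<alpha> = (\<lambda>_. 0)(j := 1)"
proof (cases "sum \<alpha> UNIV < 1")
  case True
  then show ?thesis by (intro that(1) degree_0_index)
next
  case False
  with assms have "sum \<alpha> UNIV = 1" by linarith
  then show ?thesis using degree_1_index that(2) by blast
qed

lemma mfps_vec_eq_iff: "g = h \<longleftrightarrow> (\<forall>i \<alpha>. mfps_nth (g $ i) \<alpha> = mfps_nth (h $ i) \<alpha>)"
  by (auto simp: vec_eq_iff intro: mfps_eqI)

text \<open>The basis maps \<open>e\<close> are described by their coefficients only, so that the
  expansion can be used both with tensors of a monomial and an axis vector and with case
  distinctions on the component.\<close>

lemma homogeneous_expansion:
  assumes "homogeneous k r"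
    and e: "\<And>l \<beta> i \<alpha>. sum \<beta> UNIV = k \<Longrightarrow> mfps_nth (e l \<beta> $ i) \<alpha> = (if i = l \<and> \<alpha> = \<beta> then 1 else 0)"
  shows "r = (\<Sum>l\<in>UNIV. \<Sum>\<beta> | sum \<beta> UNIV = k. mfps_const (mfps_nth (r $ l) \<beta>) *s e l \<beta>)"
  unfolding mfps_vec_eq_iff
proof (intro allI)
  fix i \<alpha>
  have "mfps_nth ((\<Sum>l\<in>UNIV. \<Sum>\<beta> | sum \<beta> UNIV = k. mfps_const (mfps_nth (r $ l) \<beta>) *s e l \<beta>) $ i) \<alpha> =
      (\<Sum>l\<in>UNIV. \<Sum>\<beta> | sum \<beta> UNIV = k. mfps_nth (r $ l) \<beta> * mfps_nth (e l \<beta> $ i) \<alpha>)" by simp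
  also have "\<dots> = (\<Sum>l\<in>UNIV. if l = i then (\<Sum>\<beta> | sum \<beta> UNIV = k. if \<alpha> = \<beta> then mfps_nth (r $ l) \<beta> else 0) else 0)"
  proof (rule sum.cong)
    fix l
    show "(\<Sum>\<beta> | sum \<beta> UNIV = k. mfps_nth (r $ l) \<beta> * mfps_nth (e l \<beta> $ i) \<alpha>) =
        (if l = i then (\<Sum>\<beta> | sum \<beta> UNIV = k. if \<alpha> = \<beta> then mfps_nth (r $ l) \<beta> else 0) else 0)"
    proof (cases "l = i")
      case True
      have "(\<Sum>\<beta> | sum \<beta> UNIV = k. mfps_nth (r $ l) \<beta> * mfps_nth (e l \<beta> $ i) \<alpha>) =
          (\<Sum>\<beta> | sum \<beta> UNIV = k. if \<alpha> = \<beta> then mfps_nth (r $ l) \<beta> else 0)"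
        by (rule sum.cong) (use True e in auto)
      then show ?thesis using True by simp
    qed (simp add: e)
  qed simp
  also have "\<dots> = (if sum \<alpha> UNIV = k then mfps_nth (r $ i) \<alpha> else 0)" by simp
  also have "\<dots> = mfps_nth (r $ i) \<alpha>" using assms(1) by (simp add: homogeneous_def)
  finally show "mfps_nth (r $ i) \<alpha> =
      mfps_nth ((\<Sum>l\<in>UNIV. \<Sum>\<beta> | sum \<beta> UNIV = k. mfps_const (mfps_nth (r $ l) \<beta>) *s e l \<beta>) $ i) \<alpha>" by simp
qed

lemma matrix_const_linear:
  "map_matrix mfps_const A *v (g + h) = map_matrix mfps_const A *v g + map_matrix mfps_const A *v h"
  "map_matrix mfps_const A *v (g - h) = map_matrix mfps_const A *v g - map_matrix mfps_const A *v h"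
  "map_matrix mfps_const A *v (mfps_const c *s g) = mfps_const c *s (map_matrix mfps_const A *v g)"
  by (auto simp: vec_eq_iff mfps_nth_const_matrix distrib_left right_diff_distrib sum.distrib sum_subtractf
      sum_distrib_left mult.left_commute intro!: mfps_eqI)

section \<open>The homological operator\<close>

locale nonresonant_matrix =
  fixes A :: "complex ^ 'n ^ 'n" and ev :: "'n \<Rightarrow> complex"
  assumes invertible_A: "invertible A"
    and ev: "eigenvalues_with_multiplicity A ev"
    and nonresonant: "non_resonant ev"
begin

definition subst_A :: "(complex, 'n) mfps ^ 'n \<Rightarrow> (complex, 'n) mfps ^ 'n" where
  "subst_A g = (\<chi> i. mfps_subst (linear_mfps A) (g $ i))"

definition homological :: "(complex, 'n) mfps ^ 'n \<Rightarrow> (complex, 'n) mfps ^ 'n" where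
  "homological g = subst_A g - map_matrix mfps_const A *v g"

lemma subst_A_linear:
  "subst_A (g + h) = subst_A g + subst_A h" "subst_A (mfps_const c *s g) = mfps_const c *s subst_A g"
  by (simp_all add: subst_A_def vec_eq_iff mfps_subst_add mfps_subst_const_mult)

lemma complex_endo_homological: "complex_endo scale_mfps_vec homological"
proof (rule complex_endo_intro[OF vector_space_mfps_vec])
  show "homological (x + y) = homological x + homological y" for x y
    by (simp add: homological_def subst_A_linear matrix_const_linear)
  show "homological (mfps_const c *s x) = mfps_const c *s homological x" for c x
    by (simp add: homological_def subst_A_linear matrix_const_linear vec_eq_iff right_diff_distrib)
qed

interpretation homological: complex_endo scale_mfps_vec homological
  by (rule complex_endo_homological)

lemma homogeneous_subst_A:
  assumes "homogeneous k g"
  shows "homogeneous k (subst_A g)"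
  unfolding homogeneous_def
proof (intro allI impI)
  fix i :: 'n and \<alpha> :: "'n \<Rightarrow> nat" assume \<alpha>: "sum \<alpha> UNIV \<noteq> k"
  have "mfps_nth (g $ i) \<beta> * mfps_nth (mfps_pow (linear_mfps A) \<beta>) \<alpha> = 0" for \<beta>
    using assms \<alpha> linear_mfps_pow_homogeneous[of \<alpha> \<beta> A] by (cases "sum \<beta> UNIV = k") (auto simp: homogeneous_def)
  then show "mfps_nth (subst_A g $ i) \<alpha> = 0" by (simp add: subst_A_def mfps_subst_def sum.neutral)
qed

lemma homogeneous_matrix: "homogeneous k g \<Longrightarrow> homogeneous k (map_matrix mfps_const B *v g)"
  by (simp add: homogeneous_def mfps_nth_const_matrix)

text \<open>A homogeneous map is a sum of tensors of a series and a constant vector;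
  \<open>D\<close> acts on the first by substitution and on the second by the inverse matrix. Its
  generalized eigenvalues in degree k are thus the quotients of a product of k eigenvalues by one
  eigenvalue.\<close>

lemma homogeneous_in_gen_eigenspace:
  fixes r :: "(complex, 'n) mfps ^ 'n"
  assumes "homogeneous k r"
  defines "D \<equiv> \<lambda>g. map_matrix mfps_const (matrix_inv A) *v subst_A g"
  shows "complex_endo scale_mfps_vec D"
    and "r \<in> gen_eigenspace scale_mfps_vec D {s * t | s t. s \<in> power_products ev k \<and> t \<in> range (\<lambda>j. inverse (ev j))}"
proof -
  show D: "complex_endo scale_mfps_vec D"
    by (rule complex_endo_intro[OF vector_space_mfps_vec])
      (simp_all add: D_def subst_A_linear matrix_const_linear)
  interpret D: complex_endo scale_mfps_vec D by (rule D)
  define b where "b P v = (\<chi> i. mfps_const (v $ i) * P)" for P :: "(complex, 'n) mfps" and v :: "complex ^ 'n"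
  have r_eq: "r = (\<Sum>l\<in>UNIV. \<Sum>\<beta> | sum \<beta> UNIV = k. mfps_const (mfps_nth (r $ l) \<beta>) *s b (mfps_monom \<beta>) (axis l 1))"
    by (rule homogeneous_expansion[OF assms(1)]) (simp add: b_def axis_def)
  have mem: "b (mfps_monom \<beta>) (axis l 1) \<in> gen_eigenspace scale_mfps_vec D
      {s * t | s t. s \<in> power_products ev k \<and> t \<in> range (\<lambda>j. inverse (ev j))}" if "sum \<beta> UNIV = k" for l \<beta>
  proof (rule gen_eigenspace_bilinear[where b = b])
    show "complex_endo scale_mfps (mfps_subst (linear_mfps A))"
      by (rule complex_endo_intro[OF vector_space_mfps])
        (simp_all add: mfps_subst_add mfps_subst_const_mult)
    show "complex_endo (*s) ((*v) (matrix_inv A))"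
      unfolding complex_endo_def by (rule matrix_vector_mul_linear_gen)
    show "complex_endo scale_mfps_vec D" by (rule D)
    show "mfps_monom \<beta> \<in> gen_eigenspace scale_mfps (mfps_subst (linear_mfps A)) (power_products ev k)"
      using monom_in_gen_eigenspace[OF ev invertible_A, of \<beta>] that by simp
    show "axis l 1 \<in> gen_eigenspace (*s) ((*v) (matrix_inv A)) (range (\<lambda>j. inverse (ev j)))"
      by (rule gen_eigenspace_transpose_inverse(2)[OF ev invertible_A])
    show "b (P + Q) v = b P v + b Q v" "b P (v + w) = b P v + b P w"
      "b (mfps_const c * P) v = mfps_const c *s b P v" "b P (c *s v) = mfps_const c *s b P v" for P Q v w c
      by (auto simp: b_def vec_eq_iff distrib_left distrib_right mult.left_commute mult.assoc intro!: mfps_eqI)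
    show "D (b P v) = b (mfps_subst (linear_mfps A) P) (matrix_inv A *v v)" for P v
    proof -
      have "mfps_nth (D (b P v) $ i) \<alpha> = mfps_nth (b (mfps_subst (linear_mfps A) P) (matrix_inv A *v v) $ i) \<alpha>" for i \<alpha>
      proof -
        have "mfps_nth (D (b P v) $ i) \<alpha> =
            (\<Sum>j\<in>UNIV. matrix_inv A $ i $ j * (v $ j * mfps_nth (mfps_subst (linear_mfps A) P) \<alpha>))"
          by (simp add: D_def mfps_nth_const_matrix subst_A_def b_def mfps_subst_const_mult)
        then show ?thesis by (simp add: b_def matrix_vector_mult_def sum_distrib_right mult.assoc)
      qed
      then show ?thesis by (simp add: vec_eq_iff mfps_eqI)
    qed
  qed
  show "r \<in> gen_eigenspace scale_mfps_vec D {s * t | s t. s \<in> power_products ev k \<and> t \<in> range (\<lambda>j. inverse (ev j))}"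
    by (subst r_eq) (intro D.gen_sum D.gen_scale mem, simp)
qed

text \<open>After multiplication by the inverse of \<open>A\<close>, \<open>homological\<close>
  becomes \<open>D - 1\<close>, and 1 is not a generalized eigenvalue of \<open>D\<close> in degree
  k. Then \<open>gen_solve\<close> gives existence within homogeneous maps and
  \<open>gen_eigenvector_zero\<close> gives uniqueness.\<close>

lemma homological_bijective:
  assumes k: "k \<ge> 2" and r: "homogeneous k r"
  shows "\<exists>!g. homogeneous k g \<and> homological g = r"
proof -
  define D where "D = (\<lambda>g. map_matrix mfps_const (matrix_inv A) *v subst_A g)"
  define S where "S = {s * t | s t. s \<in> power_products ev k \<and> t \<in> range (\<lambda>j. inverse (ev j))}"
  interpret D: complex_endo scale_mfps_vec D
    unfolding D_def by (rule homogeneous_in_gen_eigenspace(1)[OF r])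
  have gen: "g \<in> D.G S" if "homogeneous k g" for g
    unfolding D_def S_def by (rule homogeneous_in_gen_eigenspace(2)[OF that])
  \<comment> \<open>A quotient equal to 1 would be a resonance; its denominator is nonzero since
    \<open>inverse 0\<close> is 0.\<close>
  have S1: "1 \<notin> S"
  proof
    assume "1 \<in> S"
    then obtain \<beta> j where "1 = (\<Prod>i\<in>UNIV. ev i ^ \<beta> i) * inverse (ev j)" "sum \<beta> UNIV = k"
      by (auto simp: S_def power_products_def)
    moreover from this have "ev j \<noteq> 0" by auto
    ultimately have "ev j - (\<Prod>i\<in>UNIV. ev i ^ \<beta> i) = 0" "sum \<beta> UNIV \<ge> 2" using k by (auto simp: field_simps)
    then show False using nonresonant unfolding non_resonant_def by blast
  qed
  have inv: "map_matrix mfps_const A *v (map_matrix mfps_const (matrix_inv A) *v g) = g"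
    "map_matrix mfps_const (matrix_inv A) *v (map_matrix mfps_const A *v g) = g" for g
    by (simp_all add: mfps_const_matrix_mult matrix_inv_mult[OF invertible_A] mfps_const_matrix_1)
  have const1: "mfps_const 1 *s g = g" for g :: "(complex, 'n) mfps ^ 'n" by (simp add: mfps_vec_eq_iff)
  have ex: "\<exists>g. homogeneous k g \<and> homological g = r"
  proof -
    have "\<exists>w\<in>{g. homogeneous k g}. D w - mfps_const 1 *s w = map_matrix mfps_const (matrix_inv A) *v r"
    proof (rule D.gen_solve)
      show "map_matrix mfps_const (matrix_inv A) *v r \<in> D.G S"
        by (intro gen homogeneous_matrix r)
      show "map_matrix mfps_const (matrix_inv A) *v r \<in> {g. homogeneous k g}"
        by (simp add: homogeneous_matrix r)
      show "1 \<notin> S" by (rule S1)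
      show "homological.vs1.subspace {g. homogeneous k g}"
        unfolding homological.vs1.subspace_def by (auto simp: homogeneous_def)
      show "D w \<in> {g. homogeneous k g}" if "w \<in> {g. homogeneous k g}" for w
        using that by (simp add: D_def homogeneous_matrix homogeneous_subst_A)
    qed
    then obtain w where w: "homogeneous k w" "D w - w = map_matrix mfps_const (matrix_inv A) *v r"
      by (auto simp: const1)
    have "map_matrix mfps_const A *v (D w - w) = homological w"
      by (simp add: matrix_const_linear D_def inv homological_def)
    then have "homological w = r" unfolding w(2) inv(1) by (rule sym)
    with w(1) show ?thesis by blast
  qed
  moreover have "g = g'" if g: "homogeneous k g" "homological g = r" and g': "homogeneous k g'" "homological g' = r" for g g'
  proof -
    have hom: "homogeneous k (g - g')" using g g' by (simp add: homogeneous_def)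
    have "homological (g - g') = 0" using g g' by (simp add: homological.diff)
    then have "subst_A (g - g') = map_matrix mfps_const A *v (g - g')" by (simp add: homological_def)
    then have "D (g - g') = mfps_const 1 *s (g - g')" by (simp only: D_def inv const1)
    then have "g - g' = 0" by (rule D.gen_eigenvector_zero[OF gen[OF hom] _ S1])
    then show ?thesis by simp
  qed
  ultimately show ?thesis by blast
qed

definition homological_inverse :: "nat \<Rightarrow> (complex, 'n) mfps ^ 'n \<Rightarrow> (complex, 'n) mfps ^ 'n" where
  "homological_inverse k r = (THE g. homogeneous k g \<and> homological g = r)"

lemma homological_inverse:
  assumes "k \<ge> 2" "homogeneous k r"
  shows "homogeneous k (homological_inverse k r)" "homological (homological_inverse k r) = r"
  using theI'[OF homological_bijective[OF assms]] unfolding homological_inverse_def by auto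

lemma homological_inverse_unique:
  assumes "k \<ge> 2" "homogeneous k g" "homogeneous k (homological g)"
  shows "g = homological_inverse k (homological g)"
  using homological_bijective[OF assms(1,3)] homological_inverse[OF assms(1,3)] assms(2) by blast

text \<open>The weights on the right depend only on \<open>A\<close> and \<open>k\<close>. This is
  how polynomial dependence on the parameters passes through the inverse with no change of
  degree.\<close>

lemma homological_inverse_expand:
  fixes r :: "(complex, 'n) mfps ^ 'n"
  assumes k: "k \<ge> 2" and r: "homogeneous k r"
  shows "mfps_nth (homological_inverse k r $ i) \<alpha> = (\<Sum>l\<in>UNIV. \<Sum>\<beta> | sum \<beta> UNIV = k.
    mfps_nth (r $ l) \<beta> * mfps_nth (homological_inverse k (\<chi> i. if i = l then mfps_monom \<beta> else 0) $ i) \<alpha>)"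
proof -
  define e where "e l \<beta> = (\<chi> i. if i = l then mfps_monom \<beta> else (0 :: (complex, 'n) mfps))" for l :: 'n and \<beta>
  have e: "homogeneous k (e l \<beta>)" if "sum \<beta> UNIV = k" for l \<beta>
    using that by (auto simp: homogeneous_def e_def)
  define g where "g = (\<Sum>l\<in>UNIV. \<Sum>\<beta> | sum \<beta> UNIV = k. mfps_const (mfps_nth (r $ l) \<beta>) *s homological_inverse k (e l \<beta>))"
  have g: "homogeneous k g"
    unfolding homogeneous_def
  proof (intro allI impI)
    fix i :: 'n and \<alpha> :: "'n \<Rightarrow> nat" assume "sum \<alpha> UNIV \<noteq> k"
    then have "mfps_nth (homological_inverse k (e l \<beta>) $ i) \<alpha> = 0" if "sum \<beta> UNIV = k" for l \<beta>
      using homological_inverse(1)[OF k e[OF that]] by (simp add: homogeneous_def)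
    then show "mfps_nth (g $ i) \<alpha> = 0" by (simp add: g_def)
  qed
  have "homological g = (\<Sum>l\<in>UNIV. \<Sum>\<beta> | sum \<beta> UNIV = k. mfps_const (mfps_nth (r $ l) \<beta>) *s e l \<beta>)"
    unfolding g_def homological.sum homological.scale
    by (intro sum.cong refl) (simp add: homological_inverse(2)[OF k e])
  also have "\<dots> = r"
    by (rule homogeneous_expansion[OF r, symmetric]) (simp add: e_def)
  finally have "homological_inverse k r = g"
    using homological_inverse_unique[OF k g] r by simp
  then show ?thesis by (simp add: g_def e_def)
qed

section \<open>Conjugacy degree by degree\<close>

definition homog_part :: "nat \<Rightarrow> (complex, 'n) mfps ^ 'n \<Rightarrow> (complex, 'n) mfps ^ 'n" where
  "homog_part k h = (\<chi> i. Abs_mfps (\<lambda>\<alpha>. if sum \<alpha> UNIV = k then mfps_nth (h $ i) \<alpha> else 0))"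

definition low_part :: "nat \<Rightarrow> (complex, 'n) mfps ^ 'n \<Rightarrow> (complex, 'n) mfps ^ 'n" where
  "low_part k h = (\<chi> i. Abs_mfps (\<lambda>\<alpha>. if sum \<alpha> UNIV < k then mfps_nth (h $ i) \<alpha> else 0))"

text \<open>The right-hand side of the homological equation in degree \<open>k\<close>: what the
  terms of \<open>h\<close> of degree below \<open>k\<close> contribute to the composition with
  \<open>F\<close>, with opposite sign. It involves no coefficient of \<open>h\<close> of degree
  \<open>k\<close> or more.\<close>

definition defect :: "(complex, 'n) mfps ^ 'n \<Rightarrow> nat \<Rightarrow> (complex, 'n) mfps ^ 'n \<Rightarrow> (complex, 'n) mfps ^ 'n" where
  "defect F k h = (\<chi> i. Abs_mfps (\<lambda>\<alpha>. if sum \<alpha> UNIV = k then - mfps_nth (mfps_subst F (low_part k h $ i)) \<alpha> else 0))"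

lemma defect_cong: "low_part k h = low_part k h' \<Longrightarrow> defect F k h = defect F k h'"
  unfolding defect_def by (erule arg_cong[where f = "\<lambda>l. \<chi> i. Abs_mfps (\<lambda>\<alpha>. if sum \<alpha> UNIV = k then - mfps_nth (mfps_subst F (l $ i)) \<alpha> else 0)"])

lemma homogeneous_homog_part: "homogeneous k (homog_part k h)"
  by (simp add: homogeneous_def homog_part_def)

lemma homogeneous_defect: "homogeneous k (defect F k h)"
  by (simp add: homogeneous_def defect_def)

definition tangent_to_A :: "(complex, 'n) mfps ^ 'n \<Rightarrow> bool" where
  "tangent_to_A F \<longleftrightarrow> (\<forall>i. mfps_nth (F $ i) (\<lambda>_. 0) = 0) \<and> (\<forall>i j. mfps_nth (F $ i) ((\<lambda>_. 0)(j := 1)) = A $ i $ j)"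

text \<open>At the coefficient \<alpha>, terms of \<open>h\<close> of the same degree see only the
  linear part of \<open>F\<close>, and terms of higher degree are not seen at all.\<close>

lemma subst_split:
  assumes F: "tangent_to_A F"
  shows "mfps_nth (mfps_subst F (h $ i)) \<alpha> = mfps_nth (mfps_subst F (low_part (sum \<alpha> UNIV) h $ i)) \<alpha> +
    mfps_nth (subst_A (homog_part (sum \<alpha> UNIV) h) $ i) \<alpha>"
proof -
  have "mfps_nth (h $ i) \<beta> * mfps_nth (mfps_pow F \<beta>) \<alpha> =
      mfps_nth (low_part (sum \<alpha> UNIV) h $ i) \<beta> * mfps_nth (mfps_pow F \<beta>) \<alpha> +
      mfps_nth (homog_part (sum \<alpha> UNIV) h $ i) \<beta> * mfps_nth (mfps_pow (linear_mfps A) \<beta>) \<alpha>"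
    if "sum \<beta> UNIV \<le> sum \<alpha> UNIV" for \<beta>
  proof (cases "sum \<beta> UNIV = sum \<alpha> UNIV")
    case True
    have "mfps_nth (mfps_pow F \<beta>) \<alpha> = mfps_nth (mfps_pow (linear_mfps A) \<beta>) \<alpha>"
      by (rule mfps_pow_leading) (use F True in \<open>auto simp: tangent_to_A_def linear_mfps_nth simp del: One_nat_def\<close>)
    then show ?thesis using True by (simp add: low_part_def homog_part_def)
  next
    case False
    then show ?thesis using that by (simp add: low_part_def homog_part_def)
  qed
  then show ?thesis by (simp add: mfps_subst_def subst_A_def flip: sum.distrib)
qed

lemma conjugacy_iff:
  assumes F: "tangent_to_A F"
  shows "mfps_comp h F = map_matrix mfps_const A *v h \<longleftrightarrow>
    (\<forall>k. homological (homog_part k h) = defect F k h)"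
proof -
  have m: "mfps_nth ((map_matrix mfps_const A *v homog_part k h) $ i) \<alpha> =
      (if sum \<alpha> UNIV = k then mfps_nth ((map_matrix mfps_const A *v h) $ i) \<alpha> else 0)" for k i \<alpha>
    by (simp add: mfps_nth_const_matrix homog_part_def)
  have s: "mfps_nth (subst_A (homog_part k h) $ i) \<alpha> = 0" if "sum \<alpha> UNIV \<noteq> k" for k i \<alpha>
    using homogeneous_subst_A[OF homogeneous_homog_part] that by (auto simp: homogeneous_def)
  have "homological (homog_part k h) = defect F k h \<longleftrightarrow>
      (\<forall>i \<alpha>. sum \<alpha> UNIV = k \<longrightarrow> mfps_nth (mfps_comp h F $ i) \<alpha> = mfps_nth ((map_matrix mfps_const A *v h) $ i) \<alpha>)" for k
  proof -
    have "mfps_nth (homological (homog_part k h) $ i) \<alpha> = mfps_nth (defect F k h $ i) \<alpha> \<longleftrightarrow>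
      (sum \<alpha> UNIV = k \<longrightarrow> mfps_nth (mfps_comp h F $ i) \<alpha> = mfps_nth ((map_matrix mfps_const A *v h) $ i) \<alpha>)" for i \<alpha>
      using subst_split[OF F, of h i \<alpha>] s[of \<alpha> k i]
      by (auto simp: homological_def m defect_def mfps_comp_eq_subst algebra_simps)
    then show ?thesis unfolding mfps_vec_eq_iff by blast
  qed
  then show ?thesis unfolding mfps_vec_eq_iff by simp
qed

text \<open>The conditions of \<open>formal_linearization\<close> for an arbitrary formal map
  \<open>F\<close> in place of a Taylor series, so that the algebra is independent of
  convergence.\<close>

definition normalized_linearization :: "(complex, 'n) mfps ^ 'n \<Rightarrow> (complex, 'n) mfps ^ 'n \<Rightarrow> bool" where
  "normalized_linearization F h \<longleftrightarrow> (\<forall>i. mfps_nth (h $ i) (\<lambda>_. 0) = 0) \<and>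
     (\<forall>i j. mfps_nth (h $ i) ((\<lambda>_. 0)(j := 1)) = (if i = j then 1 else 0)) \<and>
     mfps_comp h F = map_matrix mfps_const A *v h"

lemma normalized_linearizationD:
  assumes "normalized_linearization F h"
  shows "mfps_nth (h $ i) (\<lambda>_. 0) = 0"
    and "mfps_nth (h $ i) ((\<lambda>_. 0)(j := 1)) = (if i = j then 1 else 0)"
    and "mfps_comp h F = map_matrix mfps_const A *v h"
  using assms[unfolded normalized_linearization_def, THEN conjunct1, rule_format]
    assms[unfolded normalized_linearization_def, THEN conjunct2, THEN conjunct1, rule_format]
    assms[unfolded normalized_linearization_def, THEN conjunct2, THEN conjunct2]
  by -

lemma homog_part_recursion:
  assumes "tangent_to_A F" "normalized_linearization F h" "k \<ge> 2"
  shows "homog_part k h = homological_inverse k (defect F k h)"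
proof -
  have "homological (homog_part k h) = defect F k h"
    using conjugacy_iff[OF assms(1)] normalized_linearizationD(3)[OF assms(2)] by blast
  then show ?thesis
    using homological_inverse_unique[OF assms(3) homogeneous_homog_part] homogeneous_defect by metis
qed

lemma normalized_linearization_unique:
  assumes F: "tangent_to_A F" and h: "normalized_linearization F h" "normalized_linearization F h'"
  shows "h = h'"
proof -
  have "\<forall>i \<alpha>. sum \<alpha> UNIV = k \<longrightarrow> mfps_nth (h $ i) \<alpha> = mfps_nth (h' $ i) \<alpha>" for k
  proof (induction k rule: less_induct)
    case (less k)
    show ?case
    proof (cases "k \<ge> 2")
      case True
      have "low_part k h = low_part k h'" using less by (auto simp: low_part_def mfps_vec_eq_iff)
      then have "defect F k h = defect F k h'" by (rule defect_cong)
      then have "homog_part k h = homog_part k h'"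
        using homog_part_recursion[OF F h(1) True] homog_part_recursion[OF F h(2) True] by simp
      then have *: "mfps_nth (homog_part k h $ i) \<alpha> = mfps_nth (homog_part k h' $ i) \<alpha>" for i \<alpha> by simp
      show ?thesis
      proof (intro allI impI)
        fix i and \<alpha> :: "'n \<Rightarrow> nat" assume "sum \<alpha> UNIV = k"
        with *[of i \<alpha>] show "mfps_nth (h $ i) \<alpha> = mfps_nth (h' $ i) \<alpha>" by (simp add: homog_part_def)
      qed
    next
      case False
      show ?thesis
      proof (intro allI impI)
        fix i and \<alpha> :: "'n \<Rightarrow> nat" assume "sum \<alpha> UNIV = k"
        with False have "sum \<alpha> UNIV < 2" by simp
        then consider "\<alpha> = (\<lambda>_. 0)" | j where "\<alpha> = (\<lambda>_. 0)(j := 1)"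
          by (rule degree_less_2_cases)
        then show "mfps_nth (h $ i) \<alpha> = mfps_nth (h' $ i) \<alpha>"
        proof cases
          case 1
          have "mfps_nth (h $ i) (\<lambda>_. 0) = 0" "mfps_nth (h' $ i) (\<lambda>_. 0) = 0"
            by (rule normalized_linearizationD(1), rule h)+
          with 1 show ?thesis by simp
        next
          case 2
          have "mfps_nth (h $ i) ((\<lambda>_. 0)(j := 1)) = (if i = j then 1 else 0)"
            "mfps_nth (h' $ i) ((\<lambda>_. 0)(j := 1)) = (if i = j then 1 else 0)"
            by (rule normalized_linearizationD(2), rule h)+
          with 2 show ?thesis by metis
        qed
      qed
    qed
  qed
  then show ?thesis unfolding mfps_vec_eq_iff by simp
qed

text \<open>Stage \<open>n\<close> is final in degrees up to n + 1: stage 0 is the identity map, of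
  degree 1, and the step from \<open>n\<close> to \<open>Suc n\<close> adds the part of degree n +
  2.\<close>

primrec approx :: "(complex, 'n) mfps ^ 'n \<Rightarrow> nat \<Rightarrow> (complex, 'n) mfps ^ 'n" where
  "approx F 0 = (\<chi> i. mfps_X i)"
| "approx F (Suc n) = approx F n + homological_inverse (n + 2) (defect F (n + 2) (approx F n))"

lemma approx_high: "sum \<alpha> UNIV > n + 1 \<Longrightarrow> mfps_nth (approx F n $ i) \<alpha> = 0"
proof (induction n)
  case 0
  then show ?case by auto
next
  case (Suc n)
  then show ?case
    using homological_inverse(1)[OF _ homogeneous_defect, of "n + 2" F "approx F n"]
    by (simp add: homogeneous_def)
qed

lemma approx_stable: "sum \<alpha> UNIV \<le> n + 1 \<Longrightarrow> n \<le> n' \<Longrightarrow> mfps_nth (approx F n' $ i) \<alpha> = mfps_nth (approx F n $ i) \<alpha>"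
proof (induction n')
  case (Suc n')
  then show ?case
    using homological_inverse(1)[OF _ homogeneous_defect, of "n' + 2" F "approx F n'"]
    by (cases "n = Suc n'") (auto simp: homogeneous_def)
qed simp

lemma normalized_linearization_exists:
  assumes F: "tangent_to_A F"
  shows "\<exists>h. normalized_linearization F h"
proof -
  \<comment> \<open>The diagonal of the approximations: the coefficient at \<alpha> is stable from
    stage \<open>sum \<alpha> UNIV - 1\<close> on.\<close>
  define h where "h = (\<chi> i. Abs_mfps (\<lambda>\<alpha>. mfps_nth (approx F (sum \<alpha> UNIV) $ i) \<alpha>))"
  have h: "mfps_nth (h $ i) \<alpha> = mfps_nth (approx F n $ i) \<alpha>" if "sum \<alpha> UNIV \<le> n + 1" for i \<alpha> n
  proof -
    have "mfps_nth (approx F (sum \<alpha> UNIV) $ i) \<alpha> = mfps_nth (approx F (sum \<alpha> UNIV - 1) $ i) \<alpha>"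
      by (rule approx_stable) auto
    moreover have "mfps_nth (approx F n $ i) \<alpha> = mfps_nth (approx F (sum \<alpha> UNIV - 1) $ i) \<alpha>"
      using that by (intro approx_stable) auto
    ultimately show ?thesis by (simp add: h_def)
  qed
  have h0: "mfps_nth (h $ i) (\<lambda>_. 0) = 0" for i
    using h[of "\<lambda>_. 0" 0] by simp
  have h1: "mfps_nth (h $ i) ((\<lambda>_. 0)(j := 1)) = (if i = j then 1 else 0)" for i j
  proof -
    have "sum ((\<lambda>_. 0)(j := 1)) UNIV = (\<Sum>k\<in>UNIV. if k = j then 1 else 0 :: nat)"
      by (rule sum.cong) auto
    then show ?thesis using h[of "(\<lambda>_. 0)(j := 1)" 0 i] by auto
  qed
  have "homological (homog_part k h) = defect F k h" for k
  proof -
    consider "k = 0" | "k = 1" | n where "k = n + 2"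
      by (metis add_2_eq_Suc' One_nat_def not0_implies_Suc)
    then show ?thesis
    proof cases
      case 1
      have "homog_part 0 h = 0"
        unfolding mfps_vec_eq_iff
      proof (intro allI)
        fix i and \<alpha> :: "'n \<Rightarrow> nat"
        show "mfps_nth (homog_part 0 h $ i) \<alpha> = mfps_nth (0 $ i) \<alpha>"
        proof (cases "sum \<alpha> UNIV = 0")
          case True
          then have "\<alpha> = (\<lambda>_. 0)" by auto
          then show ?thesis using h0[of i] by (simp add: homog_part_def)
        qed (simp add: homog_part_def del: sum_eq_0_iff)
      qed
      moreover have "defect F 0 h = 0"
        by (auto simp: defect_def low_part_def mfps_subst_def vec_eq_iff intro!: mfps_eqI)
      ultimately show ?thesis using 1 by simp
    next
      case 2
      have "homog_part 1 h = (\<chi> i. mfps_X i)"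
      proof (rule vec_eq_iff[THEN iffD2], rule allI, rule mfps_eqI)
        fix i \<alpha>
        show "mfps_nth (homog_part 1 h $ i) \<alpha> = mfps_nth ((\<chi> i. mfps_X i) $ i) \<alpha>"
        proof (cases "sum \<alpha> UNIV = 1")
          case True
          then have "mfps_nth (homog_part 1 h $ i) \<alpha> = mfps_nth (h $ i) \<alpha>" by (simp add: homog_part_def)
          also have "\<dots> = mfps_nth (approx F 0 $ i) \<alpha>" using True by (intro h) simp
          finally show ?thesis by simp
        next
          case False
          then have "\<alpha> \<noteq> (\<lambda>_. 0)(i := 1)" by auto
          with False show ?thesis by (simp add: homog_part_def)
        qed
      qed
      \<comment> \<open>The homological operator kills the identity map, so degree 1 imposes no
        condition and is settled by the normalization.\<close>
      moreover have "subst_A (\<chi> i. mfps_X i) = map_matrix mfps_const A *v (\<chi> i. mfps_X i)"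
      proof (rule vec_eq_iff[THEN iffD2], rule allI)
        fix i
        have "mfps_subst (linear_mfps A) (mfps_X i) = mfps_pow (linear_mfps A) ((\<lambda>_. 0)(i := 1))"
          by (rule mfps_subst_monom) (rule linear_mfps_nth)
        also have "\<dots> = (\<Prod>j\<in>UNIV. if j = i then linear_mfps A $ j else 1)"
          unfolding mfps_pow_def by (rule prod.cong) auto
        also have "\<dots> = linear_mfps A $ i" by simp
        finally show "subst_A (\<chi> i. mfps_X i) $ i = (map_matrix mfps_const A *v (\<chi> i. mfps_X i)) $ i"
          unfolding subst_A_def by (simp add: linear_mfps_def matrix_vector_mult_def map_matrix_def)
      qed
      moreover have "low_part 1 h = 0"
        unfolding mfps_vec_eq_iff
      proof (intro allI)
        fix i and \<alpha> :: "'n \<Rightarrow> nat"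
        show "mfps_nth (low_part 1 h $ i) \<alpha> = mfps_nth (0 $ i) \<alpha>"
        proof (cases "sum \<alpha> UNIV = 0")
          case True
          then have "\<alpha> = (\<lambda>_. 0)" by auto
          then show ?thesis using h0[of i] by (simp add: low_part_def)
        qed (simp add: low_part_def del: sum_eq_0_iff)
      qed
      then have "defect F 1 h = 0"
        by (auto simp: defect_def mfps_subst_def vec_eq_iff intro!: mfps_eqI)
      ultimately show ?thesis using 2 by (simp add: homological_def)
    next
      case 3
      have "mfps_nth (homog_part k h $ i) \<alpha> = mfps_nth (homological_inverse k (defect F k (approx F n)) $ i) \<alpha>" for i \<alpha>
      proof (cases "sum \<alpha> UNIV = k")
        case True
        then have "mfps_nth (homog_part k h $ i) \<alpha> = mfps_nth (approx F (Suc n) $ i) \<alpha>"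
          using h[of \<alpha> "Suc n" i] 3 by (simp add: homog_part_def)
        also have "\<dots> = mfps_nth (homological_inverse k (defect F k (approx F n)) $ i) \<alpha>"
          using approx_high[of n \<alpha> F i] True 3 by simp
        finally show ?thesis .
      next
        case False
        then show ?thesis
          using homological_inverse(1)[OF _ homogeneous_defect, of k F "approx F n"] 3
          by (simp add: homog_part_def homogeneous_def)
      qed
      then have eq: "homog_part k h = homological_inverse k (defect F k (approx F n))"
        unfolding mfps_vec_eq_iff by simp
      have "low_part k h = low_part k (approx F n)"
        using h 3 by (auto simp: low_part_def vec_eq_iff intro!: mfps_eqI)
      then have "defect F k h = defect F k (approx F n)" by (rule defect_cong)
      then show ?thesis unfolding eq using 3 by (simp add: homological_inverse(2) homogeneous_defect)
    qed
  qed
  then have "normalized_linearization F h"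
    using h0 h1 conjugacy_iff[OF F] by (simp add: normalized_linearization_def)
  then show ?thesis by blast
qed

section \<open>Polynomial dependence on the parameters\<close>

text \<open>\<open>a\<close> is a lower bound for the order in z; only the excess of the degree over
  \<open>a\<close> costs degree in \<open>t\<close>. The subtraction truncates only where the
  coefficient is 0 anyway.\<close>

definition graded_poly :: "nat \<Rightarrow> nat \<Rightarrow> ((nat \<Rightarrow> complex) \<Rightarrow> (complex, 'n) mfps) \<Rightarrow> bool" where
  "graded_poly d a P \<longleftrightarrow> (\<forall>t \<alpha>. sum \<alpha> UNIV < a \<longrightarrow> mfps_nth (P t) \<alpha> = 0) \<and>
     (\<forall>\<alpha>. line_poly (d * (sum \<alpha> UNIV - a)) (\<lambda>t. mfps_nth (P t) \<alpha>))"

lemma graded_poly_mult: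
  assumes P: "graded_poly d a P" and Q: "graded_poly d b Q"
  shows "graded_poly d (a + b) (\<lambda>t. P t * Q t)"
proof -
  have zero: "mfps_nth (P t) \<beta> * mfps_nth (Q t) \<gamma> = 0" if "sum \<beta> UNIV < a \<or> sum \<gamma> UNIV < b" for t \<beta> \<gamma>
    using P Q that by (auto simp: graded_poly_def)
  have "mfps_nth (P t * Q t) \<alpha> = 0" if "sum \<alpha> UNIV < a + b" for t \<alpha>
    unfolding mfps_nth_mult
  proof (rule sum.neutral, clarify)
    fix \<beta> \<gamma> assume "(\<beta>, \<gamma>) \<in> splittings \<alpha>"
    with that have "sum \<beta> UNIV < a \<or> sum \<gamma> UNIV < b" by (auto simp: sum_splitting)
    then show "mfps_nth (P t) \<beta> * mfps_nth (Q t) \<gamma> = 0" by (rule zero)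
  qed
  moreover have "line_poly (d * (sum \<alpha> UNIV - (a + b))) (\<lambda>t. mfps_nth (P t * Q t) \<alpha>)" for \<alpha>
    unfolding mfps_nth_mult case_prod_unfold
  proof (rule line_poly_sum)
    fix p assume p: "p \<in> splittings \<alpha>"
    have sp: "sum \<alpha> UNIV = sum (fst p) UNIV + sum (snd p) UNIV"
      using p sum_splitting[of "fst p" "snd p" \<alpha>] by simp
    show "line_poly (d * (sum \<alpha> UNIV - (a + b))) (\<lambda>t. mfps_nth (P t) (fst p) * mfps_nth (Q t) (snd p))"
    proof (cases "sum (fst p) UNIV < a \<or> sum (snd p) UNIV < b")
      case True
      then show ?thesis by (simp add: zero line_poly_const)
    next
      case False
      have "line_poly (d * (sum (fst p) UNIV - a) + d * (sum (snd p) UNIV - b))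
          (\<lambda>t. mfps_nth (P t) (fst p) * mfps_nth (Q t) (snd p))"
        using P Q by (intro line_poly_mult) (auto simp: graded_poly_def)
      moreover have "d * (sum (fst p) UNIV - a) + d * (sum (snd p) UNIV - b) = d * (sum \<alpha> UNIV - (a + b))"
        using False sp by (simp flip: distrib_left)
      ultimately show ?thesis by simp
    qed
  qed
  ultimately show ?thesis by (simp add: graded_poly_def)
qed

text \<open>In the recursion for degree k, a coefficient of \<open>h t\<close> at \<gamma> brings
  d(|\<gamma>| - 1) and the power of \<open>F t\<close> with exponent \<gamma> brings d(k -
  |\<gamma>|), which add up to d(k - 1); the inverse of the homological operator does not depend on
  \<open>t\<close>.\<close>

lemma linearization_line_poly:
  fixes F h :: "(nat \<Rightarrow> complex) \<Rightarrow> (complex, 'n) mfps ^ 'n"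
  assumes F: "\<And>t. tangent_to_A (F t)"
    and Fpoly: "\<And>i \<alpha>. line_poly (d * (sum \<alpha> UNIV - 1)) (\<lambda>t. mfps_nth (F t $ i) \<alpha>)"
    and h: "\<And>t. normalized_linearization (F t) (h t)"
  shows "line_poly (d * (sum \<alpha> UNIV - 1)) (\<lambda>t. mfps_nth (h t $ i) \<alpha>)"
proof (induction "sum \<alpha> UNIV" arbitrary: \<alpha> i rule: less_induct)
  case less
  define k where "k = sum \<alpha> UNIV"
  show ?case
  proof (cases "k \<ge> 2")
    case False
    then have "sum \<alpha> UNIV < 2" by (simp add: k_def)
    then consider "\<alpha> = (\<lambda>_. 0)" | j where "\<alpha> = (\<lambda>_. 0)(j := 1)"
      by (rule degree_less_2_cases)
    then show ?thesis
    proof cases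
      case 1
      have "(\<lambda>t. mfps_nth (h t $ i) \<alpha>) = (\<lambda>t. 0)" unfolding 1 using normalized_linearizationD(1)[OF h] by simp
      then show ?thesis by (simp add: line_poly_const)
    next
      case 2
      have "(\<lambda>t. mfps_nth (h t $ i) \<alpha>) = (\<lambda>t. if i = j then 1 else 0)" unfolding 2 using normalized_linearizationD(2)[OF h] by simp
      then show ?thesis by (simp add: line_poly_const)
    qed
  next
    case True
    have pow: "graded_poly d (sum \<gamma> UNIV) (\<lambda>t. mfps_pow (F t) \<gamma>)" for \<gamma>
      unfolding mfps_pow_def
    proof (rule graded_power_prod)
      show "graded_poly d 0 (\<lambda>t. 1)" by (simp add: graded_poly_def mfps_nth_1 line_poly_const)
      show "graded_poly d 1 (\<lambda>t. F t $ j)" for j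
        unfolding graded_poly_def
      proof (intro conjI allI impI)
        fix t and \<alpha> :: "'n \<Rightarrow> nat" assume "sum \<alpha> UNIV < 1"
        then have "\<alpha> = (\<lambda>_. 0)" by (rule degree_0_index)
        then show "mfps_nth (F t $ j) \<alpha> = 0" using F by (simp add: tangent_to_A_def)
      qed (rule Fpoly)
    qed (rule graded_poly_mult)
    have "line_poly (d * (k - 1)) (\<lambda>t. mfps_nth (defect (F t) k (h t) $ l) \<beta>)" if \<beta>: "sum \<beta> UNIV = k" for l \<beta>
    proof -
      have "(\<lambda>t. mfps_nth (defect (F t) k (h t) $ l) \<beta>) =
          (\<lambda>t. (- 1) * (\<Sum>\<gamma> | sum \<gamma> UNIV < k. mfps_nth (h t $ l) \<gamma> * mfps_nth (mfps_pow (F t) \<gamma>) \<beta>))"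
      proof
        fix t
        have "(\<Sum>\<gamma> | sum \<gamma> UNIV \<le> k. mfps_nth (low_part k (h t) $ l) \<gamma> * mfps_nth (mfps_pow (F t) \<gamma>) \<beta>) =
            (\<Sum>\<gamma> | sum \<gamma> UNIV < k. mfps_nth (h t $ l) \<gamma> * mfps_nth (mfps_pow (F t) \<gamma>) \<beta>)"
          by (rule sum.mono_neutral_cong_right) (auto simp: low_part_def)
        then show "mfps_nth (defect (F t) k (h t) $ l) \<beta> =
          (- 1) * (\<Sum>\<gamma> | sum \<gamma> UNIV < k. mfps_nth (h t $ l) \<gamma> * mfps_nth (mfps_pow (F t) \<gamma>) \<beta>)"
          using \<beta> by (simp add: defect_def mfps_subst_def)
      qed
      moreover have "line_poly (d * (k - 1)) (\<lambda>t. mfps_nth (h t $ l) \<gamma> * mfps_nth (mfps_pow (F t) \<gamma>) \<beta>)"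
        if \<gamma>: "sum \<gamma> UNIV < k" for \<gamma>
      \<comment> \<open>At the index 0 the truncated subtraction would make the degrees add up to
        \<open>d * k\<close>; there the coefficient of \<open>h t\<close> vanishes.\<close>
      proof (cases "\<gamma> = (\<lambda>_. 0)")
        case True
        then have "(\<lambda>t. mfps_nth (h t $ l) \<gamma> * mfps_nth (mfps_pow (F t) \<gamma>) \<beta>) = (\<lambda>t. 0)"
          using normalized_linearizationD(1)[OF h] by simp
        then show ?thesis by (simp add: line_poly_const)
      next
        case False
        then have 1: "sum \<gamma> UNIV \<ge> 1" using degree_0_index[of \<gamma>] by (meson not_le)
        have "line_poly (d * (sum \<gamma> UNIV - 1) + d * (k - sum \<gamma> UNIV))
            (\<lambda>t. mfps_nth (h t $ l) \<gamma> * mfps_nth (mfps_pow (F t) \<gamma>) \<beta>)"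
        proof (rule line_poly_mult)
          show "line_poly (d * (sum \<gamma> UNIV - 1)) (\<lambda>t. mfps_nth (h t $ l) \<gamma>)"
            by (rule less) (use \<gamma> in \<open>simp add: k_def\<close>)
          show "line_poly (d * (k - sum \<gamma> UNIV)) (\<lambda>t. mfps_nth (mfps_pow (F t) \<gamma>) \<beta>)"
            using pow[of \<gamma>] unfolding graded_poly_def \<beta>[symmetric] by blast
        qed
        moreover have "d * (sum \<gamma> UNIV - 1) + d * (k - sum \<gamma> UNIV) = d * (k - 1)"
          using 1 \<gamma> by (simp flip: distrib_left)
        ultimately show ?thesis by simp
      qed
      ultimately show ?thesis by (simp only:) (intro line_poly_cmult line_poly_sum, simp)
    qed
    then have "line_poly (d * (k - 1)) (\<lambda>t. (\<Sum>l\<in>UNIV. \<Sum>\<beta> | sum \<beta> UNIV = k.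
      mfps_nth (homological_inverse k (\<chi> i. if i = l then mfps_monom \<beta> else 0) $ i) \<alpha> * mfps_nth (defect (F t) k (h t) $ l) \<beta>))"
      by (intro line_poly_sum line_poly_cmult) auto
    moreover have "mfps_nth (h t $ i) \<alpha> = (\<Sum>l\<in>UNIV. \<Sum>\<beta> | sum \<beta> UNIV = k.
      mfps_nth (homological_inverse k (\<chi> i. if i = l then mfps_monom \<beta> else 0) $ i) \<alpha> * mfps_nth (defect (F t) k (h t) $ l) \<beta>)" for t
    proof -
      have "mfps_nth (h t $ i) \<alpha> = mfps_nth (homog_part k (h t) $ i) \<alpha>" by (simp add: homog_part_def k_def)
      also have "\<dots> = mfps_nth (homological_inverse k (defect (F t) k (h t)) $ i) \<alpha>"
        using homog_part_recursion[OF F h True] by simp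
      also have "\<dots> = (\<Sum>l\<in>UNIV. \<Sum>\<beta> | sum \<beta> UNIV = k.
        mfps_nth (defect (F t) k (h t) $ l) \<beta> * mfps_nth (homological_inverse k (\<chi> i. if i = l then mfps_monom \<beta> else 0) $ i) \<alpha>)"
        by (rule homological_inverse_expand[OF True homogeneous_defect])
      finally show ?thesis by (simp add: mult.commute)
    qed
    ultimately show ?thesis by (simp add: k_def)
  qed
qed

end

section \<open>Power series expansions in several variables\<close>

text \<open>A finite set of multi-indices lies in a box, over which the sum factors into partial
  geometric sums.\<close>

lemma summable_on_monomials:
  fixes x :: "'n::finite \<Rightarrow> real"
  assumes "\<And>j. 0 \<le> x j" "\<And>j. x j < 1"
  shows "(\<lambda>\<alpha>. \<Prod>j\<in>UNIV. x j ^ \<alpha> j) summable_on UNIV"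
proof (rule nonneg_bdd_above_summable_on)
  show "(\<Prod>j\<in>UNIV. x j ^ \<alpha> j) \<ge> 0" for \<alpha> using assms by (intro prod_nonneg) auto
  have "(\<Sum>\<alpha>\<in>F. \<Prod>j\<in>UNIV. x j ^ \<alpha> j) \<le> (\<Prod>j\<in>UNIV. 1 / (1 - x j))" if "finite F" for F :: "('n \<Rightarrow> nat) set"
  proof -
    define N where "N = (\<Sum>\<alpha>\<in>F. sum \<alpha> UNIV)"
    have "\<alpha> j \<le> N" if "\<alpha> \<in> F" for \<alpha> j
    proof -
      have "\<alpha> j \<le> sum \<alpha> UNIV" by (rule member_le_sum) auto
      also have "\<dots> \<le> N" unfolding N_def by (rule member_le_sum) (use that \<open>finite F\<close> in auto)
      finally show ?thesis .
    qed
    then have "F \<subseteq> PiE UNIV (\<lambda>_. {..N})" by (auto simp: PiE_iff)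
    then have "(\<Sum>\<alpha>\<in>F. \<Prod>j\<in>UNIV. x j ^ \<alpha> j) \<le> (\<Sum>\<alpha>\<in>PiE UNIV (\<lambda>_. {..N}). \<Prod>j\<in>UNIV. x j ^ \<alpha> j)"
      using assms by (intro sum_mono2 finite_PiE prod_nonneg) auto
    also have "\<dots> = (\<Prod>j\<in>UNIV. \<Sum>k\<le>N. x j ^ k)" by (subst prod_sum_PiE) auto
    also have "\<dots> \<le> (\<Prod>j\<in>UNIV. 1 / (1 - x j))"
    proof (rule prod_mono)
      fix j
      have "(\<Sum>k\<le>N. x j ^ k) \<le> (\<Sum>k. x j ^ k)"
        using assms[of j] by (intro sum_le_suminf summable_geometric) auto
      also have "\<dots> = 1 / (1 - x j)" using assms[of j] by (intro suminf_geometric) auto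
      finally show "0 \<le> (\<Sum>k\<le>N. x j ^ k) \<and> (\<Sum>k\<le>N. x j ^ k) \<le> 1 / (1 - x j)"
        using assms[of j] by (auto intro: sum_nonneg)
    qed
    finally show ?thesis .
  qed
  then show "bdd_above (sum (\<lambda>\<alpha>. \<Prod>j\<in>UNIV. x j ^ \<alpha> j) ` {F. F \<subseteq> UNIV \<and> finite F})"
    by (intro bdd_aboveI[of _ "\<Prod>j\<in>UNIV. 1 / (1 - x j)"]) auto
qed

section \<open>Uniqueness of expansions\<close>

definition vupd :: "complex ^ 'n \<Rightarrow> 'n \<Rightarrow> complex \<Rightarrow> complex ^ 'n" where
  "vupd z j w = (\<chi> i. if i = j then w else z $ i)"

lemma vupd_nth [simp]: "vupd z j w $ i = (if i = j then w else z $ i)"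
  by (simp add: vupd_def)

lemma vupd_simps [simp]: "vupd z j (z $ j) = z" "vupd (vupd z j v) j w = vupd z j w"
  by (auto simp: vec_eq_iff)

lemma vupd_swap: "i \<noteq> j \<Longrightarrow> vupd (vupd z i v) j w = vupd (vupd z j w) i v"
  by (auto simp: vec_eq_iff)

lemma monomial_upd: 
  assumes "\<alpha> j = 0"
  shows "monomial (vupd z j w) (\<alpha>(j := k)) = w ^ k * monomial z \<alpha>"
proof -
  have "monomial (vupd z j w) (\<alpha>(j := k)) = w ^ k * (\<Prod>i\<in>UNIV - {j}. (z $ i) ^ \<alpha> i)"
    unfolding monomial_def by (subst prod.remove[of _ j]) (auto intro!: prod.cong)
  also have "(\<Prod>i\<in>UNIV - {j}. (z $ i) ^ \<alpha> i) = monomial z \<alpha>"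
    unfolding monomial_def using assms by (subst prod.remove[of _ j]) auto
  finally show ?thesis .
qed

lemma has_sum_split_index:
  "(f has_sum s) UNIV \<longleftrightarrow> ((\<lambda>(k, \<alpha>). f (\<alpha>(j := k))) has_sum s) (UNIV \<times> {\<alpha> :: 'n \<Rightarrow> nat. \<alpha> j = 0})"
  by (rule has_sum_reindex_bij_witness[where i = "\<lambda>(k, \<alpha>). \<alpha>(j := k)" and j = "\<lambda>\<alpha>. (\<alpha> j, \<alpha>(j := 0))"]) auto

text \<open>A nonzero coefficient of positive index would make the sum, here identically 0, nonzero
  on a punctured disc.\<close>

lemma power_series_zero_imp_coeffs_zero:
  fixes b :: "nat \<Rightarrow> complex"
  assumes r: "r > 0" and sums: "\<And>w. cmod w < r \<Longrightarrow> (\<lambda>l. b l * w ^ l) sums 0"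
  shows "b k = 0"
proof (cases "k = 0")
  case True
  have "(\<lambda>l. b l * 0 ^ l) sums b 0" by (rule powser_sums_zero)
  then show ?thesis using sums[of 0] r True sums_unique2 by auto
next
  case False
  show ?thesis
  proof (rule ccontr)
    assume "b k \<noteq> 0"
    with False obtain s where s: "0 < s" "\<And>z :: complex. z \<in> cball 0 s - {0} \<Longrightarrow> (0 :: complex) \<noteq> 0"
      using powser_0_nonzero[of r 0 b "\<lambda>_. 0" k] r sums by auto
    have "complex_of_real s \<in> cball 0 s - {0}" using s(1) by auto
    then show False using s(2) by blast
  qed
qed

text \<open>Induction on the set \<open>S\<close> of variables that occur. Grouped by the exponent
  of \<open>j\<close>, the series is a one-variable power series in \<open>w\<close> that vanishes
  identically; each of its coefficients is a vanishing series in the remaining variables.\<close>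

lemma monomial_series_unique:
  fixes c :: "('n::finite \<Rightarrow> nat) \<Rightarrow> complex"
  assumes "finite S" "\<And>\<alpha>. (\<exists>i. i \<notin> S \<and> \<alpha> i \<noteq> 0) \<Longrightarrow> c \<alpha> = 0" and r: "r > 0"
    and "\<And>z. (\<forall>j. cmod (z $ j) < r) \<Longrightarrow> ((\<lambda>\<alpha>. c \<alpha> * monomial z \<alpha>) has_sum 0) UNIV"
  shows "c \<alpha> = 0"
  using assms(1,2,4)
proof (induction S arbitrary: c \<alpha> rule: finite_induct)
  case empty
  have c: "c \<alpha> = 0" if \<alpha>: "\<alpha> \<noteq> (\<lambda>_. 0)" for \<alpha>
  proof -
    have "\<exists>i. \<alpha> i \<noteq> 0" using \<alpha> by (auto simp: fun_eq_iff)
    then show ?thesis by (intro empty(1)) auto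
  qed
  have "((\<lambda>\<alpha>. c \<alpha> * monomial 0 \<alpha>) has_sum c (\<lambda>_. 0)) UNIV"
    by (rule has_sum_finite_neutralI[of "{\<lambda>_. 0}"]) (auto simp: c monomial_def)
  moreover have "((\<lambda>\<alpha>. c \<alpha> * monomial 0 \<alpha>) has_sum 0) UNIV" using empty(2)[of 0] r by simp
  ultimately have "c (\<lambda>_. 0) = 0" using has_sum_unique by blast
  then show ?case using c by (cases "\<alpha> = (\<lambda>_. 0)") auto
next
  case (insert j S)
  define ck where "ck k \<beta> = (if \<beta> j = 0 then c (\<beta>(j := k)) else 0)" for k \<beta>
  have ck: "((\<lambda>\<beta>. ck k \<beta> * monomial z \<beta>) has_sum 0) UNIV" if z: "\<forall>j. cmod (z $ j) < r" for k z
  proof -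
    define T where "T = {\<beta> :: 'n \<Rightarrow> nat. \<beta> j = 0}"
    have pairs: "((\<lambda>(l, \<beta>). w ^ l * (c (\<beta>(j := l)) * monomial z \<beta>)) has_sum 0) (UNIV \<times> T)"
      if w: "cmod w < r" for w
    proof -
      have "((\<lambda>\<alpha>. c \<alpha> * monomial (vupd z j w) \<alpha>) has_sum 0) UNIV"
        by (rule insert.prems(2)) (use z w in auto)
      then have "((\<lambda>(l, \<beta>). c (\<beta>(j := l)) * monomial (vupd z j w) (\<beta>(j := l))) has_sum 0) (UNIV \<times> T)"
        unfolding T_def by (subst (asm) has_sum_split_index)
      also have "?this \<longleftrightarrow> ((\<lambda>(l, \<beta>). w ^ l * (c (\<beta>(j := l)) * monomial z \<beta>)) has_sum 0) (UNIV \<times> T)"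
        by (rule has_sum_cong) (auto simp: T_def monomial_upd)
      finally show ?thesis .
    qed
    define b where "b l = infsum (\<lambda>\<beta>. c (\<beta>(j := l)) * monomial z \<beta>) T" for l
    have b: "((\<lambda>\<beta>. c (\<beta>(j := l)) * monomial z \<beta>) has_sum b l) T" for l
    proof -
      \<comment> \<open>Any nonzero point of the disc would do: summability of the inner series does
        not depend on \<open>w\<close> once its power is divided out.\<close>
      define w where "w = complex_of_real (r / 2)"
      have w: "cmod w < r" "w \<noteq> 0" using r by (auto simp: w_def norm_divide)
      have "(\<lambda>(l, \<beta>). w ^ l * (c (\<beta>(j := l)) * monomial z \<beta>)) summable_on (UNIV \<times> T)"
        using pairs[OF w(1)] unfolding summable_on_def by blast
      from summable_on_SigmaD1[OF this, of l]
      have "(\<lambda>\<beta>. w ^ l * (c (\<beta>(j := l)) * monomial z \<beta>)) summable_on T" by simp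
      then have "(\<lambda>\<beta>. c (\<beta>(j := l)) * monomial z \<beta>) summable_on T"
        using w(2) summable_on_cmult_right'[of "w ^ l"] by auto
      then show ?thesis unfolding b_def by (rule has_sum_infsum)
    qed
    have "b k = 0"
    proof (rule power_series_zero_imp_coeffs_zero[OF r])
      fix w assume w: "cmod w < r"
      have "((\<lambda>l. w ^ l * b l) has_sum 0) UNIV"
        by (rule has_sum_SigmaD[OF pairs[OF w]]) (auto intro: has_sum_cmult_right b)
      from has_sum_imp_sums[OF this] show "(\<lambda>l. b l * w ^ l) sums 0" by (simp add: mult.commute)
    qed
    with b[of k] have "((\<lambda>\<beta>. c (\<beta>(j := k)) * monomial z \<beta>) has_sum 0) T" by simp
    also have "?this \<longleftrightarrow> ((\<lambda>\<beta>. ck k \<beta> * monomial z \<beta>) has_sum 0) UNIV"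
      by (rule has_sum_cong_neutral) (auto simp: T_def ck_def)
    finally show ?thesis .
  qed
  have "ck (\<alpha> j) (\<alpha>(j := 0)) = 0"
  proof (rule insert.IH)
    fix \<beta> :: "'n \<Rightarrow> nat" assume "\<exists>i. i \<notin> S \<and> \<beta> i \<noteq> 0"
    then obtain i where i: "i \<notin> S" "\<beta> i \<noteq> 0" by blast
    show "ck (\<alpha> j) \<beta> = 0"
    proof (cases "i = j")
      case False
      then have "c (\<beta>(j := \<alpha> j)) = 0" using i by (intro insert.prems(1) exI[of _ i]) auto
      then show ?thesis by (simp add: ck_def)
    qed (use i in \<open>simp add: ck_def\<close>)
  qed (rule ck)
  then show ?case by (simp add: ck_def)
qed

section \<open>Expansion of separately holomorphic functions\<close>

text \<open>The hypotheses of Osgood's lemma, boundedness replacing joint continuity. Both survive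
  taking a Taylor coefficient in one variable, which lets the expansion proceed variable by
  variable.\<close>

definition sep_holomorphic :: "real \<Rightarrow> real \<Rightarrow> (complex ^ 'n \<Rightarrow> complex) \<Rightarrow> bool" where
  "sep_holomorphic R M g \<longleftrightarrow> (\<forall>z. (\<forall>j. cmod (z $ j) < R) \<longrightarrow>
     cmod (g z) \<le> M \<and> (\<forall>j. (\<lambda>w. g (vupd z j w)) holomorphic_on ball 0 R))"

definition coord_coeff :: "'n \<Rightarrow> nat \<Rightarrow> (complex ^ 'n \<Rightarrow> complex) \<Rightarrow> complex ^ 'n \<Rightarrow> complex" where
  "coord_coeff j k g z = (deriv ^^ k) (\<lambda>w. g (vupd z j w)) 0 / fact k"

lemma coord_coeff_sums:
  assumes "sep_holomorphic R M g" "\<forall>j. cmod (z $ j) < R" "cmod w < R"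
  shows "(\<lambda>k. coord_coeff j k g z * w ^ k) sums g (vupd z j w)"
  using holomorphic_power_series[of "\<lambda>w. g (vupd z j w)" 0 R w] assms
  by (simp add: sep_holomorphic_def coord_coeff_def)

lemma coord_coeff_bound:
  assumes g: "sep_holomorphic R M g" and z: "\<forall>j. cmod (z $ j) < R" and \<rho>: "0 < \<rho>" "\<rho> < R"
  shows "cmod (coord_coeff j k g z) \<le> M / \<rho> ^ k"
proof -
  have hol: "(\<lambda>w. g (vupd z j w)) holomorphic_on ball 0 R"
    using g z by (simp add: sep_holomorphic_def)
  have "cmod ((deriv ^^ k) (\<lambda>w. g (vupd z j w)) 0) \<le> fact k * M / \<rho> ^ k"
  proof (rule Cauchy_inequality)
    show "(\<lambda>w. g (vupd z j w)) holomorphic_on ball 0 \<rho>"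
      by (rule holomorphic_on_subset[OF hol]) (use \<rho> in auto)
    show "continuous_on (cball 0 \<rho>) (\<lambda>w. g (vupd z j w))"
      by (rule continuous_on_subset[OF holomorphic_on_imp_continuous_on[OF hol]]) (use \<rho> in auto)
    show "cmod (g (vupd z j w)) \<le> M" if "cmod (0 - w) = \<rho>" for w
    proof -
      have "\<forall>i. cmod (vupd z j w $ i) < R" using z that \<rho> by auto
      then show ?thesis using g by (simp add: sep_holomorphic_def)
    qed
  qed (rule \<rho>)
  then show ?thesis by (simp add: coord_coeff_def norm_divide field_simps)
qed

text \<open>The k-th Taylor coefficient in the variable j is the limit, for small e, of the value at
  e minus the Taylor terms below k, divided by e^k. By induction these quotients are holomorphic in
  the variable i, and Cauchy's inequality makes the convergence uniform.\<close>

lemma coord_coeff_holomorphic: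
  assumes g: "sep_holomorphic R M g" and z: "\<forall>j. cmod (z $ j) < R" and R: "R > 0" and ij: "i \<noteq> j"
  shows "(\<lambda>v. coord_coeff j k g (vupd z i v)) holomorphic_on ball 0 R"
proof (induction k rule: less_induct)
  case (less k)
  define \<rho> where "\<rho> = R / 2"
  have \<rho>: "0 < \<rho>" "\<rho> < R" using R by (auto simp: \<rho>_def)
  have M: "M \<ge> 0" using g z norm_ge_zero order_trans unfolding sep_holomorphic_def by blast
  \<comment> \<open>Tends to 0 and stays below \<rho> / 2, so the Taylor tail is dominated by a
    geometric series of ratio at most 1/2.\<close>
  define e where "e n = \<rho> / (real n + 2)" for n :: nat
  have e: "0 < e n" "e n \<le> \<rho> / 2" "e n < R" for n
  proof -
    show "0 < e n" using \<rho> by (simp add: e_def)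
    show "e n \<le> \<rho> / 2" unfolding e_def using \<rho> by (intro divide_left_mono) auto
    then show "e n < R" using \<rho> by linarith
  qed
  have zv: "\<forall>j. cmod (vupd z i v $ j) < R" if "v \<in> ball 0 R" for v using z that by auto
  define f where "f n v = (g (vupd (vupd z i v) j (of_real (e n))) -
    (\<Sum>l<k. coord_coeff j l g (vupd z i v) * of_real (e n) ^ l)) / of_real (e n) ^ k" for n v
  have f_hol: "f n holomorphic_on ball 0 R" for n
  proof -
    have "(\<lambda>v. g (vupd (vupd z j (of_real (e n))) i v)) holomorphic_on ball 0 R"
      using g z e[of n] by (simp add: sep_holomorphic_def)
    then show ?thesis
      unfolding f_def vupd_swap[OF ij] using less e(1)[of n] by (intro holomorphic_intros) auto
  qed
  have dist: "cmod (f n v - coord_coeff j k g (vupd z i v)) \<le> 2 * M / \<rho> ^ Suc k * e n"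
    if v: "v \<in> ball 0 R" for n v
  proof -
    define a where "a l = coord_coeff j l g (vupd z i v)" for l
    define x where "x = e n / \<rho>"
    have x: "0 \<le> x" "x \<le> 1 / 2" using e[of n] \<rho> by (auto simp: x_def field_simps)
    have a: "cmod (a l) \<le> M / \<rho> ^ l" for l
      unfolding a_def by (rule coord_coeff_bound[OF g zv[OF v] \<rho>])
    have "(\<lambda>l. a l * of_real (e n) ^ l) sums g (vupd (vupd z i v) j (of_real (e n)))"
      unfolding a_def by (rule coord_coeff_sums[OF g zv[OF v]]) (use e[of n] in auto)
    from sums_split_initial_segment[OF this, of "Suc k"]
    have "(\<lambda>l. a (l + Suc k) * of_real (e n) ^ (l + Suc k)) sums
        (g (vupd (vupd z i v) j (of_real (e n))) - (\<Sum>l<Suc k. a l * of_real (e n) ^ l))" .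
    then have "(\<lambda>l. a (l + Suc k) * of_real (e n) ^ (l + Suc k) / of_real (e n) ^ k) sums
        ((g (vupd (vupd z i v) j (of_real (e n))) - (\<Sum>l<Suc k. a l * of_real (e n) ^ l)) / of_real (e n) ^ k)"
      by (rule sums_divide)
    also have "(\<lambda>l. a (l + Suc k) * of_real (e n) ^ (l + Suc k) / of_real (e n) ^ k) =
        (\<lambda>l. a (l + Suc k) * of_real (e n) ^ Suc l)"
      using e(1)[of n] by (auto simp: power_add field_simps)
    also have "((g (vupd (vupd z i v) j (of_real (e n))) - (\<Sum>l<Suc k. a l * of_real (e n) ^ l)) / of_real (e n) ^ k) =
        f n v - a k"
      using e(1)[of n] by (simp add: f_def a_def diff_divide_distrib add_divide_distrib)
    finally have s: "(\<lambda>l. a (l + Suc k) * of_real (e n) ^ Suc l) sums (f n v - a k)" .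
    have bd: "cmod (a (l + Suc k) * of_real (e n) ^ Suc l) \<le> M / \<rho> ^ k * x ^ Suc l" for l
    proof -
      have "cmod (a (l + Suc k) * of_real (e n) ^ Suc l) = cmod (a (l + Suc k)) * e n ^ Suc l"
        using e(1)[of n] by (simp add: norm_mult norm_power)
      also have "\<dots> \<le> M / \<rho> ^ (l + Suc k) * e n ^ Suc l"
        using e(1)[of n] by (intro mult_right_mono a) auto
      also have "\<dots> = M / \<rho> ^ k * x ^ Suc l" using \<rho> by (simp add: x_def power_add power_divide field_simps)
      finally show ?thesis .
    qed
    have gs: "(\<lambda>l. M / \<rho> ^ k * x ^ Suc l) sums (M / \<rho> ^ k * (x * (1 / (1 - x))))"
      unfolding power_Suc using x by (intro sums_mult geometric_sums) auto
    have "cmod (f n v - a k) \<le> M / \<rho> ^ k * (x * (1 / (1 - x)))"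
      using norm_suminf_le[OF bd sums_summable[OF gs]] sums_unique[OF s] sums_unique[OF gs] by simp
    also have "\<dots> \<le> M / \<rho> ^ k * (x * 2)"
      using x M \<rho> by (intro mult_left_mono) (auto simp: field_simps)
    also have "\<dots> = 2 * M / \<rho> ^ Suc k * e n" by (simp add: x_def mult_ac)
    finally show ?thesis by (simp add: a_def)
  qed
  have lim: "(\<lambda>n. 2 * M / \<rho> ^ Suc k * e n) \<longlonglongrightarrow> 0"
  proof -
    have "e \<longlonglongrightarrow> 0" unfolding e_def by real_asymp
    then show ?thesis by (rule tendsto_mult_right_zero)
  qed
  show ?case
  proof (rule holomorphic_uniform_sequence[OF open_ball f_hol])
    fix x :: complex assume "x \<in> ball 0 R"
    then obtain d where d: "0 < d" "cball x d \<subseteq> ball 0 R" using open_contains_cball open_ball by blast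
    have "uniform_limit (cball x d) f (\<lambda>v. coord_coeff j k g (vupd z i v)) sequentially"
    proof (rule uniform_limitI)
      fix \<epsilon> :: real assume "\<epsilon> > 0"
      then have "\<forall>\<^sub>F n in sequentially. 2 * M / \<rho> ^ Suc k * e n < \<epsilon>"
        using lim by (intro order_tendstoD(2)) auto
      then show "\<forall>\<^sub>F n in sequentially. \<forall>v\<in>cball x d. dist (f n v) (coord_coeff j k g (vupd z i v)) < \<epsilon>"
      proof eventually_elim
        case (elim n)
        show ?case
        proof
          fix v assume "v \<in> cball x d"
          then have "v \<in> ball 0 R" using d(2) by blast
          from dist[OF this, of n] elim show "dist (f n v) (coord_coeff j k g (vupd z i v)) < \<epsilon>"
            unfolding dist_norm by (rule le_less_trans)
        qed
      qed
    qed
    with d show "\<exists>d. 0 < d \<and> cball x d \<subseteq> ball 0 R \<and>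
        uniform_limit (cball x d) f (\<lambda>v. coord_coeff j k g (vupd z i v)) sequentially" by blast
  qed
qed

lemma sep_holomorphic_coord_coeff:
  assumes g: "sep_holomorphic R M g" and \<rho>: "0 < \<rho>" "\<rho> < R"
  shows "sep_holomorphic R (M / \<rho> ^ k) (coord_coeff j k g)"
  unfolding sep_holomorphic_def
proof (intro allI impI conjI)
  fix z :: "complex ^ 'a" and i assume z: "\<forall>j. cmod (z $ j) < R"
  show "cmod (coord_coeff j k g z) \<le> M / \<rho> ^ k" by (rule coord_coeff_bound[OF g z \<rho>])
  show "(\<lambda>w. coord_coeff j k g (vupd z i w)) holomorphic_on ball 0 R"
  proof (cases "i = j")
    case True
    then show ?thesis by (simp add: coord_coeff_def)
  next
    case False
    then show ?thesis using coord_coeff_holomorphic[OF g z] \<rho> by simp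
  qed
qed

text \<open>An expansion in the variables of \<open>S\<close> only. The coefficients are still
  functions of the whole point, but do not depend on its coordinates in \<open>S\<close>; the bound
  on them is Cauchy's, which yields absolute convergence at the next stage.\<close>

definition partial_expansion ::
    "real \<Rightarrow> real \<Rightarrow> real \<Rightarrow> 'n set \<Rightarrow> (complex ^ 'n \<Rightarrow> complex) \<Rightarrow> (('n \<Rightarrow> nat) \<Rightarrow> complex ^ 'n \<Rightarrow> complex) \<Rightarrow> bool" where
  "partial_expansion R M \<rho> S g c \<longleftrightarrow> (\<forall>\<alpha>. sep_holomorphic R (M / \<rho> ^ sum \<alpha> UNIV) (c \<alpha>)) \<and>
    (\<forall>\<alpha> z z'. (\<forall>i. i \<notin> S \<longrightarrow> z $ i = z' $ i) \<longrightarrow> c \<alpha> z = c \<alpha> z') \<and>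
    (\<forall>\<alpha> z. (\<exists>i. i \<notin> S \<and> \<alpha> i \<noteq> 0) \<longrightarrow> c \<alpha> z = 0) \<and>
    (\<forall>z. (\<forall>j. cmod (z $ j) < \<rho>) \<longrightarrow> ((\<lambda>\<alpha>. c \<alpha> z * monomial z \<alpha>) has_sum g z) UNIV)"

lemma partial_expansionD:
  assumes "partial_expansion R M \<rho> S g c"
  shows "sep_holomorphic R (M / \<rho> ^ sum \<alpha> UNIV) (c \<alpha>)"
    and "(\<And>i. i \<notin> S \<Longrightarrow> z $ i = z' $ i) \<Longrightarrow> c \<alpha> z = c \<alpha> z'"
    and "i \<notin> S \<Longrightarrow> \<alpha> i \<noteq> 0 \<Longrightarrow> c \<alpha> z = 0"
    and "(\<And>j. cmod (z $ j) < \<rho>) \<Longrightarrow> ((\<lambda>\<alpha>. c \<alpha> z * monomial z \<alpha>) has_sum g z) UNIV"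
proof -
  note * = assms[unfolded partial_expansion_def]
  show "sep_holomorphic R (M / \<rho> ^ sum \<alpha> UNIV) (c \<alpha>)" using * by (rule conjunct1[THEN spec])
  show "(\<And>i. i \<notin> S \<Longrightarrow> z $ i = z' $ i) \<Longrightarrow> c \<alpha> z = c \<alpha> z'"
    using *[THEN conjunct2, THEN conjunct1] by simp
  show "i \<notin> S \<Longrightarrow> \<alpha> i \<noteq> 0 \<Longrightarrow> c \<alpha> z = 0"
    using *[THEN conjunct2, THEN conjunct2, THEN conjunct1] by blast
  show "(\<And>j. cmod (z $ j) < \<rho>) \<Longrightarrow> ((\<lambda>\<alpha>. c \<alpha> z * monomial z \<alpha>) has_sum g z) UNIV"
    using *[THEN conjunct2, THEN conjunct2, THEN conjunct2] by simp
qed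

lemma sep_holomorphic_expansion_partial:
  fixes g :: "complex ^ 'n \<Rightarrow> complex"
  assumes "finite S" "sep_holomorphic R M g" and \<rho>: "0 < \<rho>" "\<rho> < R"
  shows "\<exists>c. partial_expansion R M \<rho> S g c"
  using assms(1)
proof (induction S rule: finite_induct)
  case empty
  have M: "M \<ge> 0"
  proof -
    have "cmod (g 0) \<le> M" using assms(2) \<rho> unfolding sep_holomorphic_def by force
    then show ?thesis using norm_ge_zero order_trans by blast
  qed
  define c where "c \<alpha> = (if \<alpha> = (\<lambda>_. 0) then g else (\<lambda>_. 0))" for \<alpha> :: "'n \<Rightarrow> nat"
  have "sep_holomorphic R (M / \<rho> ^ sum \<alpha> UNIV) (c \<alpha>)" for \<alpha>
    using assms(2) M \<rho> by (simp add: c_def sep_holomorphic_def)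
  moreover have "((\<lambda>\<alpha>. c \<alpha> z * monomial z \<alpha>) has_sum g z) UNIV" for z
    by (rule has_sum_finite_neutralI[of "{\<lambda>_. 0}"]) (auto simp: c_def monomial_def)
  moreover have "c \<alpha> z = 0" if "\<exists>i. i \<notin> {} \<and> \<alpha> i \<noteq> 0" for \<alpha> z using that by (auto simp: c_def)
  moreover have "c \<alpha> z = c \<alpha> z'" if "\<forall>i. i \<notin> {} \<longrightarrow> z $ i = z' $ i" for \<alpha> z z'
  proof -
    have "z = z'" using that by (simp add: vec_eq_iff)
    then show ?thesis by simp
  qed
  ultimately show ?case unfolding partial_expansion_def by (intro exI[of _ c] conjI allI impI)
next
  case (insert j S)
  then obtain c where "partial_expansion R M \<rho> S g c" by blast
  note c1 = partial_expansionD(1)[OF this] and c2 = partial_expansionD(2)[OF this]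
    and c3 = partial_expansionD(3)[OF this] and c4 = partial_expansionD(4)[OF this]
  define c' where "c' \<alpha> = coord_coeff j (\<alpha> j) (c (\<alpha>(j := 0)))" for \<alpha>
  have sum_upd: "sum \<alpha> UNIV = sum (\<alpha>(j := 0)) UNIV + \<alpha> j" for \<alpha> :: "'n \<Rightarrow> nat"
    by (simp add: sum.remove[of UNIV j])
  have 1: "sep_holomorphic R (M / \<rho> ^ sum \<alpha> UNIV) (c' \<alpha>)" for \<alpha>
    using sep_holomorphic_coord_coeff[OF c1 \<rho>, of "\<alpha>(j := 0)" "\<alpha> j" j]
    by (simp add: c'_def sum_upd[of \<alpha>] power_add)
  have 2: "c' \<alpha> z = c' \<alpha> z'" if "\<forall>i. i \<notin> insert j S \<longrightarrow> z $ i = z' $ i" for \<alpha> z z'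
  proof -
    have "c (\<alpha>(j := 0)) (vupd z j w) = c (\<alpha>(j := 0)) (vupd z' j w)" for w
      by (rule c2) (use that in auto)
    then show ?thesis by (simp add: c'_def coord_coeff_def)
  qed
  have 3: "c' \<alpha> z = 0" if ex: "\<exists>i. i \<notin> insert j S \<and> \<alpha> i \<noteq> 0" for \<alpha> z
  proof -
    obtain i where "i \<noteq> j" "i \<notin> S" "\<alpha> i \<noteq> 0" using ex by auto
    then have "c (\<alpha>(j := 0)) z = 0" for z by (intro c3[of i]) auto
    then have "c (\<alpha>(j := 0)) = (\<lambda>z. 0)" by auto
    then show ?thesis by (simp add: c'_def coord_coeff_def)
  qed
  have 4: "((\<lambda>\<alpha>. c' \<alpha> z * monomial z \<alpha>) has_sum g z) UNIV" if z: "\<forall>j. cmod (z $ j) < \<rho>" for z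
  proof -
    have zR: "\<forall>j. cmod (z $ j) < R" using z \<rho> by (meson less_trans)
    define T where "T = {\<beta> :: 'n \<Rightarrow> nat. \<beta> j = 0}"
    \<comment> \<open>Absolute convergence is settled before the value of the sum; it permits
      summing in any order.\<close>
    have "(\<lambda>\<alpha>. M * (\<Prod>j\<in>UNIV. (cmod (z $ j) / \<rho>) ^ \<alpha> j)) summable_on UNIV"
      using z \<rho> by (intro summable_on_cmult_right summable_on_monomials) (auto simp: divide_less_eq_1)
    then have "(\<lambda>\<alpha>. norm (c' \<alpha> z * monomial z \<alpha>)) summable_on UNIV"
    proof (rule summable_on_comparison_test)
      fix \<alpha> :: "'n \<Rightarrow> nat"
      have "cmod (c' \<alpha> z) \<le> M / \<rho> ^ sum \<alpha> UNIV" using 1[of \<alpha>] zR by (simp add: sep_holomorphic_def)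
      then have "norm (c' \<alpha> z * monomial z \<alpha>) \<le> M / \<rho> ^ sum \<alpha> UNIV * (\<Prod>j\<in>UNIV. cmod (z $ j) ^ \<alpha> j)"
        unfolding norm_mult monomial_def prod_norm[symmetric] norm_power
        by (intro mult_right_mono prod_nonneg) auto
      also have "\<dots> = M * (\<Prod>j\<in>UNIV. (cmod (z $ j) / \<rho>) ^ \<alpha> j)"
        by (simp add: power_divide prod_dividef power_sum)
      finally show "norm (c' \<alpha> z * monomial z \<alpha>) \<le> M * (\<Prod>j\<in>UNIV. (cmod (z $ j) / \<rho>) ^ \<alpha> j)" .
    qed simp
    then have "(\<lambda>\<alpha>. c' \<alpha> z * monomial z \<alpha>) summable_on UNIV" by (rule abs_summable_summable)
    then obtain s where s: "((\<lambda>\<alpha>. c' \<alpha> z * monomial z \<alpha>) has_sum s) UNIV" unfolding summable_on_def by blast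
    then have "((\<lambda>(k, \<beta>). c' (\<beta>(j := k)) z * monomial z (\<beta>(j := k))) has_sum s) (UNIV \<times> T)"
      unfolding T_def by (subst (asm) has_sum_split_index)
    then have "((\<lambda>(\<beta>, k). c' (\<beta>(j := k)) z * monomial z (\<beta>(j := k))) has_sum s) (T \<times> UNIV)"
      by (subst has_sum_reindex_bij_witness[where i = prod.swap and j = prod.swap and T = "UNIV \<times> T" and
            h = "\<lambda>(k, \<beta>). c' (\<beta>(j := k)) z * monomial z (\<beta>(j := k))" and s' = s]) auto
    also have "?this \<longleftrightarrow> ((\<lambda>(\<beta>, k). coord_coeff j k (c \<beta>) z * (z $ j) ^ k * monomial z \<beta>) has_sum s) (T \<times> UNIV)"
    proof (rule has_sum_cong, clarify)
      fix \<beta> k assume "\<beta> \<in> T"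
      then have "monomial z (\<beta>(j := k)) = (z $ j) ^ k * monomial z \<beta>" "\<beta>(j := 0) = \<beta>"
        using monomial_upd[of \<beta> j z "z $ j" k] by (auto simp: T_def)
      then show "c' (\<beta>(j := k)) z * monomial z (\<beta>(j := k)) = coord_coeff j k (c \<beta>) z * (z $ j) ^ k * monomial z \<beta>"
        by (simp add: c'_def)
    qed
    finally have pairs: "((\<lambda>(\<beta>, k). coord_coeff j k (c \<beta>) z * (z $ j) ^ k * monomial z \<beta>) has_sum s) (T \<times> UNIV)" .
    \<comment> \<open>Summing first over the exponent of \<open>j\<close> rebuilds the old
      coefficient from its Taylor series in that variable, so the new series has the same sum as the
      old one.\<close>
    have "((\<lambda>\<beta>. c \<beta> z * monomial z \<beta>) has_sum s) T"
    proof (rule has_sum_SigmaD[OF pairs])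
      fix \<beta> assume "\<beta> \<in> T"
      have "(\<lambda>(\<beta>, k). coord_coeff j k (c \<beta>) z * (z $ j) ^ k * monomial z \<beta>) summable_on (T \<times> UNIV)"
        using pairs unfolding summable_on_def by blast
      from summable_on_SigmaD1[OF this \<open>\<beta> \<in> T\<close>]
      obtain b where b: "((\<lambda>k. coord_coeff j k (c \<beta>) z * (z $ j) ^ k * monomial z \<beta>) has_sum b) UNIV"
        unfolding summable_on_def by auto
      have "(\<lambda>k. coord_coeff j k (c \<beta>) z * (z $ j) ^ k) sums c \<beta> (vupd z j (z $ j))"
        by (rule coord_coeff_sums[OF c1 zR]) (use zR in auto)
      then have "(\<lambda>k. coord_coeff j k (c \<beta>) z * (z $ j) ^ k * monomial z \<beta>) sums (c \<beta> z * monomial z \<beta>)"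
        by (simp add: sums_mult2)
      with has_sum_imp_sums[OF b] have "b = c \<beta> z * monomial z \<beta>" using sums_unique2 by blast
      with b show "((\<lambda>k. case (\<beta>, k) of (\<beta>, k) \<Rightarrow> coord_coeff j k (c \<beta>) z * (z $ j) ^ k * monomial z \<beta>)
          has_sum c \<beta> z * monomial z \<beta>) UNIV" by simp
    qed
    also have "?this \<longleftrightarrow> ((\<lambda>\<beta>. c \<beta> z * monomial z \<beta>) has_sum s) UNIV"
      by (rule has_sum_cong_neutral) (use c3[OF insert.hyps(2)] in \<open>auto simp: T_def\<close>)
    finally have "((\<lambda>\<beta>. c \<beta> z * monomial z \<beta>) has_sum s) UNIV" .
    then have "s = g z" by (rule has_sum_unique) (rule c4, use z in blast)
    with s show ?thesis by simp
  qed
  show ?case unfolding partial_expansion_def using 1 2 3 4 by (intro exI[of _ c'] conjI allI impI)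
qed

lemma sep_holomorphic_expansion:
  fixes g :: "complex ^ 'n \<Rightarrow> complex"
  assumes "sep_holomorphic R M g" "R > 0"
  shows "\<exists>c. \<forall>z. (\<forall>j. cmod (z $ j) < R / 2) \<longrightarrow> ((\<lambda>\<alpha>. c \<alpha> * monomial z \<alpha>) has_sum g z) UNIV"
proof -
  obtain c where c: "partial_expansion R M (R / 2) UNIV g c"
    using sep_holomorphic_expansion_partial[of UNIV R M g "R / 2"] assms by auto
  have "((\<lambda>\<alpha>. c \<alpha> 0 * monomial z \<alpha>) has_sum g z) UNIV" if "\<forall>j. cmod (z $ j) < R / 2" for z
  proof -
    have "((\<lambda>\<alpha>. c \<alpha> z * monomial z \<alpha>) has_sum g z) UNIV"
      by (rule partial_expansionD(4)[OF c]) (use that in blast)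
    moreover have "c \<alpha> z = c \<alpha> 0" for \<alpha> by (rule partial_expansionD(2)[OF c]) simp
    ultimately show ?thesis by simp
  qed
  then show ?thesis by (intro exI[of _ "\<lambda>\<alpha>. c \<alpha> 0"] allI impI)
qed

section \<open>Germs and their Taylor series\<close>

lemma eventually_nhds_polydisc:
  "(\<forall>\<^sub>F z in nhds (0 :: complex ^ 'n). P z) \<longleftrightarrow> (\<exists>r>0. \<forall>z. (\<forall>j. cmod (z $ j) < r) \<longrightarrow> P z)"
proof
  assume "\<forall>\<^sub>F z in nhds (0 :: complex ^ 'n). P z"
  then obtain e where e: "e > 0" "\<And>z :: complex ^ 'n. norm z < e \<Longrightarrow> P z"
    by (auto simp: eventually_nhds_metric)
  have "P z" if "\<forall>j. cmod (z $ j) < e / CARD('n)" for z :: "complex ^ 'n"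
  proof (rule e(2))
    have "norm z \<le> (\<Sum>j\<in>UNIV. cmod (z $ j))" unfolding norm_vec_def by (rule L2_set_le_sum) auto
    also have "\<dots> < (\<Sum>j\<in>(UNIV :: 'n set). e / CARD('n))" using that by (intro sum_strict_mono) auto
    finally show "norm z < e" by simp
  qed
  then show "\<exists>r>0. \<forall>z. (\<forall>j. cmod (z $ j) < r) \<longrightarrow> P z" using e(1)
    by (intro exI[of _ "e / CARD('n)"]) auto
next
  assume "\<exists>r>0. \<forall>z. (\<forall>j. cmod (z $ j) < r) \<longrightarrow> P z"
  then obtain r where r: "r > 0" "\<And>z. (\<forall>j. cmod (z $ j) < r) \<Longrightarrow> P z" by blast
  have "P z" if "norm z < r" for z
    using r(2)[of z] Finite_Cartesian_Product.norm_nth_le[of z] that by (meson le_less_trans)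
  then show "\<forall>\<^sub>F z in nhds (0 :: complex ^ 'n). P z" using r(1)
    by (auto simp: eventually_nhds_metric)
qed

lemma bounded_linear_vupd: "bounded_linear (vupd (0 :: complex ^ 'n) j)"
  unfolding linear_conv_bounded_linear[symmetric]
  by (rule linearI) (auto simp: vec_eq_iff)

lemma sum_vupd_0: "(\<Sum>i\<in>UNIV. vupd (0 :: complex ^ 'n) i (c i)) = (\<chi> i. c i)"
  unfolding vec_eq_iff by (simp add: sum_component cong: if_cong)

lemma has_derivative_vupd: "(vupd z j has_derivative vupd 0 j) (at w within S)"
proof -
  have "vupd z j = (\<lambda>w. vupd z j 0 + vupd 0 j w)" by (auto simp: vec_eq_iff fun_eq_iff)
  moreover have "((\<lambda>w. vupd z j 0 + vupd 0 j w) has_derivative (\<lambda>h. 0 + vupd 0 j h)) (at w within S)"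
    by (intro has_derivative_add has_derivative_const bounded_linear_imp_has_derivative bounded_linear_vupd)
  ultimately show ?thesis by simp
qed

text \<open>A derivative given by a complex matrix makes each component holomorphic in each
  coordinate; continuity at 0 supplies the bound on a small polydisc.\<close>

lemma holomorphic_germ_expansion:
  fixes f :: "complex ^ 'n \<Rightarrow> complex ^ 'n"
  assumes "holomorphic_germ f"
  shows "\<exists>F. f has_mfps_expansion F"
proof -
  have ev: "\<forall>\<^sub>F z in nhds 0. \<exists>J :: complex ^ 'n ^ 'n. (f has_derivative (\<lambda>v. J *v v)) (at z)"
    using assms unfolding holomorphic_germ_def .
  then have "isCont f 0" using eventually_nhds_x_imp_x has_derivative_continuous by blast
  then have "((\<lambda>z. norm (f z)) \<longlongrightarrow> norm (f 0)) (at 0)" by (intro tendsto_norm) (simp add: isCont_def)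
  then have "\<forall>\<^sub>F z in at 0. norm (f z) < norm (f 0) + 1" by (rule order_tendstoD(2)) simp
  then have "\<forall>\<^sub>F z in nhds 0. norm (f z) < norm (f 0) + 1" by (simp add: eventually_nhds_conv_at)
  with ev have "\<forall>\<^sub>F z in nhds 0. (\<exists>J :: complex ^ 'n ^ 'n. (f has_derivative (\<lambda>v. J *v v)) (at z)) \<and>
      norm (f z) < norm (f 0) + 1" by (rule eventually_conj)
  then obtain r where r: "r > 0"
    "\<And>z. (\<forall>j. cmod (z $ j) < r) \<Longrightarrow> \<exists>J :: complex ^ 'n ^ 'n. (f has_derivative (\<lambda>v. J *v v)) (at z)"
    "\<And>z. (\<forall>j. cmod (z $ j) < r) \<Longrightarrow> norm (f z) < norm (f 0) + 1"
    unfolding eventually_nhds_polydisc by blast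
  have sep: "sep_holomorphic r (norm (f 0) + 1) (\<lambda>z. f z $ i)" for i
    unfolding sep_holomorphic_def
  proof (intro allI impI conjI)
    fix z :: "complex ^ 'n" and j assume z: "\<forall>j. cmod (z $ j) < r"
    show "cmod (f z $ i) \<le> norm (f 0) + 1"
      using r(3)[OF z] Finite_Cartesian_Product.norm_nth_le[of "f z" i] by linarith
    show "(\<lambda>w. f (vupd z j w) $ i) holomorphic_on ball 0 r"
      unfolding holomorphic_on_def field_differentiable_def
    proof
      fix w assume "w \<in> ball (0 :: complex) r"
      then have "\<forall>k. cmod (vupd z j w $ k) < r" using z by simp
      then obtain J :: "complex ^ 'n ^ 'n" where "(f has_derivative (\<lambda>v. J *v v)) (at (vupd z j w))"
        using r(2) by blast
      then have "((\<lambda>w. f (vupd z j w)) has_derivative (\<lambda>h. J *v (vupd 0 j h))) (at w within ball 0 r)"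
        by (rule has_derivative_compose[OF has_derivative_vupd])
      then have "((\<lambda>w. f (vupd z j w) $ i) has_derivative (\<lambda>h. (J *v (vupd 0 j h)) $ i)) (at w within ball 0 r)"
        by (rule bounded_linear.has_derivative[OF bounded_linear_vec_nth])
      moreover have "(J *v (vupd 0 j h)) $ i = J $ i $ j * h" for h
        by (simp add: matrix_vector_mult_def if_distrib cong: if_cong)
      ultimately have "((\<lambda>w. f (vupd z j w) $ i) has_field_derivative J $ i $ j) (at w within ball 0 r)"
        by (simp add: has_field_derivative_def)
      then show "\<exists>D. ((\<lambda>w. f (vupd z j w) $ i) has_field_derivative D) (at w within ball 0 r)" by blast
    qed
  qed
  have "\<exists>c. \<forall>i z. (\<forall>j. cmod (z $ j) < r / 2) \<longrightarrow> ((\<lambda>\<alpha>. c i \<alpha> * monomial z \<alpha>) has_sum f z $ i) UNIV"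
    using sep_holomorphic_expansion[OF sep r(1)] by (intro choice allI)
  then obtain c where c: "\<And>i z. (\<forall>j. cmod (z $ j) < r / 2) \<Longrightarrow> ((\<lambda>\<alpha>. c i \<alpha> * monomial z \<alpha>) has_sum f z $ i) UNIV"
    by blast
  have "f has_mfps_expansion (\<chi> i. Abs_mfps (c i))"
    unfolding has_mfps_expansion_def eventually_nhds_polydisc using r(1) c
    by (intro exI[of _ "r / 2"]) simp
  then show ?thesis by blast
qed

lemma has_mfps_expansion_unique:
  fixes f :: "complex ^ 'n \<Rightarrow> complex ^ 'n"
  assumes "f has_mfps_expansion F" "f has_mfps_expansion F'"
  shows "F = F'"
proof -
  have "\<forall>\<^sub>F z in nhds 0. \<forall>i. ((\<lambda>\<alpha>. (mfps_nth (F $ i) \<alpha> - mfps_nth (F' $ i) \<alpha>) * monomial z \<alpha>) has_sum 0) UNIV"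
    using assms unfolding has_mfps_expansion_def
  proof eventually_elim
    case (elim z)
    show ?case
    proof
      fix i
      have "((\<lambda>\<alpha>. mfps_nth (F $ i) \<alpha> * monomial z \<alpha> + (- 1) * (mfps_nth (F' $ i) \<alpha> * monomial z \<alpha>)) has_sum
          f z $ i + (- 1) * f z $ i) UNIV"
        using elim by (intro has_sum_add has_sum_cmult_right) auto
      then show "((\<lambda>\<alpha>. (mfps_nth (F $ i) \<alpha> - mfps_nth (F' $ i) \<alpha>) * monomial z \<alpha>) has_sum 0) UNIV"
        by (simp add: left_diff_distrib)
    qed
  qed
  then obtain r where r: "r > 0" "\<And>z i. (\<forall>j. cmod (z $ j) < r) \<Longrightarrow>
      ((\<lambda>\<alpha>. (mfps_nth (F $ i) \<alpha> - mfps_nth (F' $ i) \<alpha>) * monomial z \<alpha>) has_sum 0) UNIV"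
    unfolding eventually_nhds_polydisc by blast
  have "mfps_nth (F $ i) \<alpha> - mfps_nth (F' $ i) \<alpha> = 0" for i \<alpha>
    by (rule monomial_series_unique[OF finite_class.finite_UNIV _ r(1,2)]) auto
  then show ?thesis by (simp add: mfps_vec_eq_iff)
qed

lemma taylor_series_eq: "f has_mfps_expansion F \<Longrightarrow> taylor_series f = F"
  unfolding taylor_series_def using has_mfps_expansion_unique by blast

text \<open>On the axis of the coordinate j the i-th component is a one-variable power series whose
  first two coefficients are the ones in question. Its sum is at most C|w|^2, so its value and its
  derivative at 0 vanish.\<close>

lemma expansion_second_order:
  fixes f :: "complex ^ 'n \<Rightarrow> complex ^ 'n"
  assumes F: "f has_mfps_expansion F" and f0: "f 0 = 0"
    and O: "(\<lambda>z. norm (f z)) \<in> O[at 0](\<lambda>z. norm z ^ 2)"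
  shows "mfps_nth (F $ i) (\<lambda>_. 0) = 0" "mfps_nth (F $ i) ((\<lambda>_. 0)(j := 1)) = 0"
proof -
  obtain C where C: "C > 0" "\<forall>\<^sub>F z in at 0. norm (norm (f z)) \<le> C * norm (norm z ^ 2)"
    using landau_o.bigE[OF O] by blast
  have "\<forall>\<^sub>F z in nhds 0. norm (f z) \<le> C * norm z ^ 2"
    using C(2) f0 by (simp add: eventually_nhds_conv_at)
  with F have "\<forall>\<^sub>F z in nhds 0. (\<forall>i. ((\<lambda>\<alpha>. mfps_nth (F $ i) \<alpha> * monomial z \<alpha>) has_sum f z $ i) UNIV) \<and>
      norm (f z) \<le> C * norm z ^ 2"
    unfolding has_mfps_expansion_def by (rule eventually_conj)
  then obtain r where r: "r > 0"
    "\<And>z i. (\<forall>j. cmod (z $ j) < r) \<Longrightarrow> ((\<lambda>\<alpha>. mfps_nth (F $ i) \<alpha> * monomial z \<alpha>) has_sum f z $ i) UNIV"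
    "\<And>z. (\<forall>j. cmod (z $ j) < r) \<Longrightarrow> norm (f z) \<le> C * norm z ^ 2"
    unfolding eventually_nhds_polydisc by blast
  define b where "b k = mfps_nth (F $ i) ((\<lambda>_. 0)(j := k))" for k
  define g where "g w = f (vupd 0 j w) $ i" for w
  have sums: "(\<lambda>k. b k * w ^ k) sums g w" if w: "cmod w < r" for w
  proof -
    have "((\<lambda>\<alpha>. mfps_nth (F $ i) \<alpha> * monomial (vupd 0 j w) \<alpha>) has_sum g w) UNIV"
      unfolding g_def by (rule r(2)) (use w r(1) in simp)
    also have "?this \<longleftrightarrow> ((\<lambda>\<alpha>. mfps_nth (F $ i) \<alpha> * monomial (vupd 0 j w) \<alpha>) has_sum g w) (range (\<lambda>k. (\<lambda>_. 0)(j := k)))"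
    proof (rule has_sum_cong_neutral)
      fix \<alpha> assume \<alpha>: "\<alpha> \<in> UNIV - range (\<lambda>k. (\<lambda>_. 0 :: nat)(j := k))"
      have "\<exists>l. l \<noteq> j \<and> \<alpha> l \<noteq> 0"
      proof (rule ccontr)
        assume "\<not> ?thesis"
        then have "\<alpha> = (\<lambda>_. 0)(j := \<alpha> j)" by (auto simp: fun_eq_iff)
        with \<alpha> show False by blast
      qed
      then obtain l where "l \<noteq> j" "\<alpha> l \<noteq> 0" by blast
      then have "monomial (vupd 0 j w) \<alpha> = 0"
        unfolding monomial_def by (intro prod_zero bexI[of _ l]) (auto simp: zero_power)
      then show "mfps_nth (F $ i) \<alpha> * monomial (vupd 0 j w) \<alpha> = 0" by simp
    qed auto
    also have "\<dots> \<longleftrightarrow> ((\<lambda>k. mfps_nth (F $ i) ((\<lambda>_. 0)(j := k)) * monomial (vupd 0 j w) ((\<lambda>_. 0)(j := k))) has_sum g w) UNIV"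
    proof (subst has_sum_reindex)
      show "inj (\<lambda>k. (\<lambda>_. 0 :: nat)(j := k))" by (rule injI) (metis fun_upd_same)
    qed (simp add: o_def)
    also have "(\<lambda>k. mfps_nth (F $ i) ((\<lambda>_. 0)(j := k)) * monomial (vupd 0 j w) ((\<lambda>_. 0)(j := k))) = (\<lambda>k. b k * w ^ k)"
    proof
      fix k
      have "monomial (vupd (0 :: complex ^ 'n) j w) ((\<lambda>_. 0)(j := k)) = w ^ k * monomial (0 :: complex ^ 'n) (\<lambda>_. 0)"
        by (rule monomial_upd) simp
      then show "mfps_nth (F $ i) ((\<lambda>_. 0)(j := k)) * monomial (vupd 0 j w) ((\<lambda>_. 0)(j := k)) = b k * w ^ k"
        by (simp add: b_def monomial_def)
    qed
    finally show ?thesis by (rule has_sum_imp_sums)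
  qed
  have g0: "g 0 = 0"
  proof -
    have "vupd 0 j 0 = (0 :: complex ^ 'n)" by (simp add: vec_eq_iff)
    then show ?thesis by (simp add: g_def f0)
  qed
  have b0: "b 0 = 0"
    using sums[of 0] r(1) g0 powser_sums_zero[of b] sums_unique2 by fastforce
  have gb: "cmod (g w) \<le> C * cmod w ^ 2" if w: "cmod w < r" for w
  proof -
    have "norm (f (vupd 0 j w)) \<le> C * norm (vupd (0 :: complex ^ 'n) j w) ^ 2"
      by (rule r(3)) (use w r(1) in simp)
    moreover have "norm (vupd (0 :: complex ^ 'n) j w) \<le> cmod w"
    proof -
      have "norm (vupd (0 :: complex ^ 'n) j w) \<le> (\<Sum>k\<in>UNIV. cmod (vupd 0 j w $ k))"
        unfolding norm_vec_def by (rule L2_set_le_sum) auto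
      also have "\<dots> = (\<Sum>k\<in>UNIV. if k = j then cmod w else 0)" by (intro sum.cong) auto
      finally show ?thesis by simp
    qed
    then have "C * norm (vupd (0 :: complex ^ 'n) j w) ^ 2 \<le> C * cmod w ^ 2"
      using C(1) by (intro mult_left_mono power_mono) auto
    moreover have "cmod (g w) \<le> norm (f (vupd 0 j w))" unfolding g_def by (rule Finite_Cartesian_Product.norm_nth_le)
    ultimately show ?thesis by linarith
  qed
  have "b 1 = 0"
  proof (rule ccontr)
    assume "b 1 \<noteq> 0"
    have "((\<lambda>w. \<Sum>k. b k * w ^ k) has_field_derivative (\<Sum>k. diffs b k * 0 ^ k)) (at 0)"
    proof (rule termdiffs_strong)
      show "summable (\<lambda>k. b k * complex_of_real (r / 2) ^ k)"
        by (rule sums_summable[OF sums]) (use r(1) in \<open>simp add: norm_divide\<close>)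
      show "cmod 0 < cmod (complex_of_real (r / 2))" using r(1) by simp
    qed
    then have "((\<lambda>w. \<Sum>k. b k * w ^ k) has_field_derivative b 1) (at 0)" by (simp add: diffs_def)
    then have "(g has_field_derivative b 1) (at 0)"
    proof (rule has_field_derivative_transform_within_open)
      show "(\<Sum>k. b k * w ^ k) = g w" if "w \<in> ball 0 r" for w
        using sums_unique[OF sums] that by simp
    qed (use r(1) in auto)
    then have "((\<lambda>w. g w / w) \<longlongrightarrow> b 1) (at 0)" by (simp add: has_field_derivative_iff g0)
    moreover have "((\<lambda>w. g w / w) \<longlongrightarrow> 0) (at 0)"
    proof (rule Lim_null_comparison)
      have "\<forall>\<^sub>F w in at 0. w \<in> ball 0 r" using r(1) by (intro eventually_at_in_open') auto
      then show "\<forall>\<^sub>F w in at 0. cmod (g w / w) \<le> C * cmod w"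
      proof eventually_elim
        case (elim w)
        then show ?case using gb[of w] C(1)
          by (cases "w = 0") (simp_all add: norm_divide divide_le_eq power2_eq_square mult.assoc)
      qed
      show "((\<lambda>w :: complex. C * cmod w) \<longlongrightarrow> 0) (at 0)"
        by (intro tendsto_mult_right_zero tendsto_norm_zero tendsto_ident_at)
    qed
    ultimately show False using \<open>b 1 \<noteq> 0\<close> LIM_unique by blast
  qed
  with b0 show "mfps_nth (F $ i) (\<lambda>_. 0) = 0" "mfps_nth (F $ i) ((\<lambda>_. 0)(j := 1)) = 0"
    by (simp_all add: b_def fun_upd_idem)
qed

section \<open>Convergence and geometric bounds on coefficients\<close>

text \<open>Absolute summability at the single point (s, ..., s) bounds every term, and there a
  monomial has modulus s to the power of its degree. The choices s \<le> 1 and K \<ge> 1 make both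
  constants at least 1.\<close>

lemma expansion_coefficient_bound:
  fixes h :: "(complex, 'n::finite) mfps ^ 'n"
  assumes "H has_mfps_expansion h"
  shows "\<exists>M N. M \<ge> 1 \<and> N \<ge> 1 \<and> (\<forall>i \<alpha>. cmod (mfps_nth (h $ i) \<alpha>) \<le> M * N ^ sum \<alpha> UNIV)"
proof -
  obtain r where r: "r > 0"
    "\<And>z i. (\<forall>j. cmod (z $ j) < r) \<Longrightarrow> ((\<lambda>\<alpha>. mfps_nth (h $ i) \<alpha> * monomial z \<alpha>) has_sum H z $ i) UNIV"
    using assms unfolding has_mfps_expansion_def eventually_nhds_polydisc by blast
  define s where "s = min 1 (r / 2)"
  have s: "0 < s" "s < r" "s \<le> 1" using r(1) by (auto simp: s_def)
  define z where "z = ((\<chi> j. complex_of_real s) :: complex ^ 'n)"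
  have mon: "cmod (monomial z \<alpha>) = s ^ sum \<alpha> UNIV" for \<alpha>
    using s by (simp add: monomial_def z_def norm_mult norm_power power_sum flip: prod_norm)
  define M where "M i = infsum (\<lambda>\<alpha>. norm (mfps_nth (h $ i) \<alpha> * monomial z \<alpha>)) UNIV" for i
  have bd: "cmod (mfps_nth (h $ i) \<alpha>) \<le> M i * (1 / s) ^ sum \<alpha> UNIV" for i \<alpha>
  proof -
    have "((\<lambda>\<alpha>. mfps_nth (h $ i) \<alpha> * monomial z \<alpha>) has_sum H z $ i) UNIV"
      by (rule r(2)) (use s in \<open>simp add: z_def\<close>)
    then have "(\<lambda>\<alpha>. mfps_nth (h $ i) \<alpha> * monomial z \<alpha>) summable_on UNIV"
      unfolding summable_on_def by (rule exI)
    then have "(\<lambda>\<alpha>. norm (mfps_nth (h $ i) \<alpha> * monomial z \<alpha>)) summable_on UNIV"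
      by (rule summable_on_iff_abs_summable_on_complex[THEN iffD1])
    then have "(\<Sum>\<beta>\<in>{\<alpha>}. norm (mfps_nth (h $ i) \<beta> * monomial z \<beta>)) \<le> M i"
      unfolding M_def by (rule finite_sum_le_infsum) auto
    then have "cmod (mfps_nth (h $ i) \<alpha>) * s ^ sum \<alpha> UNIV \<le> M i" by (simp add: norm_mult mon)
    then show ?thesis using s by (simp add: power_one_over field_simps)
  qed
  have M0: "M i \<ge> 0" for i unfolding M_def by (rule infsum_nonneg) auto
  define K where "K = 1 + (\<Sum>i\<in>UNIV. M i)"
  have "M i \<le> K" for i
    unfolding K_def using member_le_sum[of i UNIV M] M0 by auto
  then have "cmod (mfps_nth (h $ i) \<alpha>) \<le> K * (1 / s) ^ sum \<alpha> UNIV" for i \<alpha>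
    using order_trans[OF bd mult_right_mono] s by simp
  moreover have "K \<ge> 1" using M0 by (simp add: K_def sum_nonneg)
  moreover have "1 / s \<ge> 1" using s by simp
  ultimately show ?thesis by blast
qed

lemma geometric_abs_summable:
  fixes z :: "complex ^ 'n"
  assumes bd: "\<And>\<alpha>. cmod (c \<alpha>) \<le> K * \<rho> ^ sum \<alpha> UNIV" and z: "\<And>j. \<rho> * cmod (z $ j) < 1" and "\<rho> \<ge> 0"
  shows "(\<lambda>\<alpha>. norm (c \<alpha> * monomial z \<alpha>)) summable_on UNIV"
proof (rule summable_on_comparison_test)
  show "(\<lambda>\<alpha>. K * (\<Prod>j\<in>UNIV. (\<rho> * cmod (z $ j)) ^ \<alpha> j)) summable_on UNIV"
    using assms by (intro summable_on_cmult_right summable_on_monomials) auto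
  fix \<alpha> :: "'n \<Rightarrow> nat"
  have "norm (c \<alpha> * monomial z \<alpha>) = cmod (c \<alpha>) * (\<Prod>j\<in>UNIV. cmod (z $ j) ^ \<alpha> j)"
    by (simp add: norm_mult monomial_def norm_power flip: prod_norm)
  also have "\<dots> \<le> K * \<rho> ^ sum \<alpha> UNIV * (\<Prod>j\<in>UNIV. cmod (z $ j) ^ \<alpha> j)"
    by (intro mult_right_mono bd prod_nonneg) auto
  also have "\<dots> = K * (\<Prod>j\<in>UNIV. (\<rho> * cmod (z $ j)) ^ \<alpha> j)"
    by (simp add: power_mult_distrib prod.distrib power_sum)
  finally show "norm (c \<alpha> * monomial z \<alpha>) \<le> K * (\<Prod>j\<in>UNIV. (\<rho> * cmod (z $ j)) ^ \<alpha> j)" .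
qed simp

lemma mfps_conv_radius_ge:
  fixes h :: "(complex, 'n::finite) mfps ^ 'n"
  assumes bd: "\<And>i \<alpha>. cmod (mfps_nth (h $ i) \<alpha>) \<le> K * \<rho> ^ sum \<alpha> UNIV" and \<rho>: "\<rho> > 0"
  shows "mfps_conv_radius h \<ge> ereal (1 / \<rho>)"
proof -
  have "(\<lambda>\<alpha>. mfps_nth (h $ i) \<alpha> * monomial z \<alpha>) summable_on UNIV" if z: "norm z < 1 / \<rho>" for z i
  proof (rule abs_summable_summable, rule geometric_abs_summable[OF bd])
    fix j
    have "cmod (z $ j) < 1 / \<rho>" using z Finite_Cartesian_Product.norm_nth_le[of z j] by linarith
    then show "\<rho> * cmod (z $ j) < 1" using \<rho> by (simp add: field_simps)
  qed (use \<rho> in simp)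
  then show ?thesis
    unfolding mfps_conv_radius_def using \<rho> by (intro Sup_upper CollectI exI[of _ "1 / \<rho>"]) auto
qed

section \<open>Termwise differentiation and the inverse germ\<close>

definition monomial_deriv :: "complex ^ 'n \<Rightarrow> ('n \<Rightarrow> nat) \<Rightarrow> 'n \<Rightarrow> complex" where
  "monomial_deriv z \<alpha> j = of_nat (\<alpha> j) * (z $ j) ^ (\<alpha> j - 1) * (\<Prod>i\<in>UNIV - {j}. (z $ i) ^ \<alpha> i)"

lemma has_derivative_monomial:
  "((\<lambda>z. monomial z \<alpha>) has_derivative (\<lambda>v. \<Sum>j\<in>UNIV. monomial_deriv z \<alpha> j * v $ j)) (at z within S)"
proof -
  have "((\<lambda>z. \<Prod>j\<in>UNIV. (z $ j) ^ \<alpha> j) has_derivative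
      (\<lambda>v. \<Sum>j\<in>UNIV. (of_nat (\<alpha> j) * v $ j * (z $ j) ^ (\<alpha> j - 1)) * (\<Prod>i\<in>UNIV - {j}. (z $ i) ^ \<alpha> i))) (at z within S)"
    by (intro has_derivative_prod has_derivative_power bounded_linear_imp_has_derivative bounded_linear_vec_nth)
  then show ?thesis by (simp add: monomial_def monomial_deriv_def mult_ac)
qed

text \<open>Multiplication by r restores the full degree, and the factor \<open>\<alpha> j\<close>
  is at most 2 to the power of that degree, hence the doubled radius.\<close>

lemma monomial_deriv_bound:
  fixes z :: "complex ^ 'n"
  assumes "\<And>j. cmod (z $ j) \<le> r"
  shows "r * cmod (monomial_deriv z \<alpha> j) \<le> (2 * r) ^ sum \<alpha> UNIV"
proof (cases "\<alpha> j = 0")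
  case True
  have "r \<ge> 0" using assms norm_ge_zero order_trans by blast
  then show ?thesis using True by (simp add: monomial_deriv_def)
next
  case False
  have r: "r \<ge> 0" using assms norm_ge_zero order_trans by blast
  have s: "sum \<alpha> UNIV = \<alpha> j + sum \<alpha> (UNIV - {j})" by (simp add: sum.remove[of UNIV j])
  have "cmod (monomial_deriv z \<alpha> j) =
      of_nat (\<alpha> j) * cmod (z $ j) ^ (\<alpha> j - 1) * (\<Prod>i\<in>UNIV - {j}. cmod (z $ i) ^ \<alpha> i)"
    by (simp add: monomial_deriv_def norm_mult norm_power flip: prod_norm)
  also have "\<dots> \<le> of_nat (\<alpha> j) * r ^ (\<alpha> j - 1) * (\<Prod>i\<in>UNIV - {j}. r ^ \<alpha> i)"
    using r assms by (intro mult_mono mult_left_mono power_mono prod_mono conjI prod_nonneg mult_nonneg_nonneg) auto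
  also have "(\<Prod>i\<in>UNIV - {j}. r ^ \<alpha> i) = r ^ sum \<alpha> (UNIV - {j})" by (simp add: power_sum)
  finally have "r * cmod (monomial_deriv z \<alpha> j) \<le> r * (of_nat (\<alpha> j) * r ^ (\<alpha> j - 1) * r ^ sum \<alpha> (UNIV - {j}))"
    using r by (rule mult_left_mono)
  also have "\<dots> = of_nat (\<alpha> j) * r ^ sum \<alpha> UNIV"
  proof -
    obtain m where "\<alpha> j = Suc m" using False by (cases "\<alpha> j") auto
    then show ?thesis by (simp add: s power_add mult_ac)
  qed
  also have "\<dots> \<le> 2 ^ sum \<alpha> UNIV * r ^ sum \<alpha> UNIV"
  proof (rule mult_right_mono)
    have "real (\<alpha> j) \<le> 2 ^ \<alpha> j" using of_nat_less_two_power[of "\<alpha> j"] by (rule less_imp_le)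
    also have "\<dots> \<le> 2 ^ sum \<alpha> UNIV" using s by (intro power_increasing) auto
    finally show "real (\<alpha> j) \<le> 2 ^ sum \<alpha> UNIV" .
  qed (use r in simp)
  finally show ?thesis by (simp add: power_mult_distrib)
qed

lemma monomial_deriv_0: "monomial_deriv 0 \<alpha> j = (if \<alpha> = (\<lambda>_. 0)(j := 1) then 1 else 0)"
proof (cases "\<alpha> = (\<lambda>_. 0)(j := 1)")
  case True
  then show ?thesis by (simp add: monomial_deriv_def)
next
  case False
  consider "\<alpha> j = 0" | "\<alpha> j \<ge> 2" | "\<alpha> j = 1" by linarith
  then show ?thesis
  proof cases
    case 3
    have "\<exists>i. i \<noteq> j \<and> \<alpha> i \<noteq> 0"
    proof (rule ccontr)
      assume "\<not> (\<exists>i. i \<noteq> j \<and> \<alpha> i \<noteq> 0)"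
      then have "\<alpha> x = ((\<lambda>_. 0)(j := 1)) x" for x using 3 by (cases "x = j") auto
      then have "\<alpha> = (\<lambda>_. 0)(j := 1)" by (rule ext)
      with False show False by contradiction
    qed
    then obtain i where "i \<noteq> j" "\<alpha> i \<noteq> 0" by blast
    then have "(\<Prod>i\<in>UNIV - {j}. ((0 :: complex ^ 'a) $ i) ^ \<alpha> i) = 0"
      by (intro prod_zero bexI[of _ i]) (auto simp: zero_power)
    with False show ?thesis by (simp add: monomial_deriv_def)
  qed (use False in \<open>simp_all add: monomial_deriv_def zero_power\<close>)
qed

lemma countable_index_enum:
  obtains e :: "nat \<Rightarrow> 'n::finite \<Rightarrow> nat" where "bij e"
proof -
  have "inj (\<lambda>k. (\<lambda>_. k) :: 'n \<Rightarrow> nat)" by (rule injI) metis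
  then have "infinite (UNIV :: ('n \<Rightarrow> nat) set)"
    using range_inj_infinite infinite_super subset_UNIV by blast
  then show ?thesis using that bij_betw_from_nat_into countableI_type by blast
qed

lemma bounded_linear_matrix: "bounded_linear ((*v) (A :: complex ^ 'n ^ 'n))"
  unfolding linear_conv_bounded_linear[symmetric]
  by (rule linearI) (auto simp: vec_eq_iff matrix_vector_mult_def distrib_left sum.distrib scaleR_sum_right)

text \<open>Multi-indices are enumerated by naturals so that the theorem on differentiating a series
  of functions applies. The derivative is delivered as a matrix, i.e. complex-linear, with
  continuous entries, as needed for inverting the germ.\<close>

lemma geometric_series_differentiable:
  fixes c :: "'n::finite \<Rightarrow> ('n \<Rightarrow> nat) \<Rightarrow> complex"
  assumes bd: "\<And>i \<alpha>. cmod (c i \<alpha>) \<le> K * \<rho> ^ sum \<alpha> UNIV" and \<rho>: "\<rho> > 0" and c0: "\<And>i. c i (\<lambda>_. 0) = 0"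
  obtains g J r where "r > 0"
    "\<And>z i. z \<in> ball 0 r \<Longrightarrow> ((\<lambda>\<alpha>. c i \<alpha> * monomial z \<alpha>) has_sum g z $ i) UNIV"
    "\<And>z. z \<in> ball 0 r \<Longrightarrow> (g has_derivative (\<lambda>v. J z *v v)) (at z)"
    "\<And>i j. continuous_on (ball 0 r) (\<lambda>z. J z $ i $ j)"
    "\<And>i j. J 0 $ i $ j = c i ((\<lambda>_. 0)(j := 1))"
proof -
  obtain e :: "nat \<Rightarrow> 'n \<Rightarrow> nat" where e: "bij e" by (rule countable_index_enum)
  \<comment> \<open>With this radius 2 \<rho> r = 1/2, which is the ratio in the majorant
    \<open>B\<close> of the differentiated terms.\<close>
  define r where "r = 1 / (4 * \<rho>)"
  have r: "r > 0" "\<rho> * r = 1 / 4" using \<rho> by (auto simp: r_def)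
  define S where "S = ball (0 :: complex ^ 'n) r"
  have S: "convex S" "open S" "0 \<in> S" using r by (auto simp: S_def)
  have Sz: "cmod (z $ j) \<le> r" if "z \<in> S" for z j
    using that Finite_Cartesian_Product.norm_nth_le[of z j] by (simp add: S_def)
  have K: "K \<ge> 0" using order_trans[OF norm_ge_zero bd[of undefined "\<lambda>_. 0"]] by simp
  define B where "B \<alpha> = K / r * (1 / 2) ^ sum \<alpha> UNIV" for \<alpha> :: "'n \<Rightarrow> nat"
  have "(\<lambda>\<alpha> :: 'n \<Rightarrow> nat. K / r * (\<Prod>j\<in>UNIV. (1 / 2) ^ \<alpha> j)) summable_on UNIV"
    by (intro summable_on_cmult_right summable_on_monomials) auto
  then have "B summable_on UNIV" by (simp add: B_def[abs_def] power_sum)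
  then have "(\<lambda>k. B (e k)) summable_on UNIV" by (subst summable_on_reindex_bij_betw[OF e])
  then have B: "summable (\<lambda>k. B (e k))" by (rule summable_on_imp_summable)
  have dbd: "norm (c i \<alpha> * monomial_deriv z \<alpha> j) \<le> B \<alpha>" if "z \<in> S" for z i j \<alpha>
  proof -
    have "norm (c i \<alpha> * monomial_deriv z \<alpha> j) * r = cmod (c i \<alpha>) * (r * cmod (monomial_deriv z \<alpha> j))"
      by (simp add: norm_mult)
    also have "\<dots> \<le> (K * \<rho> ^ sum \<alpha> UNIV) * (2 * r) ^ sum \<alpha> UNIV"
      using K \<rho> r monomial_deriv_bound[OF Sz[OF that]] by (intro mult_mono bd) auto
    also have "\<dots> = K * (2 * (\<rho> * r)) ^ sum \<alpha> UNIV" by (simp add: power_mult_distrib mult_ac)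
    also have "2 * (\<rho> * r) = 1 / 2" using r(2) by simp
    also have "K * (1 / 2) ^ sum \<alpha> UNIV = B \<alpha> * r" using r(1) by (simp add: B_def)
    finally show ?thesis using r(1) by simp
  qed
  define J where "J z = (\<chi> i j. \<Sum>k. c i (e k) * monomial_deriv z (e k) j)" for z :: "complex ^ 'n"
  define tail where "tail n = (\<Sum>k. B (e (k + n)))" for n
  have tail_lim: "tail \<longlonglongrightarrow> 0" unfolding tail_def using B by (rule suminf_exist_split2)
  have tail: "cmod ((\<Sum>k<n. c i (e k) * monomial_deriv z (e k) j) - J z $ i $ j) \<le> tail n" if z: "z \<in> S" for z i j n
  proof -
    have sm: "summable (\<lambda>k. c i (e k) * monomial_deriv z (e k) j)"
      by (rule summable_comparison_test'[OF B]) (rule dbd[OF z])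
    have "J z $ i $ j - (\<Sum>k<n. c i (e k) * monomial_deriv z (e k) j) =
        (\<Sum>k. c i (e (k + n)) * monomial_deriv z (e (k + n)) j)"
      unfolding J_def using suminf_minus_initial_segment[OF sm] by simp
    also have "cmod \<dots> \<le> tail n"
      unfolding tail_def by (rule norm_suminf_le[OF dbd[OF z] summable_ignore_initial_segment[OF B]])
    finally show ?thesis by (simp add: norm_minus_commute)
  qed
  define f where "f k z = (\<chi> i. c i (e k) * monomial z (e k))" for k and z :: "complex ^ 'n"
  define f' where "f' k z v = (\<chi> i. \<Sum>j\<in>UNIV. c i (e k) * monomial_deriv z (e k) j * v $ j)" for k and z v :: "complex ^ 'n"
  have f_deriv: "(f k has_derivative f' k z) (at z within S)" for k z
  proof -
    have "f k = (\<lambda>z. \<Sum>i\<in>UNIV. vupd 0 i (c i (e k) * monomial z (e k)))"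
      unfolding sum_vupd_0 by (simp add: fun_eq_iff f_def)
    moreover have "f' k z = (\<lambda>v. \<Sum>i\<in>UNIV. vupd 0 i (c i (e k) * (\<Sum>j\<in>UNIV. monomial_deriv z (e k) j * v $ j)))"
      unfolding sum_vupd_0 by (simp add: fun_eq_iff f'_def sum_distrib_left mult.assoc)
    moreover have "((\<lambda>z. \<Sum>i\<in>UNIV. vupd 0 i (c i (e k) * monomial z (e k))) has_derivative
        (\<lambda>v. \<Sum>i\<in>UNIV. vupd 0 i (c i (e k) * (\<Sum>j\<in>UNIV. monomial_deriv z (e k) j * v $ j)))) (at z within S)"
      by (intro has_derivative_sum bounded_linear.has_derivative[OF bounded_linear_vupd]
          has_derivative_mult_right has_derivative_monomial)
    ultimately show ?thesis by simp
  qed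
  have "\<exists>g. \<forall>z\<in>S. (\<lambda>k. f k z) sums g z \<and> (g has_derivative (\<lambda>v. J z *v v)) (at z within S)"
  proof (rule has_derivative_series[OF S(1) f_deriv _ S(3)])
    \<comment> \<open>The norm of a vector is at most the sum of its entries, and each entry of the
      error is a sum over the columns: two factors CARD('n).\<close>
    fix \<epsilon> :: real assume \<epsilon>: "\<epsilon> > 0"
    have "\<forall>\<^sub>F n in sequentially. tail n < \<epsilon> / (CARD('n) * CARD('n))"
      using tail_lim by (rule order_tendstoD(2)) (use \<epsilon> in simp)
    then show "\<forall>\<^sub>F n in sequentially. \<forall>z\<in>S. \<forall>v. norm ((\<Sum>k<n. f' k z v) - J z *v v) \<le> \<epsilon> * norm v"
    proof eventually_elim
      case (elim n)
      show ?case
      proof (intro ballI allI)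
        fix z v :: "complex ^ 'n" assume z: "z \<in> S"
        have comp: "cmod (((\<Sum>k<n. f' k z v) - J z *v v) $ i) \<le> CARD('n) * (tail n * norm v)" for i
        proof -
          have "((\<Sum>k<n. f' k z v) - J z *v v) $ i =
              (\<Sum>j\<in>UNIV. ((\<Sum>k<n. c i (e k) * monomial_deriv z (e k) j) - J z $ i $ j) * v $ j)"
          proof -
            have "(\<Sum>k<n. f' k z v) $ i = (\<Sum>k<n. \<Sum>j\<in>UNIV. c i (e k) * monomial_deriv z (e k) j * v $ j)"
              by (simp add: f'_def)
            also have "\<dots> = (\<Sum>j\<in>UNIV. \<Sum>k<n. c i (e k) * monomial_deriv z (e k) j * v $ j)" by (rule sum.swap)
            finally show ?thesis
              by (simp add: matrix_vector_mult_def left_diff_distrib sum_subtractf sum_distrib_right)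
          qed
          also have "cmod \<dots> \<le> (\<Sum>j\<in>(UNIV :: 'n set). tail n * norm v)"
          proof (rule sum_norm_le)
            fix j
            show "cmod (((\<Sum>k<n. c i (e k) * monomial_deriv z (e k) j) - J z $ i $ j) * v $ j) \<le> tail n * norm v"
              unfolding norm_mult
              using order_trans[OF norm_ge_zero tail[OF z, of i j n]]
              by (intro mult_mono tail[OF z] Finite_Cartesian_Product.norm_nth_le) auto
          qed
          finally show ?thesis by simp
        qed
        have "norm ((\<Sum>k<n. f' k z v) - J z *v v) \<le> (\<Sum>i\<in>UNIV. cmod (((\<Sum>k<n. f' k z v) - J z *v v) $ i))"
          unfolding norm_vec_def by (rule L2_set_le_sum) auto
        also have "\<dots> \<le> (\<Sum>i\<in>(UNIV :: 'n set). CARD('n) * (tail n * norm v))" by (intro sum_mono comp)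
        also have "\<dots> = (CARD('n) * CARD('n)) * tail n * norm v" by simp
        also have "\<dots> \<le> \<epsilon> * norm v"
          using elim by (intro mult_right_mono) (simp_all add: field_simps)
        finally show "norm ((\<Sum>k<n. f' k z v) - J z *v v) \<le> \<epsilon> * norm v" .
      qed
    qed
  next
    have "c i (e k) * monomial 0 (e k) = 0" for i k
    proof (cases "e k = (\<lambda>_. 0)")
      case False
      then obtain j where "e k j \<noteq> 0" by (auto simp: fun_eq_iff)
      then have "monomial (0 :: complex ^ 'n) (e k) = 0"
        unfolding monomial_def by (intro prod_zero bexI[of _ j]) (auto simp: zero_power)
      then show ?thesis by simp
    qed (simp add: c0)
    then have "f k 0 = 0" for k by (simp add: f_def vec_eq_iff)
    then show "(\<lambda>k. f k 0) sums 0" by simp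
  qed
  then obtain g where g: "\<And>z. z \<in> S \<Longrightarrow> (\<lambda>k. f k z) sums g z"
    "\<And>z. z \<in> S \<Longrightarrow> (g has_derivative (\<lambda>v. J z *v v)) (at z within S)" by blast
  have 1: "((\<lambda>\<alpha>. c i \<alpha> * monomial z \<alpha>) has_sum g z $ i) UNIV" if z: "z \<in> S" for z i
  proof -
    have "\<rho> * cmod (z $ j) < 1" for j
    proof -
      have "\<rho> * cmod (z $ j) \<le> \<rho> * r" using \<rho> Sz[OF z] by (intro mult_left_mono) auto
      then show ?thesis using r by simp
    qed
    then have "(\<lambda>\<alpha>. norm (c i \<alpha> * monomial z \<alpha>)) summable_on UNIV"
      by (intro geometric_abs_summable[OF bd]) (use \<rho> in auto)
    then have "(\<lambda>\<alpha>. c i \<alpha> * monomial z \<alpha>) summable_on UNIV" by (rule abs_summable_summable)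
    then obtain s where s: "((\<lambda>\<alpha>. c i \<alpha> * monomial z \<alpha>) has_sum s) UNIV"
      unfolding summable_on_def by (rule exE)
    then have "((\<lambda>k. c i (e k) * monomial z (e k)) has_sum s) UNIV"
      by (subst has_sum_reindex_bij_betw[OF e])
    then have "(\<lambda>k. c i (e k) * monomial z (e k)) sums s" by (rule has_sum_imp_sums)
    moreover have "(\<lambda>k. f k z $ i) sums (g z $ i)"
      by (rule bounded_linear.sums[OF bounded_linear_vec_nth g(1)[OF z]])
    then have "(\<lambda>k. c i (e k) * monomial z (e k)) sums (g z $ i)" by (simp add: f_def)
    ultimately have "s = g z $ i" by (rule sums_unique2)
    with s show ?thesis by simp
  qed
  have 2: "(g has_derivative (\<lambda>v. J z *v v)) (at z)" if "z \<in> S" for z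
    using g(2)[OF that] at_within_open[OF that S(2)] by simp
  have 3: "continuous_on S (\<lambda>z. J z $ i $ j)" for i j
  proof (rule uniform_limit_theorem)
    show "\<forall>\<^sub>F n in sequentially. continuous_on S (\<lambda>z. \<Sum>k<n. c i (e k) * monomial_deriv z (e k) j)"
      unfolding monomial_deriv_def by (intro always_eventually allI continuous_intros)
    show "uniform_limit S (\<lambda>n z. \<Sum>k<n. c i (e k) * monomial_deriv z (e k) j) (\<lambda>z. J z $ i $ j) sequentially"
    proof (rule uniform_limitI)
      fix \<epsilon> :: real assume "\<epsilon> > 0"
      then have "\<forall>\<^sub>F n in sequentially. tail n < \<epsilon>" using tail_lim by (intro order_tendstoD(2)) auto
      then show "\<forall>\<^sub>F n in sequentially. \<forall>z\<in>S. dist (\<Sum>k<n. c i (e k) * monomial_deriv z (e k) j) (J z $ i $ j) < \<epsilon>"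
      proof eventually_elim
        case (elim n)
        show ?case unfolding dist_norm using le_less_trans[OF tail elim] by blast
      qed
    qed
  qed simp
  have 4: "J 0 $ i $ j = c i ((\<lambda>_. 0)(j := 1))" for i j
  proof -
    obtain k0 where k0: "e k0 = (\<lambda>_. 0)(j := 1)" using bij_is_surj[OF e] by (metis surjD)
    have "(\<lambda>k. c i (e k) * monomial_deriv 0 (e k) j) = (\<lambda>k. if k = k0 then c i ((\<lambda>_. 0)(j := 1)) else 0)"
    proof
      fix k
      have "e k = (\<lambda>_. 0)(j := 1) \<longleftrightarrow> k = k0" using k0 bij_is_inj[OF e] by (metis injD)
      then show "c i (e k) * monomial_deriv 0 (e k) j = (if k = k0 then c i ((\<lambda>_. 0)(j := 1)) else 0)"
        unfolding monomial_deriv_0 using k0 by simp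
    qed
    moreover have "(\<lambda>k. if k = k0 then c i ((\<lambda>_. 0)(j := 1)) else 0) sums c i ((\<lambda>_. 0)(j := 1))"
      by (rule sums_single)
    ultimately show ?thesis by (simp add: J_def sums_iff)
  qed
  show ?thesis by (rule that[of r g J]) (use r(1) 1 2 3 4 in \<open>auto simp: S_def\<close>)
qed

text \<open>The sum has the identity as derivative at 0, so the inverse function theorem applies;
  what it leaves open is that the inverse is holomorphic, not just real differentiable.\<close>

lemma geometric_defines_diffeo_germ:
  fixes h :: "(complex, 'n::finite) mfps ^ 'n"
  assumes bd: "\<And>i \<alpha>. cmod (mfps_nth (h $ i) \<alpha>) \<le> K * \<rho> ^ sum \<alpha> UNIV" and \<rho>: "\<rho> > 0"
    and h0: "\<And>i. mfps_nth (h $ i) (\<lambda>_. 0) = 0"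
    and h1: "\<And>i j. mfps_nth (h $ i) ((\<lambda>_. 0)(j := 1)) = (if i = j then 1 else 0)"
  shows "defines_diffeo_germ h"
proof -
  obtain g J r where r: "r > 0"
    and g: "\<And>z i. z \<in> ball 0 r \<Longrightarrow> ((\<lambda>\<alpha>. mfps_nth (h $ i) \<alpha> * monomial z \<alpha>) has_sum g z $ i) UNIV"
    and der: "\<And>z. z \<in> ball 0 r \<Longrightarrow> (g has_derivative (\<lambda>v. J z *v v)) (at z)"
    and cont: "\<And>i j. continuous_on (ball 0 r) (\<lambda>z. J z $ i $ j)"
    and J0: "\<And>i j. J 0 $ i $ j = mfps_nth (h $ i) ((\<lambda>_. 0)(j := 1))"
    by (rule geometric_series_differentiable[where c = "\<lambda>i. mfps_nth (h $ i)", OF bd \<rho> h0]) (rule that)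
  have ev_ball: "\<forall>\<^sub>F z in nhds (0 :: complex ^ 'n). z \<in> ball 0 r"
    using r by (intro eventually_nhds_in_open) auto
  have exp: "g has_mfps_expansion h"
    unfolding has_mfps_expansion_def using ev_ball by eventually_elim (use g in blast)
  have hol: "holomorphic_germ g"
    unfolding holomorphic_germ_def using ev_ball by eventually_elim (use der in blast)
  have g0: "g 0 = 0"
  proof -
    have "g 0 $ i = 0" for i
    proof -
      have "mfps_nth (h $ i) \<alpha> * monomial 0 \<alpha> = 0" for \<alpha>
      proof (cases "\<alpha> = (\<lambda>_. 0)")
        case False
        then obtain j where "\<alpha> j \<noteq> 0" by (auto simp: fun_eq_iff)
        then have "monomial (0 :: complex ^ 'n) \<alpha> = 0"
          unfolding monomial_def by (intro prod_zero bexI[of _ j]) (auto simp: zero_power)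
        then show ?thesis by simp
      qed (simp add: h0)
      then have "((\<lambda>\<alpha>. mfps_nth (h $ i) \<alpha> * monomial 0 \<alpha>) has_sum 0) UNIV" by (simp add: has_sum_0)
      then show ?thesis using g[of 0 i] r has_sum_unique by auto
    qed
    then show ?thesis by (simp add: vec_eq_iff)
  qed
  define L where "L z = Blinfun ((*v) (J z))" for z
  have L: "blinfun_apply (L z) = (*v) (J z)" for z
    unfolding L_def by (rule bounded_linear_Blinfun_apply) (rule bounded_linear_matrix)
  have contL: "continuous_on (ball 0 r) L"
  proof (rule continuous_on_blinfun_componentwise)
    fix v :: "complex ^ 'n"
    show "continuous_on (ball 0 r) (\<lambda>z. blinfun_apply (L z) v)"
      unfolding L matrix_vector_mult_def
      by (intro continuous_on_vec_lambda continuous_on_sum continuous_on_mult continuous_on_const cont)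
  qed
  have "J 0 $ i $ j = mat 1 $ i $ j" for i j
    unfolding J0 h1 by (simp add: mat_def)
  then have "J 0 = mat 1" by (simp add: vec_eq_iff)
  then have inv0: "id_blinfun o\<^sub>L L 0 = id_blinfun"
    by (intro blinfun_eqI) (simp add: L)
  have der': "(g has_derivative blinfun_apply (L z)) (at z)" if "z \<in> ball 0 r" for z
    using der[OF that] by (simp add: L)
  have "0 \<in> ball (0 :: complex ^ 'n) r" using r by simp
  have "\<exists>U V G G'. open U \<and> U \<subseteq> ball 0 r \<and> 0 \<in> U \<and> open V \<and> g 0 \<in> V \<and> homeomorphism U V g G \<and>
    (\<forall>y\<in>V. (G has_derivative G' y) (at y)) \<and> (\<forall>y\<in>V. G' y = inv (blinfun_apply (L (G y)))) \<and>
    (\<forall>y\<in>V. bij (blinfun_apply (L (G y))))"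
  proof (rule inverse_function_theorem[OF open_ball der' contL \<open>0 \<in> ball 0 r\<close> inv0], goal_cases)
    case (2 U V G G')
    then show ?case by (intro exI conjI ballI)
  qed
  then obtain U V G G' where UV: "open U" "U \<subseteq> ball 0 r" "0 \<in> U" "open V" "g 0 \<in> V" "homeomorphism U V g G"
    "\<And>y. y \<in> V \<Longrightarrow> (G has_derivative G' y) (at y)"
    "\<And>y. y \<in> V \<Longrightarrow> G' y = inv (blinfun_apply (L (G y)))"
    "\<And>y. y \<in> V \<Longrightarrow> bij (blinfun_apply (L (G y)))"
    by blast
  have "holomorphic_germ G"
    unfolding holomorphic_germ_def
  proof -
    \<comment> \<open>The inverse of a complex-linear bijection is again given by a complex
      matrix.\<close>
    have "\<exists>A :: complex ^ 'n ^ 'n. (G has_derivative (\<lambda>v. A *v v)) (at y)" if y: "y \<in> V" for y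
    proof -
      have "bij ((*v) (J (G y)))" using UV(9)[OF y] by (simp add: L)
      then have "invertible (J (G y))" by (simp add: invertible_eq_bij)
      note iv = matrix_inv_mult[OF this]
      have "inv ((*v) (J (G y))) = (*v) (matrix_inv (J (G y)))"
        by (rule inv_unique_comp) (auto simp: fun_eq_iff matrix_vector_mul_assoc iv)
      then show ?thesis using UV(7,8)[OF y] by (auto simp: L)
    qed
    moreover have "\<forall>\<^sub>F y in nhds 0. y \<in> V" using UV(4,5) g0 by (intro eventually_nhds_in_open) auto
    ultimately show "\<forall>\<^sub>F y in nhds 0. \<exists>A :: complex ^ 'n ^ 'n. (G has_derivative (\<lambda>v. A *v v)) (at y)"
      by (auto elim: eventually_mono)
  qed
  moreover have Gg: "G (g z) = z" if "z \<in> U" for z using UV(6) that by (simp add: homeomorphism_apply1)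
  moreover have gG: "g (G z) = z" if "z \<in> V" for z using UV(6) that by (simp add: homeomorphism_apply2)
  moreover have "G 0 = 0" using Gg[OF UV(3)] g0 by simp
  moreover have "\<forall>\<^sub>F z in nhds 0. z \<in> U \<and> z \<in> V"
    using UV g0 by (intro eventually_conj eventually_nhds_in_open) auto
  then have "\<forall>\<^sub>F z in nhds 0. G (g z) = z \<and> g (G z) = z" by eventually_elim (use Gg gG in blast)
  ultimately have "diffeo_germ g"
    unfolding diffeo_germ_def using hol g0 by blast
  with exp show ?thesis unfolding defines_diffeo_germ_def by blast
qed

section \<open>The dichotomy\<close>

lemma finite_multi_indices [simp]: "finite (multi_indices m d)"
proof (rule finite_subset)
  show "multi_indices m d \<subseteq> {i. \<forall>j. (j \<in> {..<m} \<longrightarrow> i j \<in> {..d}) \<and> (j \<notin> {..<m} \<longrightarrow> i j = 0)}"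
  proof (intro subsetI CollectI allI conjI impI)
    fix i j assume i: "i \<in> multi_indices m d"
    show "i j = 0" if "j \<notin> {..<m}" using i that by (simp add: multi_indices_def)
    show "i j \<in> {..d}" if "j \<in> {..<m}"
      using i member_le_sum[OF that, of i] by (simp add: multi_indices_def)
  qed
qed (intro finite_set_of_finite_funs, auto)

lemma has_mfps_expansion_linear: "(\<lambda>z. A *v z) has_mfps_expansion linear_mfps (A :: complex ^ 'n ^ 'n)"
  unfolding has_mfps_expansion_def
proof (intro always_eventually allI)
  fix z :: "complex ^ 'n" and i
  define e where "e = (\<lambda>j :: 'n. (\<lambda>_. 0 :: nat)(j := 1))"
  have inj: "inj e" by (rule injI) (simp add: e_def unit_index_eq_iff)
  show "((\<lambda>\<alpha>. mfps_nth (linear_mfps A $ i) \<alpha> * monomial z \<alpha>) has_sum (A *v z) $ i) UNIV"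
  proof (rule has_sum_finite_neutralI)
    have "monomial z (e j) = z $ j" for j
    proof -
      have "monomial z (e j) = (\<Prod>i\<in>UNIV. if i = j then z $ j else 1)"
        unfolding monomial_def by (intro prod.cong) (auto simp: e_def)
      then show ?thesis by simp
    qed
    then show "(A *v z) $ i = (\<Sum>\<alpha>\<in>range e. mfps_nth (linear_mfps A $ i) \<alpha> * monomial z \<alpha>)"
      unfolding sum.reindex[OF inj] comp_def unfolding e_def linear_mfps_nth(2)
      by (simp add: matrix_vector_mult_def)
  next
    fix \<alpha> assume "\<alpha> \<in> UNIV - range e"
    then have "\<alpha> \<noteq> (\<lambda>_. 0)(j := 1)" for j by (auto simp: e_def)
    then show "mfps_nth (linear_mfps A $ i) \<alpha> * monomial z \<alpha> = 0"
      by (simp add: linear_mfps_def)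
  qed auto
qed

lemma has_mfps_expansion_add:
  assumes "f has_mfps_expansion F" "g has_mfps_expansion G"
  shows "(\<lambda>z. f z + g z) has_mfps_expansion (F + G)"
  using assms unfolding has_mfps_expansion_def
proof eventually_elim
  case (elim z)
  then show ?case using has_sum_add by (fastforce simp: distrib_right)
qed

lemma has_mfps_expansion_cmult:
  assumes "f has_mfps_expansion F"
  shows "(\<lambda>z. c *s f z) has_mfps_expansion (mfps_const c *s F)"
  using assms unfolding has_mfps_expansion_def
proof eventually_elim
  case (elim z)
  show ?case
  proof
    fix i
    have "((\<lambda>\<alpha>. c * (mfps_nth (F $ i) \<alpha> * monomial z \<alpha>)) has_sum c * f z $ i) UNIV"
      using elim by (intro has_sum_cmult_right) (rule spec)
    then show "((\<lambda>\<alpha>. mfps_nth ((mfps_const c *s F) $ i) \<alpha> * monomial z \<alpha>) has_sum (c *s f z) $ i) UNIV"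
      by (simp add: mult.assoc)
  qed
qed

lemma has_mfps_expansion_sum:
  assumes "finite I" "\<And>i. i \<in> I \<Longrightarrow> f i has_mfps_expansion F i"
  shows "(\<lambda>z. \<Sum>i\<in>I. f i z) has_mfps_expansion (\<Sum>i\<in>I. F i)"
  using assms
proof induction
  case empty
  show ?case by (simp add: has_mfps_expansion_def has_sum_0)
next
  case (insert i I)
  then show ?case by (simp add: has_mfps_expansion_add)
qed

section \<open>The family and its coefficient bounds\<close>

definition family_mfps ::
    "complex ^ 'n ^ 'n \<Rightarrow> nat \<Rightarrow> nat \<Rightarrow> ((nat \<Rightarrow> nat) \<Rightarrow> (complex, 'n::finite) mfps ^ 'n) \<Rightarrow>
      (nat \<Rightarrow> complex) \<Rightarrow> (complex, 'n) mfps ^ 'n" where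
  "family_mfps A m d F t =
    linear_mfps A + (\<Sum>i\<in>multi_indices m d. mfps_const (\<Prod>j<m. t j ^ i j) *s F i)"

lemma mfps_nth_family:
  "mfps_nth (family_mfps A m d F t $ l) \<alpha> = mfps_nth (linear_mfps A $ l) \<alpha> +
    (\<Sum>i\<in>multi_indices m d. mfps_nth (F i $ l) \<alpha> * (\<Prod>j<m. t j ^ i j))"
  unfolding mult.commute[of _ "\<Prod>j<m. t j ^ _ j"] by (simp add: family_mfps_def sum_component)

lemma family_expansion:
  assumes "\<And>i. i \<in> multi_indices m d \<Longrightarrow> f i has_mfps_expansion F i"
  shows "family A m d f t has_mfps_expansion family_mfps A m d F t"
proof -
  have "family A m d f t = (\<lambda>z. A *v z + (\<Sum>i\<in>multi_indices m d. (\<Prod>j<m. t j ^ i j) *s f i z))"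
    by (simp add: fun_eq_iff family_def)
  then show ?thesis
    unfolding family_mfps_def
    using assms by (simp add: has_mfps_expansion_add has_mfps_expansion_linear has_mfps_expansion_sum
        has_mfps_expansion_cmult)
qed

text \<open>In order below 2 only the constant matrix \<open>A\<close> remains; in order at least 2
  the degree in \<open>t\<close> is at most d, which is at most d times the order minus 1.\<close>

lemma line_poly_family:
  assumes F0: "\<And>i l. i \<in> multi_indices m d \<Longrightarrow> mfps_nth (F i $ l) (\<lambda>_. 0) = 0"
    and F1: "\<And>i l j. i \<in> multi_indices m d \<Longrightarrow> mfps_nth (F i $ l) ((\<lambda>_. 0)(j := 1)) = 0"
  shows "line_poly (d * (sum \<alpha> UNIV - 1)) (\<lambda>t. mfps_nth (family_mfps A m d F t $ l) \<alpha>)"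
  unfolding mfps_nth_family
proof (intro line_poly_add line_poly_const line_poly_sum)
  fix i assume i: "i \<in> multi_indices m d"
  show "line_poly (d * (sum \<alpha> UNIV - 1)) (\<lambda>t. mfps_nth (F i $ l) \<alpha> * (\<Prod>j<m. t j ^ i j))"
  proof (cases "sum \<alpha> UNIV < 2")
    case True
    then have "mfps_nth (F i $ l) \<alpha> = 0"
      by (cases rule: degree_less_2_cases) (simp_all only: F0[OF i] F1[OF i])
    then show ?thesis by (simp add: line_poly_const)
  next
    case False
    have "(\<Sum>j<m. i j) \<le> d * 1" using i by (simp add: multi_indices_def)
    also have "d * 1 \<le> d * (sum \<alpha> UNIV - 1)" using False by (intro mult_le_mono2) simp
    finally show ?thesis by (rule line_poly_cmult[OF line_poly_mono[OF line_poly_monomial]])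
  qed
qed

text \<open>The norm involves only the first \<open>m\<close> coordinates, so it is continuous for
  the product topology.\<close>

lemma compact_cspace_norm_bounded:
  assumes "compact K"
  shows "\<exists>B\<ge>0. \<forall>t\<in>K. cspace_norm m t \<le> B"
proof -
  have "continuous_on K (cspace_norm m)"
    unfolding cspace_norm_def[abs_def] L2_set_def
    by (intro continuous_intros continuous_on_subset[OF continuous_on_product_coordinates]) auto
  then have "bounded (cspace_norm m ` K)"
    using assms by (intro compact_imp_bounded compact_continuous_image)
  then obtain B where "\<forall>t\<in>K. \<bar>cspace_norm m t\<bar> \<le> B" by (auto simp: bounded_iff)
  then show ?thesis by (intro exI[of _ "max 0 B"]) fastforce
qed

context nonresonant_matrix
begin

text \<open>Convergence at a parameter gives geometric coefficients there; positive Gamma-capacity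
  of these parameters spreads the bound to all of them.\<close>

lemma linearization_coefficient_bound:
  assumes "m \<ge> 1" and F: "\<And>t. tangent_to_A (F t)"
    and Fpoly: "\<And>i \<alpha>. line_poly (d * (sum \<alpha> UNIV - 1)) (\<lambda>t. mfps_nth (F t $ i) \<alpha>)"
    and h: "\<And>t. normalized_linearization (F t) (h t)"
    and cap: "Gamma_capacity m {t \<in> cspace m. defines_diffeo_germ (h t)} \<noteq> 0"
  shows "\<exists>C\<ge>1. \<forall>t\<in>cspace m. \<forall>i \<alpha>.
    cmod (mfps_nth (h t $ i) \<alpha>) \<le> (C * (1 + cspace_norm m t) ^ d) ^ sum \<alpha> UNIV"
proof -
  \<comment> \<open>The index is the degree minus 1, to match the degree \<open>d * k\<close> in
    \<open>t\<close>. At index 0 the bound required is 1, and the normalization supplies it, the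
    coefficients being 0 or 1.\<close>
  define S where "S = {(sum \<alpha> UNIV - 1, \<lambda>t. mfps_nth (h t $ i) \<alpha>) | i \<alpha>. True}"
  have S: "line_poly (d * k) Q" if "(k, Q) \<in> S" for k Q
    using that linearization_line_poly[OF F Fpoly h] by (auto simp: S_def)
  have geom: "geometric_at S t" if t: "t \<in> {t \<in> cspace m. defines_diffeo_germ (h t)}" for t
  proof -
    obtain H where H: "H has_mfps_expansion h t" using t by (auto simp: defines_diffeo_germ_def)
    obtain M N where MN: "M \<ge> 1" "N \<ge> 1"
      "\<And>i \<alpha>. cmod (mfps_nth (h t $ i) \<alpha>) \<le> M * N ^ sum \<alpha> UNIV"
      using expansion_coefficient_bound[OF H] by blast
    have "cmod (mfps_nth (h t $ i) \<alpha>) \<le> real (nat \<lceil>M * N\<^sup>2\<rceil>) ^ (sum \<alpha> UNIV - 1)" for i \<alpha>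
    proof (cases "sum \<alpha> UNIV < 2")
      case True
      then have "cmod (mfps_nth (h t $ i) \<alpha>) \<le> 1"
        by (cases rule: degree_less_2_cases) (simp_all only: normalized_linearizationD(1,2)[OF h], auto)
      moreover have "sum \<alpha> UNIV - 1 = 0" using True by simp
      ultimately show ?thesis by simp
    next
      case False
      define k where "k = sum \<alpha> UNIV - 1"
      have k: "sum \<alpha> UNIV = Suc k" "k \<ge> 1" using False by (auto simp: k_def)
      have "cmod (mfps_nth (h t $ i) \<alpha>) \<le> M * N ^ Suc k" using MN(3)[of i \<alpha>] k by simp
      \<comment> \<open>For k \<ge> 1 and constants at least 1, the prefactor and the surplus power
        can be absorbed, leaving a pure k-th power as \<open>geometric_at\<close> demands.\<close>
      also have "\<dots> \<le> M ^ k * N ^ (2 * k)"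
        using MN k by (intro mult_mono power_increasing self_le_power) auto
      also have "\<dots> = (M * N\<^sup>2) ^ k" by (simp add: power_mult_distrib power_mult)
      also have "\<dots> \<le> real (nat \<lceil>M * N\<^sup>2\<rceil>) ^ k"
        using MN by (intro power_mono) (auto intro: real_nat_ceiling_ge)
      finally show ?thesis by (simp add: k)
    qed
    then show ?thesis unfolding geometric_at_def S_def by (intro exI[of _ "nat \<lceil>M * N\<^sup>2\<rceil>"]) blast
  qed
  have "{t \<in> cspace m. defines_diffeo_germ (h t)} \<subseteq> cspace m" by blast
  from Gamma_capacity_bound[OF \<open>m \<ge> 1\<close> S this geom cap]
  obtain C where C: "C \<ge> 1"
    "\<And>k Q t. (k, Q) \<in> S \<Longrightarrow> t \<in> cspace m \<Longrightarrow> cmod (Q t) \<le> (C * (1 + cspace_norm m t) ^ d) ^ k"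
    by blast
  have "cmod (mfps_nth (h t $ i) \<alpha>) \<le> (C * (1 + cspace_norm m t) ^ d) ^ sum \<alpha> UNIV" if "t \<in> cspace m" for t i \<alpha>
  proof -
    have "(sum \<alpha> UNIV - 1, \<lambda>t. mfps_nth (h t $ i) \<alpha>) \<in> S" by (auto simp: S_def)
    then have "cmod (mfps_nth (h t $ i) \<alpha>) \<le> (C * (1 + cspace_norm m t) ^ d) ^ (sum \<alpha> UNIV - 1)"
      using that by (rule C(2))
    also have "\<dots> \<le> (C * (1 + cspace_norm m t) ^ d) ^ sum \<alpha> UNIV"
    proof (rule power_increasing)
      have "1 * 1 \<le> C * (1 + cspace_norm m t) ^ d" using C(1) by (intro mult_mono one_le_power) auto
      then show "1 \<le> C * (1 + cspace_norm m t) ^ d" by simp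
    qed simp
    finally show ?thesis .
  qed
  with C(1) show ?thesis by blast
qed

end

text \<open>Every admissible \<open>E\<close> contains the set of parameters with convergent
  linearization. If this set has Gamma-capacity 0 it serves as \<open>E\<close>; otherwise the
  coefficient bound holds at every parameter and yields all clauses of
  \<open>total_convergence\<close>.\<close>

theorem theorem1:
  fixes A :: "complex ^ 'n ^ 'n"
    and ev :: "'n \<Rightarrow> complex"
    and m d :: nat
    and f :: "(nat \<Rightarrow> nat) \<Rightarrow> complex ^ 'n \<Rightarrow> complex ^ 'n"
  assumes "m \<ge> 1"
    and "\<And>i. i \<in> multi_indices m d \<Longrightarrow> holomorphic_germ (f i)"
    and "\<And>i. i \<in> multi_indices m d \<Longrightarrow> f i 0 = 0"
    and "\<And>i. i \<in> multi_indices m d \<Longrightarrow> (\<lambda>z. norm (f i z)) \<in> O[at 0](\<lambda>z. norm z ^ 2)"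
    and "invertible A"
    and "eigenvalues_with_multiplicity A ev"
    and "non_resonant ev"
  defines "h \<equiv> \<lambda>t. linearization A (family A m d f t)"
  defines "total_convergence \<equiv>
      (\<forall>t\<in>cspace m. defines_diffeo_germ (h t)) \<and>
      (\<forall>K. compact K \<and> K \<subseteq> cspace m \<longrightarrow>
        (\<exists>c>0. \<forall>t\<in>K. mfps_conv_radius (h t) \<ge> ereal c)) \<and>
      (\<exists>C\<^sub>0>0. \<forall>t\<in>cspace m.
        mfps_conv_radius (h t) \<ge> ereal (C\<^sub>0 / (1 + cspace_norm m t) ^ max 1 d))"
    and "general_divergence \<equiv>
      (\<exists>E\<subseteq>cspace m. Gamma_capacity m E = 0 \<and>
        (\<forall>t\<in>cspace m - E. \<not> defines_diffeo_germ (h t)))"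
  shows "(\<forall>t\<in>cspace m. \<exists>!g. formal_linearization A (family A m d f t) g) \<and>
    (total_convergence \<or> general_divergence) \<and>
    \<not> (total_convergence \<and> general_divergence)"
proof -
  interpret nonresonant_matrix A ev by (intro nonresonant_matrix.intro assms(5-7))
  obtain F where F: "\<And>i. i \<in> multi_indices m d \<Longrightarrow> f i has_mfps_expansion F i"
    using holomorphic_germ_expansion[OF assms(2)] by metis
  note F0 = expansion_second_order(1)[OF F assms(3,4)] and F1 = expansion_second_order(2)[OF F assms(3,4)]
  define Ft where "Ft = family_mfps A m d F"
  have tangent: "tangent_to_A (Ft t)" for t
    unfolding tangent_to_A_def Ft_def mfps_nth_family linear_mfps_nth by (simp add: F0 F1[unfolded One_nat_def])
  have Fpoly: "line_poly (d * (sum \<alpha> UNIV - 1)) (\<lambda>t. mfps_nth (Ft t $ l) \<alpha>)" for l \<alpha>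
    unfolding Ft_def by (intro line_poly_family F0 F1)
  have formal_iff: "formal_linearization A (family A m d f t) g \<longleftrightarrow> normalized_linearization (Ft t) g" for t g
    using taylor_series_eq[OF family_expansion[OF F]]
    by (simp add: formal_linearization_def normalized_linearization_def Ft_def)
  have ex1: "\<exists>!g. formal_linearization A (family A m d f t) g" for t
    unfolding formal_iff
    using normalized_linearization_exists[OF tangent] normalized_linearization_unique[OF tangent] by blast
  have h: "normalized_linearization (Ft t) (h t)" for t
    using theI'[OF ex1[of t]] by (simp add: h_def linearization_def formal_iff)
  have "total_convergence" if "\<not> general_divergence"
  proof -
    have "Gamma_capacity m {t \<in> cspace m. defines_diffeo_germ (h t)} \<noteq> 0"
    proof
      assume "Gamma_capacity m {t \<in> cspace m. defines_diffeo_germ (h t)} = 0"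
      then have general_divergence
        unfolding general_divergence_def
        by (intro exI[of _ "{t \<in> cspace m. defines_diffeo_germ (h t)}"]) auto
      with that show False by contradiction
    qed
    from linearization_coefficient_bound[OF assms(1) tangent Fpoly h this]
    obtain C where C: "C \<ge> 1" and bound: "\<And>t i \<alpha>. t \<in> cspace m \<Longrightarrow>
        cmod (mfps_nth (h t $ i) \<alpha>) \<le> (C * (1 + cspace_norm m t) ^ d) ^ sum \<alpha> UNIV"
      by blast
    define \<rho> where "\<rho> t = C * (1 + cspace_norm m t) ^ d" for t
    have \<rho>: "\<rho> t > 0" for t
      unfolding \<rho>_def using C by (intro mult_pos_pos zero_less_power) (auto intro: add_pos_nonneg)
    have bd: "cmod (mfps_nth (h t $ i) \<alpha>) \<le> 1 * \<rho> t ^ sum \<alpha> UNIV" if "t \<in> cspace m" for t i \<alpha>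
      using bound[OF that] by (simp add: \<rho>_def)
    have "defines_diffeo_germ (h t)" if "t \<in> cspace m" for t
      using geometric_defines_diffeo_germ[OF bd[OF that] \<rho> normalized_linearizationD(1,2)[OF h]] .
    moreover have radius: "mfps_conv_radius (h t) \<ge> ereal ((1 / C) / (1 + cspace_norm m t) ^ max 1 d)"
      if "t \<in> cspace m" for t
    proof (rule order_trans[OF _ mfps_conv_radius_ge[OF bd[OF that] \<rho>]])
      \<comment> \<open>The exponents differ only for \<open>d = 0\<close>, where the coefficient
        bound does not depend on \<open>t\<close>.\<close>
      have "(1 + cspace_norm m t) ^ d \<le> (1 + cspace_norm m t) ^ max 1 d" by (intro power_increasing) auto
      then have "\<rho> t \<le> C * (1 + cspace_norm m t) ^ max 1 d" using C by (simp add: \<rho>_def)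
      then have "1 / (C * (1 + cspace_norm m t) ^ max 1 d) \<le> 1 / \<rho> t"
        using \<rho>[of t] by (intro frac_le) auto
      then show "ereal ((1 / C) / (1 + cspace_norm m t) ^ max 1 d) \<le> ereal (1 / \<rho> t)" by simp
    qed
    moreover have "\<exists>c>0. \<forall>t\<in>K. mfps_conv_radius (h t) \<ge> ereal c" if K: "compact K" "K \<subseteq> cspace m" for K
    proof -
      obtain B where B: "B \<ge> 0" "\<And>t. t \<in> K \<Longrightarrow> cspace_norm m t \<le> B"
        using compact_cspace_norm_bounded[OF K(1)] by blast
      have "mfps_conv_radius (h t) \<ge> ereal ((1 / C) / (1 + B) ^ max 1 d)" if t: "t \<in> K" for t
      proof (rule order_trans[OF _ radius])
        have "(1 + cspace_norm m t) ^ max 1 d \<le> (1 + B) ^ max 1 d" using B(2)[OF t] by (intro power_mono) auto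
        then show "ereal ((1 / C) / (1 + B) ^ max 1 d) \<le> ereal ((1 / C) / (1 + cspace_norm m t) ^ max 1 d)"
          unfolding ereal_less_eq using C B(1)
          by (intro divide_left_mono mult_pos_pos zero_less_power) (auto intro: add_pos_nonneg)
      qed (use K t in blast)
      moreover have "(1 / C) / (1 + B) ^ max 1 d > 0" using C B(1) by simp
      ultimately show ?thesis by blast
    qed
    moreover have "1 / C > 0" using C by simp
    ultimately show ?thesis unfolding total_convergence_def by blast
  qed
  then have "total_convergence \<or> general_divergence" by (rule disjCI)
  moreover have "\<not> (total_convergence \<and> general_divergence)"
  proof
    assume "total_convergence \<and> general_divergence"
    then have total_convergence general_divergence by simp_all
    from this(2) obtain E where E: "E \<subseteq> cspace m" "Gamma_capacity m E = 0"
      "\<forall>t\<in>cspace m - E. \<not> defines_diffeo_germ (h t)"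
      unfolding general_divergence_def by (elim exE conjE)
    moreover have "\<forall>t\<in>cspace m. defines_diffeo_germ (h t)"
      using \<open>total_convergence\<close> unfolding total_convergence_def by (rule conjunct1)
    \<comment> \<open>Convergence everywhere leaves no parameter outside \<open>E\<close>, so
      \<open>E\<close> would be the whole space, which has positive Gamma-capacity.\<close>
    ultimately have "E = cspace m" by blast
    with E(2) Gamma_capacity_cspace_pos[OF assms(1)] show False by simp
  qed
  ultimately show ?thesis using ex1 by simp
qed

end
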